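(* Let $\mathbb{K}$ be an algebraically closed field. (i) Property $C^d_m$ is true if $m\leq 2$ or if $d\leq 4$. (ii) Let $r\geq 2$ and $d\geq 3$ be integers with $r\leq 6$ or $d=4$. Then: (a) the Fano scheme $\mathbf{F}_k(X_{r,d})$ is one-split if and only if $k\geq \frac{r}{2}\cdot d$ (when $r$ is even), respectively $k\geq \frac{r-1}{2}\cdot d+1$ (when $r$ is odd); (b) if $r$ is even and $k\geq \frac{r}{2}\cdot d-1$, then the Fano scheme $\mathbf{F}_k(X_{r,d})$ is two-split.
   Context: $X_{r,d}=V\left(\sum_{i=1}^r\prod_{j=1}^d x_{ij}\right)\subset\mathbb{P}^{rd-1}$, where $x_{ij}$ ($1\le i\le r$, $1\le j\le d$) are the homogeneous coordinates on $\mathbb{P}^{rd-1}$ over $\mathbb{K}$. $\mathbf{F}_k(X)$ is the Fano scheme parametrizing projective $k$-planes ($k$-dimensional linear subspaces) contained in $X\subset \mathbb{P}^n$. Splitting: for an integer $\lambda\geq 1$, a $k$-plane $L\subset X_{r,d}$ admits a $\lambda$-splitting if there exist $1\leq a_1<\dots<a_\lambda\leq r$ such that $L\subset V\left(\sum_{i=1}^\lambda\prod_{j=1}^d x_{a_ij}\right)$. $\mathbf{F}_k(X_{r,d})$ is $m$-split if every $k$-plane contained in $X_{r,d}$ admits a $\lambda$-splitting for some $\lambda\leq m$ (one-split: $m=1$; two-split: $m=2$). Property $C^d_m$ (for integers $d>1$, $m\geq 1$): consider equations of degree $d$ forms $\boldsymbol{\ell}_1+\dots+\boldsymbol{\ell}_m=\sum_{i=0}^m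 f_i\mathbf{x}_i$ in some polynomial ring over $\mathbb{K}$, where the $\mathbf{x}_i$ are pairwise coprime squarefree monomials, each $\boldsymbol{\ell}_i$ is a product of $d$ linear forms (possibly $0$), and each $f_i$ is a product of $d-\deg\mathbf{x}_i$ linear forms (possibly $0$; necessarily $0$ if $\deg \mathbf{x}_i>d$). $C^d_m$ is true if for every such equation satisfying $\deg\mathbf{x}_i+\deg\mathbf{x}_j\geq d+2$ for all $i\neq j$, there is some $i$ with $f_i=0$. *)

theory Defs
  imports
    "HOL-Computational_Algebra.Computational_Algebra"
    "HOL-Library.Poly_Mapping"
    "HOL-Library.Function_Algebras"
begin

section \<open>Polynomials, products of linear forms and monomials\<close>

text \<open>
  Polynomials are finitely supported functions on exponent vectors, with their convolution product.
  The polynomial ring in \<open>n\<close> variables is the subring of polynomials involving only the variables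
  with index \<open>v < n\<close>; every polynomial in finitely many variables lives in one of these rings.
\<close>

type_synonym 'a mpoly = "(nat \<Rightarrow>\<^sub>0 nat) \<Rightarrow>\<^sub>0 'a"

definition linear_form :: "nat \<Rightarrow> 'a::comm_ring_1 mpoly \<Rightarrow> bool" where
  "linear_form n f \<longleftrightarrow>
     (\<exists>a. f = (\<Sum>v<n. Poly_Mapping.single (Poly_Mapping.single v 1) (a v)))"

text \<open>
  The scalar \<open>c\<close> only matters for \<open>e = 0\<close> (otherwise it can be absorbed into a factor): a
  product of zero linear forms is an arbitrary constant, \<open>0\<close> included.
\<close>

definition prod_of_linear_forms :: "nat \<Rightarrow> nat \<Rightarrow> 'a::comm_ring_1 mpoly \<Rightarrow> bool" where
  "prod_of_linear_forms n e f \<longleftrightarrow>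
     (\<exists>c l. (\<forall>j<e. linear_form n (l j)) \<and> f = Poly_Mapping.single 0 c * (\<Prod>j<e. l j))"

text \<open>A monomial is given by its exponent vector.\<close>

abbreviation monomial :: "(nat \<Rightarrow>\<^sub>0 nat) \<Rightarrow> 'a::comm_ring_1 mpoly" where
  "monomial e \<equiv> Poly_Mapping.single e 1"

text \<open>
  The library constant \<^const>\<open>coprime\<close> is restricted to the class \<^class>\<open>algebraic_semidom\<close>, of
  which polynomial mappings are not an instance.
\<close>

definition coprime_mpoly :: "'a::comm_ring_1 mpoly \<Rightarrow> 'a mpoly \<Rightarrow> bool" where
  "coprime_mpoly p q \<longleftrightarrow> (\<forall>c. c dvd p \<longrightarrow> c dvd q \<longrightarrow> c dvd 1)"

definition monomial_degree :: "(nat \<Rightarrow>\<^sub>0 nat) \<Rightarrow> nat" where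
  "monomial_degree e = (\<Sum>v\<in>Poly_Mapping.keys e. Poly_Mapping.lookup e v)"

section \<open>The property \<open>C\<^sup>d\<^sub>m\<close>\<close>

text \<open>
  In \<open>C_equation n d m l f x\<close>, the family \<open>l\<close> has indices \<open>1, \<dots>, m\<close>, while \<open>f\<close> and the exponent
  vectors \<open>x\<close> have indices \<open>0, \<dots>, m\<close>.
\<close>

definition C_equation ::
  "nat \<Rightarrow> nat \<Rightarrow> nat \<Rightarrow> (nat \<Rightarrow> 'a::field mpoly) \<Rightarrow> (nat \<Rightarrow> 'a mpoly) \<Rightarrow>
     (nat \<Rightarrow> (nat \<Rightarrow>\<^sub>0 nat)) \<Rightarrow> bool" where
  "C_equation n d m l f x \<longleftrightarrow>
     (\<forall>i\<in>{0..m}. Poly_Mapping.keys (x i) \<subseteq> {..<n} \<and> squarefree (monomial (x i) :: 'a mpoly)) \<and>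
     (\<forall>i\<in>{0..m}. \<forall>j\<in>{0..m}. i \<noteq> j \<longrightarrow> coprime_mpoly (monomial (x i) :: 'a mpoly) (monomial (x j))) \<and>
     (\<forall>i\<in>{1..m}. prod_of_linear_forms n d (l i)) \<and>
     (\<forall>i\<in>{0..m}. if monomial_degree (x i) \<le> d
                  then prod_of_linear_forms n (d - monomial_degree (x i)) (f i)
                  else f i = 0) \<and>
     (\<Sum>i=1..m. l i) = (\<Sum>i=0..m. f i * monomial (x i))"

definition property_C :: "'a::field itself \<Rightarrow> nat \<Rightarrow> nat \<Rightarrow> bool" where
  "property_C K d m \<longleftrightarrow>
     (\<forall>n (l :: nat \<Rightarrow> 'a mpoly) f x.
        C_equation n d m l f x \<longrightarrow>
        (\<forall>i\<in>{0..m}. \<forall>j\<in>{0..m}. i \<noteq> j \<longrightarrow> monomial_degree (x i) + monomial_degree (x j) \<ge> d + 2) \<longrightarrow>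
        (\<exists>i\<in>{0..m}. f i = 0))"

section \<open>Linear subspaces of \<open>X\<^sub>r\<^sub>,\<^sub>d\<close> and splittings\<close>

interpretation fun_vs: vector_space "\<lambda>(c::'a::field) (v::'i \<Rightarrow> 'a) p. c * v p"
  by unfold_locales (auto simp: fun_eq_iff algebra_simps)

text \<open>
  The affine space over \<open>\<P>\<^sup>r\<^sup>d\<^sup>-\<^sup>1\<close>: coordinate \<open>(i, j)\<close> of a vector is the value of \<open>x\<^sub>i\<^sub>j\<close>.
  All coordinates outside the index range are \<open>0\<close>.
\<close>

definition coord_space :: "nat \<Rightarrow> nat \<Rightarrow> (nat \<times> nat \<Rightarrow> 'a::field) set" where
  "coord_space r d = {v. \<forall>p. p \<notin> {1..r} \<times> {1..d} \<longrightarrow> v p = 0}"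

text \<open>
  The (affine cone over the) zero locus of the form summing, over \<open>i \<in> A\<close>, the products
  of the \<open>x\<^sub>i\<^sub>j\<close> over \<open>1 \<le> j \<le> d\<close>.
\<close>

definition zero_locus :: "nat \<Rightarrow> nat \<Rightarrow> nat set \<Rightarrow> (nat \<times> nat \<Rightarrow> 'a::field) set" where
  "zero_locus r d A = {v \<in> coord_space r d. (\<Sum>i\<in>A. \<Prod>j=1..d. v (i, j)) = 0}"

abbreviation X_hypersurface :: "nat \<Rightarrow> nat \<Rightarrow> (nat \<times> nat \<Rightarrow> 'a::field) set" where
  "X_hypersurface r d \<equiv> zero_locus r d {1..r}"

text \<open>
  A projective \<open>k\<close>-plane is represented by its cone, a vector subspace of dimension \<open>k + 1\<close>.
  These are the points of the Fano scheme over the (algebraically closed) base field.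
\<close>

definition fano_planes :: "nat \<Rightarrow> nat \<Rightarrow> nat \<Rightarrow> (nat \<times> nat \<Rightarrow> 'a::field) set set" where
  "fano_planes k r d =
     {L. fun_vs.subspace L \<and> fun_vs.dim L = k + 1 \<and> L \<subseteq> X_hypersurface r d}"

text \<open>The indices \<open>a\<^sub>1 < \<dots> < a\<^sub>\<lambda>\<close> are given by the set \<open>A\<close> of their values.\<close>

definition admits_splitting :: "nat \<Rightarrow> nat \<Rightarrow> nat \<Rightarrow> (nat \<times> nat \<Rightarrow> 'a::field) set \<Rightarrow> bool" where
  "admits_splitting lam r d L \<longleftrightarrow>
     (\<exists>A. A \<subseteq> {1..r} \<and> card A = lam \<and> L \<subseteq> zero_locus r d A)"

definition fano_split :: "'a::field itself \<Rightarrow> nat \<Rightarrow> nat \<Rightarrow> nat \<Rightarrow> nat \<Rightarrow> bool" where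
  "fano_split K m k r d \<longleftrightarrow>
     (\<forall>L \<in> (fano_planes k r d :: (nat \<times> nat \<Rightarrow> 'a) set set).
        \<exists>lam. 1 \<le> lam \<and> lam \<le> m \<and> admits_splitting lam r d L)"

end

theory Submission
  imports Defs
begin

text \<open>
  Restricting linear forms to a linear section turns both parts of the theorem into bounds for the
  dimension of the span of the factors in a vanishing sum of \<open>s\<close> nonzero products of \<open>d\<close> linear
  forms.  This dimension is at most \<open>s d / 2\<close> for even \<open>s\<close>, and at most \<open>(s - 1) d / 2 + 1\<close> for odd
  \<open>s\<close>: otherwise, restricting the sum to the hyperplane where one of the factors vanishes, induction
  shows that each factor occurs in at least three of the products, and then there are too few
  factors.  For even \<open>s\<close> the bound is attained only if two of the products cancel.  Applied to the
  coordinates on a linear subspace of the hypersurface, this gives the splitting statements.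

  In an equation of property \<open>C\<close> with all \<open>f\<^sub>i\<close> nonzero, the variables of the monomials are
  independent, which contradicts the bound unless \<open>m = 2\<close>, or \<open>d = 4\<close> and all monomials have degree at
  least three.  In these cases, the sums obtained by restricting to a factor of some \<open>\<ell>\<^sub>i\<close> show that
  these factors divide the \<open>f\<^sub>j\<close>.  Hence the sum of the \<open>\<ell>\<^sub>i\<close> only depends on few linear forms, whereas
  the sum of the \<open>f\<^sub>j x\<^sub>j\<close> is not invariant under translations in the remaining directions.
\<close>

text \<open>Restricting to the hyperplane \<open>l = 0\<close> is expressed by adding
  \<open>l\<close> to a set \<open>U\<close> of forms instead of passing to a quotient: every
  estimate is relative to \<open>U\<close>, so inductions keep the same vector space and the same
  rows. Identities of forms are identities of values at all points, which is faithful because the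
  scalars are infinite.

  For property C the basic bound is too weak. There are at most \<open>2m + 1\<close> rows, so
  independent variables force a total degree of at most \<open>m d + 1\<close>. A monomial of degree
  two would force the other \<open>m\<close> to have degree \<open>d\<close>, a total of
  \<open>m d + 2\<close>; otherwise the total is at least \<open>3 (m + 1)\<close>. Together with
  the pairwise degree condition this settles \<open>m = 1\<close> and \<open>d = 3\<close>, but for
  \<open>m = 2\<close> it leaves all \<open>d \<ge> 4\<close>, and for \<open>d = 4\<close> all
  \<open>m \<ge> 2\<close>. This is why later estimates concern only the designated factors of a row
  (the variables) and not all of its factors.\<close>

locale infinite_vector_space = vector_space scale
  for scale :: "'a::field \<Rightarrow> 'b::ab_group_add \<Rightarrow> 'b" (infixr \<open>*s\<close> 75) +
  assumes infinite_scalars: "infinite (UNIV :: 'a set)"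
begin

section \<open>Dimension of finite sets of vectors\<close>

lemma dim_insert_finite:
  assumes "finite S"
  shows "dim (insert x S) = (if x \<in> span S then dim S else Suc (dim S))"
proof (cases "x \<in> span S")
  case True
  then show ?thesis
    by (metis dim_span span_redundant)
next
  case False
  obtain B where B: "B \<subseteq> S" "independent B" "S \<subseteq> span B" "card B = dim S"
    by (rule basis_exists)
  have fB: "finite B" using B(1) assms finite_subset by blast
  have spB: "span B = span S"
    using B by (metis span_mono span_span subset_antisym)
  have "independent (insert x B)" using False B(2) spB by (simp add: independent_insertI)
  moreover have "span (insert x B) = span (insert x S)"
    using spB by (simp add: span_insert)
  ultimately have "dim (insert x S) = card (insert x B)"
    by (rule dim_eq_card[rotated])
  moreover have "x \<notin> B" using False B(1) span_base by blast
  ultimately show ?thesis using False fB B(4) by simp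
qed

text \<open>The space of forms may be infinite-dimensional, and \<open>dim\<close> says nothing
  about a set without a finite basis. Finiteness of \<open>T\<close> is what makes the two bases
  comparable.\<close>

lemma dim_mono_finite:
  assumes "finite T" "S \<subseteq> span T"
  shows "dim S \<le> dim T"
proof -
  obtain B where B: "B \<subseteq> S" "independent B" "card B = dim S"
    by (rule basis_exists)
  obtain C where C: "C \<subseteq> T" "T \<subseteq> span C" "card C = dim T"
    by (rule basis_exists)
  have "finite C" using C(1) assms(1) finite_subset by blast
  moreover have "B \<subseteq> span C"
    using B(1) assms(2) C(2) by (meson order_trans span_minimal subspace_span)
  ultimately have "card B \<le> card C" using independent_span_bound B(2) by blast
  then show ?thesis using B C by simp
qed

lemma dim_Un_le_card:
  assumes "finite S" "finite A"
  shows "dim (S \<union> A) \<le> dim S + card A"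
  using assms(2)
proof (induction A rule: finite_induct)
  case (insert x A)
  then show ?case using assms(1) dim_insert_finite[of "S \<union> A" x] by (simp split: if_splits)
qed simp

text \<open>Induction on \<open>B\<close>: a vector that is new for the larger set
  \<open>S \<union> A \<union> B\<close> is also new for \<open>S \<union> B\<close>.\<close>

lemma dim_Un_submodular:
  assumes "finite S" "finite A" "finite B"
  shows "dim (S \<union> A \<union> B) + dim S \<le> dim (S \<union> A) + dim (S \<union> B)"
  using assms(3)
proof (induction B rule: finite_induct)
  case (insert x B)
  have "x \<in> span (S \<union> B) \<Longrightarrow> x \<in> span (S \<union> A \<union> B)"
    using span_mono[of "S \<union> B" "S \<union> A \<union> B"] by blast
  then show ?case
    using insert assms(1,2) dim_insert_finite[of "S \<union> B" x] dim_insert_finite[of "S \<union> A \<union> B" x]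
    by (auto split: if_splits)
qed simp

text \<open>\<open>B\<close> represents a basis of the image of \<open>A\<close> modulo
  \<open>span U\<close>. It is chosen inside \<open>A\<close> because its elements later have to be
  factors of rows.\<close>

lemma relative_basis:
  assumes "finite U" "finite A"
  obtains B where "B \<subseteq> A" "card B + dim U = dim (U \<union> A)" "A \<subseteq> span (U \<union> B)"
proof -
  have "\<exists>B\<subseteq>A. card B + dim U = dim (U \<union> A) \<and> A \<subseteq> span (U \<union> B)"
    using assms(2)
  proof (induction A rule: finite_induct)
    case empty
    show ?case by auto
  next
    case (insert x A)
    then obtain B where B: "B \<subseteq> A" "card B + dim U = dim (U \<union> A)" "A \<subseteq> span (U \<union> B)"
      by blast
    have eq: "span (U \<union> A) = span (U \<union> B)"
    proof
      show "span (U \<union> A) \<subseteq> span (U \<union> B)"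
        using B(3) span_superset[of "U \<union> B"] by (simp add: span_minimal)
      show "span (U \<union> B) \<subseteq> span (U \<union> A)" using B(1) by (intro span_mono) blast
    qed
    show ?case
    proof (cases "x \<in> span (U \<union> A)")
      case True
      then have "dim (U \<union> insert x A) = dim (U \<union> A)"
        using insert assms(1) dim_insert_finite[of "U \<union> A" x] by simp
      then show ?thesis using B True eq by (intro exI[of _ B]) auto
    next
      case False
      then have "dim (U \<union> insert x A) = Suc (dim (U \<union> A))"
        using insert assms(1) dim_insert_finite[of "U \<union> A" x] by simp
      moreover have "finite B" "x \<notin> B"
        using B(1) insert finite_subset by blast+
      moreover have "insert x A \<subseteq> span (U \<union> insert x B)"
        using B(3) span_mono[of "U \<union> B" "U \<union> insert x B"] span_base[of x "U \<union> insert x B"] by auto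
      ultimately show ?thesis using B by (intro exI[of _ "insert x B"]) auto
    qed
  qed
  then show ?thesis using that by blast
qed

text \<open>The hypothesis \<open>dim (U \<union> B) = dim U + card B\<close> encodes independence
  of \<open>B\<close> modulo \<open>span U\<close>. It passes to subsets since each omitted element
  accounts for at most one dimension.\<close>

lemma relative_independent_mono:
  assumes "finite U" "finite B" "dim (U \<union> B) = dim U + card B" "C \<subseteq> B"
  shows "dim (U \<union> C) = dim U + card C"
proof (rule antisym)
  have fC: "finite C" using assms finite_subset by blast
  show "dim (U \<union> C) \<le> dim U + card C" using dim_Un_le_card assms(1) fC by blast
  have "dim (U \<union> B) \<le> dim (U \<union> C) + card (B - C)"
    using dim_Un_le_card[of "U \<union> C" "B - C"] assms fC by (simp add: Un_assoc Un_absorb1)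
  moreover have "card B = card C + card (B - C)"
    using assms fC by (metis card_Diff_subset card_mono le_add_diff_inverse)
  ultimately show "dim U + card C \<le> dim (U \<union> C)" using assms(3) by simp
qed

lemma relative_independent_not_in_span:
  assumes "finite U" "finite B" "dim (U \<union> B) = dim U + card B" "b \<in> B"
  shows "b \<notin> span (U \<union> (B - {b}))"
proof
  assume b: "b \<in> span (U \<union> (B - {b}))"
  have "insert b (U \<union> (B - {b})) = U \<union> B" using assms by blast
  then have "dim (U \<union> B) = dim (U \<union> (B - {b}))"
    using b assms dim_insert_finite[of "U \<union> (B - {b})" b] by simp
  also have "\<dots> = dim U + card (B - {b})"
    using relative_independent_mono assms by blast
  finally show False using assms card_Diff1_less[of B b] by simp
qed

section \<open>Points of linear sections\<close>

text \<open>
  The vectors are thought of as linear forms, and the linear functionals on them as points.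
  The points of the linear section cut out by a set of forms are those vanishing on that set.
\<close>

definition point :: "'b set \<Rightarrow> ('b \<Rightarrow> 'a) \<Rightarrow> bool" where
  "point U y \<longleftrightarrow> Vector_Spaces.linear scale (*) y \<and> (\<forall>u\<in>U. y u = 0)"

lemma vector_space_mult: "vector_space ((*) :: 'a \<Rightarrow> 'a \<Rightarrow> 'a)"
  by unfold_locales (auto simp: algebra_simps)

lemma point_linear: "point U y \<Longrightarrow> Vector_Spaces.linear scale (*) y"
  by (simp add: point_def)

lemma point_add: "point U y \<Longrightarrow> y (a + b) = y a + y b"
  and point_scale: "point U y \<Longrightarrow> y (c *s a) = c * y a"
  and point_zero: "point U y \<Longrightarrow> y 0 = 0"
  and point_diff: "point U y \<Longrightarrow> y (a - b) = y a - y b"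
proof -
  assume y: "point U y"
  interpret l: Vector_Spaces.linear scale "(*)" y using y by (rule point_linear)
  show "y (a + b) = y a + y b" "y (c *s a) = c * y a" "y 0 = 0" "y (a - b) = y a - y b"
    by (simp_all add: l.add l.scale l.zero l.diff)
qed

lemma pointI:
  assumes "\<And>a b. y (a + b) = y a + y b" "\<And>c a. y (c *s a) = c * y a" "\<And>u. u \<in> U \<Longrightarrow> y u = 0"
  shows "point U y"
proof -
  interpret v: vector_space "(*) :: 'a \<Rightarrow> 'a \<Rightarrow> 'a" by (rule vector_space_mult)
  interpret vector_space_pair scale "(*) :: 'a \<Rightarrow> 'a \<Rightarrow> 'a" by unfold_locales
  show ?thesis
    using assms unfolding point_def Vector_Spaces.linear_iff
    by (auto intro: vector_space_axioms vector_space_mult)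
qed

lemma point_span:
  assumes "point U y" "v \<in> span U"
  shows "y v = 0"
  using assms(2)
proof (induction rule: span_induct_alt)
  case base
  show ?case using assms(1) by (rule point_zero)
next
  case (step c x v)
  then show ?case using assms(1) point_def by (auto simp: point_add[OF assms(1)] point_scale[OF assms(1)])
qed

lemma point_mono: "point V y \<Longrightarrow> U \<subseteq> span V \<Longrightarrow> point U y"
  using point_span[of V y] by (auto simp: point_def)

lemma point_line: "point U y \<Longrightarrow> point U z \<Longrightarrow> point U (\<lambda>v. y v + t * z v)"
  by (rule pointI) (auto simp: point_add point_scale algebra_simps, auto simp: point_def)

lemma point_scaled: "point U y \<Longrightarrow> point U (\<lambda>v. t * y v)"
  by (rule pointI) (auto simp: point_add point_scale algebra_simps, auto simp: point_def)

lemma point_of_independent: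
  assumes "independent B"
  obtains y where "point {} y" "\<And>b. b \<in> B \<Longrightarrow> y b = h b"
proof -
  interpret v: vector_space "(*) :: 'a \<Rightarrow> 'a \<Rightarrow> 'a" by (rule vector_space_mult)
  interpret vector_space_pair scale "(*) :: 'a \<Rightarrow> 'a \<Rightarrow> 'a" by unfold_locales
  obtain y where "Vector_Spaces.linear scale (*) y" "\<forall>b\<in>B. y b = h b"
    using linear_independent_extend[OF assms, of h] by blast
  then show ?thesis using that by (simp add: point_def)
qed

lemma separating_point:
  assumes "v \<notin> span U"
  obtains y where "point U y" "y v = 1"
proof -
  obtain B where B: "B \<subseteq> U" "independent B" "U \<subseteq> span B"
    by (rule basis_exists)
  have "v \<notin> span B" using assms B(1) span_mono by blast
  then have "independent (insert v B)" "v \<notin> B"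
    using B(2) independent_insertI span_base by blast+
  then obtain y where y: "point {} y" "\<And>b. b \<in> insert v B \<Longrightarrow> y b = (if b = v then 1 else 0)"
    using point_of_independent[of "insert v B" "\<lambda>b. if b = v then 1 else 0"] by blast
  then have "point B y" using \<open>v \<notin> B\<close> by (auto simp: point_def)
  then have "point U y" using B(3) by (rule point_mono)
  moreover have "y v = 1" using y(2)[of v] by simp
  ultimately show ?thesis by (rule that)
qed

text \<open>A dual basis modulo \<open>span U\<close>: a basis of \<open>U\<close> together with
  \<open>B\<close> is independent, so a functional can be prescribed as 0 on the former and
  arbitrarily on \<open>B\<close>.\<close>

lemma relative_point:
  assumes "finite U" "finite B" "dim (U \<union> B) = dim U + card B"
  obtains y where "point U y" "\<And>b. b \<in> B \<Longrightarrow> y b = h b"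
proof -
  obtain C where C: "C \<subseteq> U" "independent C" "U \<subseteq> span C" "card C = dim U"
    by (rule basis_exists)
  have fC: "finite C" using C(1) assms(1) finite_subset by blast
  have disj: "b \<notin> C" if "b \<in> B" for b
    using relative_independent_not_in_span[OF assms that] C(1) span_base by blast
  have "independent (C \<union> D)" if "finite D" "D \<subseteq> B" for D
    using that
  proof (induction D rule: finite_induct)
    case (insert x D)
    then have "x \<notin> span (U \<union> (B - {x}))"
      using relative_independent_not_in_span[OF assms] by blast
    moreover have "C \<union> D \<subseteq> U \<union> (B - {x})" using C(1) insert by blast
    ultimately have "x \<notin> span (C \<union> D)" using span_mono by blast
    then show ?case using insert by (simp add: independent_insertI)
  qed (simp add: C)
  then have "independent (C \<union> B)" using assms(2) by blast
  then obtain y where y: "point {} y" "\<And>b. b \<in> C \<union> B \<Longrightarrow> y b = (if b \<in> B then h b else 0)"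
    using point_of_independent[of "C \<union> B" "\<lambda>b. if b \<in> B then h b else 0"] by blast
  then have "point C y" using disj by (auto simp: point_def)
  then have "point U y" using C(3) by (rule point_mono)
  moreover have "y b = h b" if "b \<in> B" for b using y(2)[of b] that by simp
  ultimately show ?thesis by (rule that)
qed

text \<open>A vector space over an infinite field is not a finite union of proper subspaces. A point
  avoiding the earlier forms is moved along a direction \<open>z\<close> with
  \<open>z x = 1\<close>; each form excludes at most one parameter \<open>t\<close>.\<close>

lemma avoiding_point:
  assumes "finite S" "S \<inter> span U = {}"
  obtains y where "point U y" "\<And>s. s \<in> S \<Longrightarrow> y s \<noteq> 0"
proof -
  have "\<exists>y. point U y \<and> (\<forall>s\<in>S. y s \<noteq> 0)"
    using assms
  proof (induction S rule: finite_induct)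
    case empty
    have "point U (\<lambda>_. 0)" by (rule pointI) auto
    then show ?case by blast
  next
    case (insert x S)
    then obtain y where y: "point U y" "\<forall>s\<in>S. y s \<noteq> 0" by auto
    have "x \<notin> span U" using insert.prems by simp
    then obtain z where z: "point U z" "z x = 1" by (rule separating_point)
    have "finite (insert (- y x) ((\<lambda>s. - y s / z s) ` S))" using insert by simp
    then obtain t where t: "t \<notin> insert (- y x) ((\<lambda>s. - y s / z s) ` S)"
      using infinite_scalars ex_new_if_finite by blast
    have nz: "y s + t * z s \<noteq> 0" if "s \<in> S" for s
    proof
      assume *: "y s + t * z s = 0"
      then have "z s \<noteq> 0" using y(2) that by auto
      moreover have "t * z s = - y s" using * by (simp add: eq_neg_iff_add_eq_0 add.commute)
      ultimately have "t = - y s / z s" by (metis nonzero_mult_div_cancel_right)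
      then show False using t that by blast
    qed
    have "t \<noteq> - y x" using t by simp
    then have "y x + t * z x \<noteq> 0" using z(2) by (simp add: add_eq_0_iff)
    with nz have "\<forall>s\<in>insert x S. y s + t * z s \<noteq> 0" by simp
    then show ?case using point_line[OF y(1) z(1), of t] by (intro exI[of _ "\<lambda>v. y v + t * z v"] conjI)
  qed
  then show ?thesis using that by blast
qed

section \<open>Vanishing sums of products of linear forms\<close>

definition val :: "('b \<Rightarrow> 'a) \<Rightarrow> 'b multiset \<Rightarrow> 'a" where
  "val y M = (\<Prod>v\<in>#M. y v)"

definition vecs :: "('i \<Rightarrow> 'b multiset) \<Rightarrow> 'i set \<Rightarrow> 'b set" where
  "vecs P I = (\<Union>i\<in>I. set_mset (P i))"

text \<open>The coefficients are kept apart from the factors, so that proportionality constants can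
  be moved into them when a common factor is divided out.\<close>

definition vanishing_sum :: "'b set \<Rightarrow> 'i set \<Rightarrow> ('i \<Rightarrow> 'a) \<Rightarrow> ('i \<Rightarrow> 'b multiset) \<Rightarrow> bool" where
  "vanishing_sum U I c P \<longleftrightarrow> (\<forall>y. point U y \<longrightarrow> (\<Sum>i\<in>I. c i * val y (P i)) = 0)"

definition proper_rows :: "'b set \<Rightarrow> 'i set \<Rightarrow> ('i \<Rightarrow> 'a) \<Rightarrow> ('i \<Rightarrow> 'b multiset) \<Rightarrow> bool" where
  "proper_rows U I c P \<longleftrightarrow> (\<forall>i\<in>I. c i \<noteq> 0 \<and> set_mset (P i) \<inter> span U = {})"

text \<open>These are the rows whose product vanishes identically on the section. For
  \<open>insert l U\<close> and proper rows over \<open>U\<close>, they are the rows with a factor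
  proportional to \<open>l\<close> modulo \<open>span U\<close>.\<close>

definition rows_meeting :: "'b set \<Rightarrow> 'i set \<Rightarrow> ('i \<Rightarrow> 'b multiset) \<Rightarrow> 'i set" where
  "rows_meeting U I P = {j \<in> I. set_mset (P j) \<inter> span U \<noteq> {}}"

lemma val_empty [simp]: "val y {#} = 1"
  and val_add_mset [simp]: "val y (add_mset v M) = y v * val y M"
  and val_union [simp]: "val y (M + N) = val y M * val y N"
  by (simp_all add: val_def)

lemma val_eq_0_iff: "val y M = 0 \<longleftrightarrow> (\<exists>v\<in>#M. y v = 0)"
  by (induction M) auto

lemma val_cong: "(\<And>v. v \<in># M \<Longrightarrow> y v = z v) \<Longrightarrow> val y M = val z M"
  by (induction M) auto

lemma val_meeting_eq_0: "point U y \<Longrightarrow> set_mset M \<inter> span U \<noteq> {} \<Longrightarrow> val y M = 0"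
  using point_span unfolding val_eq_0_iff by blast

lemma finite_vecs: "finite I \<Longrightarrow> finite (vecs P I)"
  by (simp add: vecs_def)

lemma vecs_insert [simp]: "vecs P (insert i I) = set_mset (P i) \<union> vecs P I"
  and vecs_Un: "vecs P (I \<union> J) = vecs P I \<union> vecs P J"
  and vecs_empty [simp]: "vecs P {} = {}"
  by (auto simp: vecs_def)

lemma card_set_mset_le_size: "card (set_mset M) \<le> size M"
  by (induction M) (auto simp: card_insert_if)

section \<open>Dimension estimates for the factors of several rows\<close>

lemma dim_Un_mset_le: "finite S \<Longrightarrow> dim (S \<union> set_mset M) \<le> dim S + size M"
  using dim_Un_le_card[of S "set_mset M"] card_set_mset_le_size[of M] by simp

lemma dim_Un_vecs_le_sum:
  assumes "finite S" "finite J"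
  shows "dim (S \<union> vecs P J) \<le> dim S + (\<Sum>j\<in>J. size (P j))"
  using assms(2)
proof (induction J rule: finite_induct)
  case (insert j J)
  have "dim (S \<union> vecs P (insert j J)) = dim ((S \<union> vecs P J) \<union> set_mset (P j))"
    by (simp add: Un_commute Un_left_commute)
  also have "\<dots> \<le> dim (S \<union> vecs P J) + size (P j)"
    using insert assms(1) by (intro dim_Un_mset_le) (simp add: finite_vecs)
  finally show ?case using insert by simp
qed simp

lemma dim_Un_vecs_le:
  assumes "finite S" "finite J" "\<And>j. j \<in> J \<Longrightarrow> size (P j) = d"
  shows "dim (S \<union> vecs P J) \<le> dim S + card J * d"
  using dim_Un_vecs_le_sum[OF assms(1,2), of P] assms(3) by simp

text \<open>A factor in \<open>span S\<close> adds nothing, so each row adds at most its size minus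
  one. Truncated subtraction is harmless because a row meeting \<open>span S\<close> is
  nonempty.\<close>

lemma dim_Un_meeting_vecs_le:
  assumes "finite S" "finite J" "\<And>j. j \<in> J \<Longrightarrow> set_mset (P j) \<inter> span S \<noteq> {}"
  shows "dim (S \<union> vecs P J) \<le> dim S + (\<Sum>j\<in>J. size (P j) - 1)"
  using assms(2,3)
proof (induction J rule: finite_induct)
  case (insert j J)
  then obtain w M where w: "w \<in> span S" "P j = add_mset w M"
    by (metis Int_iff ex_in_conv insertCI multi_member_split)
  have fin: "finite (S \<union> vecs P J \<union> set_mset M)"
    using insert assms(1) by (simp add: finite_vecs)
  have "w \<in> span (S \<union> vecs P J \<union> set_mset M)"
    using w(1) span_mono[of S "S \<union> vecs P J \<union> set_mset M"] by blast
  then have "S \<union> vecs P (insert j J) \<subseteq> span (S \<union> vecs P J \<union> set_mset M)"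
    using w(2) span_superset[of "S \<union> vecs P J \<union> set_mset M"] by auto
  then have "dim (S \<union> vecs P (insert j J)) \<le> dim (S \<union> vecs P J \<union> set_mset M)"
    using fin by (rule dim_mono_finite[rotated])
  also have "\<dots> \<le> dim (S \<union> vecs P J) + size M"
    using insert assms(1) by (intro dim_Un_mset_le) (simp add: finite_vecs)
  finally show ?case using insert w(2) by auto
qed simp

section \<open>Restriction of vanishing sums to a linear section\<close>

lemma vanishing_sum_section:
  assumes "vanishing_sum U I c P" "U \<subseteq> span V" "finite I" "J \<subseteq> I"
    and "\<And>j. j \<in> I - J \<Longrightarrow> c j = 0 \<or> set_mset (P j) \<inter> span V \<noteq> {}"
  shows "vanishing_sum V J c P"
  unfolding vanishing_sum_def
proof (intro allI impI)
  fix y assume y: "point V y"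
  have "(\<Sum>i\<in>J. c i * val y (P i)) = (\<Sum>i\<in>I. c i * val y (P i))"
    using assms(3,4,5) val_meeting_eq_0[OF y] by (intro sum.mono_neutral_left) auto
  also have "\<dots> = 0"
    using assms(1) point_mono[OF y assms(2)] by (simp add: vanishing_sum_def)
  finally show "(\<Sum>i\<in>J. c i * val y (P i)) = 0" .
qed

text \<open>
  If a factor of the row were independent of the other rows, then moving a point along a direction
  that is invisible to the other rows would make this row vanish without changing the other ones.
\<close>

lemma row_in_span_of_others:
  assumes "finite I" "vanishing_sum U I c P" "i \<in> I" "c i \<noteq> 0" "set_mset (P i) \<inter> span U = {}"
  shows "set_mset (P i) \<subseteq> span (U \<union> vecs P (I - {i}))"
proof (rule ccontr)
  let ?S = "U \<union> vecs P (I - {i})"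
  assume "\<not> set_mset (P i) \<subseteq> span ?S"
  then obtain l where l: "l \<in># P i" "l \<notin> span ?S" by blast
  obtain z where z: "point ?S z" "z l = 1" by (rule separating_point[OF l(2)])
  obtain y where y: "point U y" "\<And>v. v \<in> set_mset (P i) \<Longrightarrow> y v \<noteq> 0"
    using avoiding_point[OF _ assms(5)] by auto
  define x where "x = (\<lambda>v. y v + (- y l) * z v)"
  have zU: "point U z" using z(1) by (auto simp: point_def)
  have x: "point U x" unfolding x_def by (rule point_line[OF y(1) zU])
  have others: "(\<Sum>j\<in>I - {i}. c j * val x (P j)) = (\<Sum>j\<in>I - {i}. c j * val y (P j))"
  proof (intro sum.cong refl arg_cong2[where f="(*)"] val_cong)
    fix j v assume "j \<in> I - {i}" "v \<in># P j"
    then have "z v = 0" using z(1) by (auto simp: point_def vecs_def)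
    then show "x v = y v" by (simp add: x_def)
  qed
  have "x l = 0" using z(2) by (simp add: x_def)
  then have "val x (P i) = 0" using l(1) by (auto simp: val_eq_0_iff)
  moreover have "(\<Sum>j\<in>I. c j * val x (P j)) = 0" "(\<Sum>j\<in>I. c j * val y (P j)) = 0"
    using assms(2) x y(1) by (simp_all add: vanishing_sum_def)
  ultimately have "c i * val y (P i) = 0"
    using assms(1,3) others by (simp add: sum.remove)
  then show False using assms(4) y(2) by (auto simp: val_eq_0_iff)
qed

lemma not_vanishing_single:
  assumes "vanishing_sum U {i} c P" "proper_rows U {i} c P"
  shows False
proof -
  have p: "set_mset (P i) \<inter> span U = {}" "c i \<noteq> 0" using assms(2) by (auto simp: proper_rows_def)
  obtain y where y: "point U y" "\<And>v. v \<in> set_mset (P i) \<Longrightarrow> y v \<noteq> 0"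
    using avoiding_point[OF _ p(1)] by auto
  then have "c i * val y (P i) = 0" using assms(1) by (simp add: vanishing_sum_def)
  then show False using p(2) y(2) by (auto simp: val_eq_0_iff)
qed

lemma finite_rows_meeting: "finite I \<Longrightarrow> finite (rows_meeting U I P)"
  by (simp add: rows_meeting_def)

lemma vanishing_sum_insert:
  assumes "vanishing_sum U I c P" "finite I"
  shows "vanishing_sum (insert l U) (I - rows_meeting (insert l U) I P) c P"
  using assms span_superset[of "insert l U"]
  by (intro vanishing_sum_section[OF assms(1)]) (auto simp: rows_meeting_def)

lemma proper_rows_insert:
  assumes "proper_rows U I c P"
  shows "proper_rows (insert l U) (I - rows_meeting (insert l U) I P) c P"
  using assms by (auto simp: rows_meeting_def proper_rows_def)

lemma proper_rows_mono: "proper_rows U I c P \<Longrightarrow> J \<subseteq> I \<Longrightarrow> proper_rows U J c P"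
  by (auto simp: proper_rows_def)

text \<open>The rows outside \<open>A\<close> survive on \<open>l = 0\<close>. Each row of
  \<open>A\<close> already has a factor in \<open>span (insert l U)\<close> and adds at most
  \<open>d - 1\<close>, while the row \<open>i\<close> itself adds nothing, being in the span of the
  other rows. This is the step from a section back to the whole sum.\<close>

lemma dim_le_via_factor:
  assumes "finite U" "finite I" "\<And>i. i \<in> I \<Longrightarrow> size (P i) = d"
    and "proper_rows U I c P" "vanishing_sum U I c P" "i \<in> I" "l \<in># P i"
    and A: "A = rows_meeting (insert l U) I P"
  shows "dim (U \<union> vecs P I) \<le> dim (insert l U \<union> vecs P (I - A)) + (card A - 1) * (d - 1)"
proof -
  let ?S = "insert l U \<union> vecs P (I - A)"
  have iA: "i \<in> A" using assms(6,7) span_base[of l "insert l U"] by (auto simp: A rows_meeting_def)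
  have AI: "A \<subseteq> I" "finite A" using assms(2) by (auto simp: A rows_meeting_def)
  have fS: "finite ?S" using assms(1,2) by (simp add: finite_vecs)
  have fT: "finite (?S \<union> vecs P (A - {i}))" using fS AI by (simp add: finite_vecs)
  have sub: "U \<union> vecs P (I - {i}) \<subseteq> ?S \<union> vecs P (A - {i})" using AI by (auto simp: vecs_def)
  have "set_mset (P i) \<subseteq> span (U \<union> vecs P (I - {i}))"
    using assms by (intro row_in_span_of_others) (auto simp: proper_rows_def)
  also have "\<dots> \<subseteq> span (?S \<union> vecs P (A - {i}))" by (rule span_mono[OF sub])
  finally have "set_mset (P i) \<subseteq> span (?S \<union> vecs P (A - {i}))" .
  moreover have "U \<union> vecs P I = set_mset (P i) \<union> (U \<union> vecs P (I - {i}))"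
    using assms(6) by (auto simp: vecs_def)
  ultimately have "U \<union> vecs P I \<subseteq> span (?S \<union> vecs P (A - {i}))"
    using sub span_superset[of "?S \<union> vecs P (A - {i})"] by blast
  then have "dim (U \<union> vecs P I) \<le> dim (?S \<union> vecs P (A - {i}))"
    using fT by (rule dim_mono_finite[rotated])
  also have "\<dots> \<le> dim ?S + (\<Sum>j\<in>A - {i}. size (P j) - 1)"
  proof (intro dim_Un_meeting_vecs_le fS)
    show "finite (A - {i})" using AI by simp
    show "set_mset (P j) \<inter> span ?S \<noteq> {}" if "j \<in> A - {i}" for j
      using that span_mono[of "insert l U" ?S] by (auto simp: A rows_meeting_def)
  qed
  also have "(\<Sum>j\<in>A - {i}. size (P j) - 1) = (\<Sum>j\<in>A - {i}. d - 1)"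
    using AI assms(3) by (intro sum.cong) auto
  also have "\<dots> = (card A - 1) * (d - 1)" using iA AI by simp
  finally show ?thesis .
qed

text \<open>For each basis element \<open>b\<close> occurring in row \<open>i\<close>, pick a factor
  \<open>f i b\<close> of this row proportional to \<open>b\<close> modulo \<open>U\<close>.
  Different basis elements pick different factors, so a row contains at most \<open>d\<close> of
  them; if it contains exactly \<open>d\<close>, every factor has been picked.\<close>

lemma basis_occurrences:
  assumes "finite U" "finite I" "\<And>i. i \<in> I \<Longrightarrow> size (P i) = d" "proper_rows U I c P"
    and "finite B" "dim (U \<union> B) = dim U + card B"
  defines "occ \<equiv> \<lambda>i. {b \<in> B. i \<in> rows_meeting (insert b U) I P}"
  shows "\<And>i. i \<in> I \<Longrightarrow> card (occ i) \<le> d"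
    and "(\<Sum>i\<in>I. card (occ i)) = (\<Sum>b\<in>B. card (rows_meeting (insert b U) I P))"
    and "\<And>i w. i \<in> I \<Longrightarrow> card (occ i) = d \<Longrightarrow> w \<in># P i \<Longrightarrow> \<exists>b\<in>occ i. w \<in> span (insert b U)"
proof -
  define f where "f i b = (SOME w. w \<in># P i \<and> w \<in> span (insert b U))" for i b
  have f: "f i b \<in># P i" "f i b \<in> span (insert b U)" if "b \<in> occ i" for i b
  proof -
    have "\<exists>w. w \<in># P i \<and> w \<in> span (insert b U)" using that by (auto simp: occ_def rows_meeting_def)
    from someI_ex[OF this] show "f i b \<in># P i" "f i b \<in> span (insert b U)" by (simp_all add: f_def)
  qed
  have inj: "inj_on (f i) (occ i)" if "i \<in> I" for i
  proof (rule inj_onI)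
    fix b b' assume b: "b \<in> occ i" "b' \<in> occ i" "f i b = f i b'"
    show "b = b'"
    proof (rule ccontr)
      assume "b \<noteq> b'"
      \<comment> \<open>A factor proportional to both \<open>b\<close> and \<open>b'\<close> would
        put \<open>b'\<close> into the span of \<open>b\<close> and \<open>U\<close> by exchange,
        against the independence of \<open>B\<close> modulo \<open>U\<close>.\<close>
      have "f i b \<notin> span U" using f[OF b(1)] assms(4) that by (auto simp: proper_rows_def)
      moreover have "f i b \<in> span (insert b' U)" using f[OF b(2)] b(3) by simp
      ultimately have "b' \<in> span (insert (f i b) U)"
        using in_span_insert by blast
      moreover have "insert (f i b) U \<subseteq> span (insert b U)"
        using f[OF b(1)] span_superset[of "insert b U"] by blast
      then have "span (insert (f i b) U) \<subseteq> span (insert b U)"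
        by (simp add: span_minimal)
      moreover have "span (insert b U) \<subseteq> span (U \<union> (B - {b'}))"
        using b \<open>b \<noteq> b'\<close> by (intro span_mono) (auto simp: occ_def)
      ultimately have "b' \<in> span (U \<union> (B - {b'}))" by blast
      then show False
        using relative_independent_not_in_span[OF assms(1,5,6), of b'] b(2) by (simp add: occ_def)
    qed
  qed
  have sub: "f i ` occ i \<subseteq> set_mset (P i)" for i using f by blast
  have card: "card (occ i) \<le> card (set_mset (P i))" if "i \<in> I" for i
    using card_inj_on_le[OF inj[OF that] sub] by simp
  then show "card (occ i) \<le> d" if "i \<in> I" for i
    using card_set_mset_le_size[of "P i"] assms(3)[OF that] that by (meson le_trans order_eq_refl)
  show "(\<Sum>i\<in>I. card (occ i)) = (\<Sum>b\<in>B. card (rows_meeting (insert b U) I P))"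
  proof -
    have "(\<Sum>i\<in>I. card (occ i)) = (\<Sum>i\<in>I. \<Sum>b\<in>B. if i \<in> rows_meeting (insert b U) I P then 1 else 0)"
      using assms(5) by (simp add: occ_def flip: sum.inter_filter)
    also have "\<dots> = (\<Sum>b\<in>B. \<Sum>i\<in>I. if i \<in> rows_meeting (insert b U) I P then 1 else 0)"
      by (rule sum.swap)
    also have "\<dots> = (\<Sum>b\<in>B. card (rows_meeting (insert b U) I P))"
    proof (rule sum.cong)
      fix b
      have "rows_meeting (insert b U) I P = {i \<in> I. i \<in> rows_meeting (insert b U) I P}"
        by (auto simp: rows_meeting_def)
      then show "(\<Sum>i\<in>I. if i \<in> rows_meeting (insert b U) I P then 1 else 0) =
          card (rows_meeting (insert b U) I P)"
        using assms(2) by (simp flip: sum.inter_filter)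
    qed simp
    finally show ?thesis .
  qed
  show "\<exists>b\<in>occ i. w \<in> span (insert b U)" if "i \<in> I" "card (occ i) = d" "w \<in># P i" for i w
  proof -
    have "card (f i ` occ i) = d" using card_image[OF inj] that by simp
    then have "card (f i ` occ i) = card (set_mset (P i))"
      using card_set_mset_le_size[of "P i"] assms(3)[OF that(1)] card_mono[OF finite_set_mset sub, of i]
      by linarith
    then have "f i ` occ i = set_mset (P i)"
      by (rule card_subset_eq[OF finite_set_mset sub])
    with that(3) obtain b where "b \<in> occ i" "w = f i b" by auto
    then show ?thesis using f(2) by auto
  qed
qed

text \<open>Double counting of pairs of a basis element and a row containing it: at least
  \<open>k\<close> rows for each basis element, at most \<open>d\<close> basis elements for each
  row.\<close>

lemma dim_le_of_occurrences:
  assumes "finite U" "finite I" "\<And>i. i \<in> I \<Longrightarrow> size (P i) = d" "proper_rows U I c P"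
    and "\<And>l. l \<in> vecs P I \<Longrightarrow> k \<le> card (rows_meeting (insert l U) I P)"
  shows "k * dim (U \<union> vecs P I) \<le> k * dim U + card I * d"
proof -
  obtain B where B: "B \<subseteq> vecs P I" "card B + dim U = dim (U \<union> vecs P I)" "vecs P I \<subseteq> span (U \<union> B)"
    using relative_basis[OF assms(1) finite_vecs[OF assms(2)]] by blast
  have fB: "finite B" using B(1) assms(2) finite_subset finite_vecs by blast
  have "dim (U \<union> vecs P I) \<le> dim (U \<union> B)"
    using B(3) span_superset[of "U \<union> B"] fB assms(1) by (intro dim_mono_finite) auto
  moreover have "dim (U \<union> B) \<le> dim U + card B" using dim_Un_le_card assms(1) fB by blast
  ultimately have ind: "dim (U \<union> B) = dim U + card B" using B(2) by simp
  note occ = basis_occurrences[OF assms(1-4) fB ind]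
  have "k * card B = (\<Sum>b\<in>B. k)" by simp
  also have "\<dots> \<le> (\<Sum>b\<in>B. card (rows_meeting (insert b U) I P))"
    using assms(5) B(1) by (intro sum_mono) blast
  also have "\<dots> = (\<Sum>i\<in>I. card {b \<in> B. i \<in> rows_meeting (insert b U) I P})"
    using occ(2) by simp
  also have "\<dots> \<le> (\<Sum>i\<in>I. d)" using occ(1) by (intro sum_mono) simp
  finally show ?thesis using B(2)[symmetric] by (simp add: algebra_simps)
qed

text \<open>Twice the bound on the dimension, which avoids halves. The even value comes from
  cancelling pairs, each with \<open>d\<close> independent factors. For odd
  \<open>s \<ge> 3\<close>, three of the rows instead share \<open>d - 1\<close> factors and have
  remaining factors \<open>a\<close>, \<open>b\<close> and \<open>- a - b\<close>, contributing
  \<open>d + 1\<close>.\<close>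

definition rank_bound :: "nat \<Rightarrow> nat \<Rightarrow> nat" where
  "rank_bound d s = (if even s then s * d else (s - 1) * d + 2)"

text \<open>
  If the bound fails, then restricting the sum to the hyperplane of a factor and using the bound for
  fewer rows shows that each factor occurs, up to scalars, in at least three rows.  But then there
  are too few different factors.
\<close>

theorem dim_vanishing_sum_le:
  assumes "finite U" "finite I" "\<And>i. i \<in> I \<Longrightarrow> size (P i) = d"
    and "proper_rows U I c P" "vanishing_sum U I c P" "2 \<le> d \<or> card I \<le> 3"
  shows "2 * dim (U \<union> vecs P I) \<le> 2 * dim U + rank_bound d (card I)"
  using assms
proof (induction "card I" arbitrary: I U rule: less_induct)
  case less
  note fU = less.prems(1) and fI = less.prems(2) and sz = less.prems(3) and pr = less.prems(4)
    and vs = less.prems(5)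
  consider "card I = 0" | "card I = 1" | "card I = 2" | "3 \<le> card I" by linarith
  then show ?case
  proof cases
    case 1
    then show ?thesis using fI by (simp add: rank_bound_def)
  next
    case 2
    then obtain i where "I = {i}" using card_1_singletonE by blast
    then show ?thesis using not_vanishing_single[of U i c P] vs pr by simp
  next
    case 3
    then obtain i j where ij: "I = {i, j}" "i \<noteq> j" by (meson card_2_iff)
    have "set_mset (P i) \<subseteq> span (U \<union> vecs P (I - {i}))"
      using row_in_span_of_others[OF fI vs, of i] pr ij by (auto simp: proper_rows_def)
    moreover have "I - {i} = {j}" using ij by auto
    ultimately have "U \<union> vecs P I \<subseteq> span (U \<union> set_mset (P j))"
      using ij span_superset[of "U \<union> set_mset (P j)"] by auto
    then have "dim (U \<union> vecs P I) \<le> dim (U \<union> set_mset (P j))"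
      using fU by (intro dim_mono_finite) auto
    also have "\<dots> \<le> dim U + d" using dim_Un_mset_le[OF fU, of "P j"] sz[of j] ij by simp
    finally show ?thesis using 3 by (simp add: rank_bound_def)
  next
    case 4
    let ?s = "card I"
    show ?thesis
    proof (rule ccontr)
      assume neg: "\<not> ?thesis"
      have three: "3 \<le> card (rows_meeting (insert l U) I P)" if l: "l \<in> vecs P I" for l
      proof -
        obtain i where i: "i \<in> I" "l \<in># P i" using l by (auto simp: vecs_def)
        define A where "A = rows_meeting (insert l U) I P"
        have iA: "i \<in> A" using i span_base[of l "insert l U"] by (auto simp: A_def rows_meeting_def)
        have AI: "A \<subseteq> I" "finite A" using fI by (auto simp: A_def rows_meeting_def)
        have a1: "1 \<le> card A" using iA AI by (metis One_nat_def Suc_leI card_gt_0_iff empty_iff)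
        have cIA: "card (I - A) = ?s - card A" using AI card_Diff_subset by blast
        have lt: "card (I - A) < ?s" using cIA a1 4 by linarith
        have "2 * dim (insert l U \<union> vecs P (I - A)) \<le> 2 * dim (insert l U) + rank_bound d (card (I - A))"
          using less.hyps[OF lt, of "insert l U"] fU fI sz vanishing_sum_insert[OF vs fI, of l]
            proper_rows_insert[OF pr, of l] less.prems(6) lt unfolding A_def by auto
        moreover have "dim (insert l U) \<le> Suc (dim U)" using dim_insert_finite[OF fU, of l] by auto
        moreover have "dim (U \<union> vecs P I) \<le> dim (insert l U \<union> vecs P (I - A)) + (card A - 1) * (d - 1)"
          using dim_le_via_factor[OF fU fI sz pr vs i A_def] .
        ultimately have "2 * dim (U \<union> vecs P I) \<le>
            2 * dim U + 2 + rank_bound d (?s - card A) + 2 * ((card A - 1) * (d - 1))"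
          unfolding cIA by linarith
        with neg have *: "rank_bound d ?s < 2 + rank_bound d (?s - card A) + 2 * ((card A - 1) * (d - 1))"
          by linarith
        \<comment> \<open>For even \<open>?s\<close>, one row in \<open>A\<close> turns
          \<open>*\<close> into \<open>s d < (s - 2) d + 4\<close>, so \<open>2 \<le> d\<close> is
          essential here: four linear forms with sum zero can span three dimensions, which exceeds
          the bound 2 for \<open>d = 1\<close>.\<close>
        have "card A \<noteq> 1"
        proof
          assume a: "card A = 1"
          show False
          proof (cases "even ?s")
            case True
            then have "?s \<noteq> 3" by auto
            then have s4: "4 \<le> ?s" using 4 by linarith
            then have d2: "2 \<le> d" using less.prems(6) by simp
            have "odd (?s - 1)" using True s4 by simp
            then have "?s * d < (?s - 2) * d + 4"
              using * True by (simp add: rank_bound_def a numeral_2_eq_2)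
            moreover have "?s * d = (?s - 2) * d + 2 * d"
              using le_Suc_ex[OF s4] by (auto simp: add_mult_distrib)
            ultimately show False using d2 by linarith
          next
            case False
            then have "even (?s - 1)" using 4 by simp
            then show False using * a False by (simp add: rank_bound_def)
          qed
        qed
        \<comment> \<open>Two rows in \<open>A\<close> cost \<open>2 + 2 (d - 1) = 2 d\<close>,
          exactly the difference of the two bounds, so \<open>*\<close> compares equal
          numbers.\<close>
        moreover have "card A \<noteq> 2"
        proof
          assume a: "card A = 2"
          have "?s * d = (?s - 2) * d + 2 * d"
            using le_Suc_ex[OF 4] by (auto simp: add_mult_distrib)
          moreover have "(?s - 1) * d = (?s - 2 - 1) * d + 2 * d"
            using le_Suc_ex[OF 4] by (auto simp: add_mult_distrib)
          moreover have "d \<noteq> 0" using sz[OF i(1)] i(2) by (auto simp: nonempty_has_size[symmetric])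
          moreover have "even (?s - 2) = even ?s" using 4 by simp
          ultimately show False
            using * unfolding a rank_bound_def by (auto split: if_splits)
        qed
        ultimately show ?thesis using a1 unfolding A_def by linarith
      qed
      have "3 * dim (U \<union> vecs P I) \<le> 3 * dim U + ?s * d"
        using dim_le_of_occurrences[OF fU fI sz pr three] by simp
      then have "3 * rank_bound d ?s < 2 * (?s * d)" using neg by linarith
      moreover have "2 * (?s * d) \<le> 3 * rank_bound d ?s"
      proof (cases "even ?s")
        case False
        obtain t where t: "?s = 3 + t" using le_Suc_ex[OF 4] by blast
        show ?thesis using False unfolding t by (simp add: rank_bound_def add_mult_distrib)
      qed (simp add: rank_bound_def)
      ultimately show False by linarith
    qed
  qed
qed

lemma proportional_on_points:
  assumes "w \<in> span (insert l U)" "w \<notin> span U"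
  obtains k where "k \<noteq> 0" "\<And>y. point U y \<Longrightarrow> y w = k * y l"
proof -
  obtain k where k: "w - k *s l \<in> span U" using assms(1) span_breakdown_eq by blast
  have "k \<noteq> 0" using k assms(2) by auto
  moreover have "y w = k * y l" if "point U y" for y
    using point_span[OF that k] by (simp add: point_diff[OF that] point_scale[OF that])
  ultimately show ?thesis by (rule that)
qed

lemma span_insert_exchange:
  assumes "w \<in> span (insert l U)" "w \<notin> span U"
  shows "span (insert w U) = span (insert l U)"
proof -
  have "l \<in> span (insert w U)" using assms in_span_insert by blast
  then show ?thesis
    using assms(1) span_superset[of "insert w U"] span_superset[of "insert l U"]
    by (intro subset_antisym) (simp_all add: span_minimal)
qed

lemma rows_meeting_exchange:
  assumes "w \<in> span (insert l U)" "w \<notin> span U"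
  shows "rows_meeting (insert w U) I P = rows_meeting (insert l U) I P"
  using span_insert_exchange[OF assms] by (simp add: rows_meeting_def)

section \<open>Sums of an even number of products\<close>

text \<open>
  In the extremal case the factors are, up to scalars, elements of a basis, and each basis element
  occurs in exactly two rows.
\<close>

theorem vanishing_pair_of_extremal:
  assumes fU: "finite U" and fI: "finite I" and sz: "\<And>i. i \<in> I \<Longrightarrow> size (P i) = d"
    and pr: "proper_rows U I c P" and vs: "vanishing_sum U I c P"
    and ev: "even (card I)" and ne: "I \<noteq> {}" and d: "3 \<le> d"
    and ext: "2 * dim U + card I * d \<le> 2 * dim (U \<union> vecs P I)"
  shows "\<exists>i\<in>I. \<exists>k\<in>I. i \<noteq> k \<and> vanishing_sum U {i, k} c P"
proof (cases "card I = 2")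
  case True
  then obtain i k where "I = {i, k}" "i \<noteq> k" by (meson card_2_iff)
  then show ?thesis using vs by blast
next
  case False
  have "card I \<noteq> 0" using fI ne by simp
  moreover have "card I \<noteq> 1" "card I \<noteq> 3" using ev by auto
  ultimately have c4: "4 \<le> card I" using False by linarith
  \<comment> \<open>A factor in a single row would leave an odd sum on its hyperplane and give twice
    the relative dimension at most \<open>(s - 2) d + 4\<close> for \<open>s = card I\<close>, which
    is below \<open>s d\<close> because \<open>3 \<le> d\<close>.\<close>
  have two: "2 \<le> card (rows_meeting (insert l U) I P)" if l: "l \<in> vecs P I" for l
  proof (rule ccontr)
    assume neg: "\<not> ?thesis"
    obtain i where i: "i \<in> I" "l \<in># P i" using l by (auto simp: vecs_def)
    define A where "A = rows_meeting (insert l U) I P"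
    have iA: "i \<in> A" using i span_base[of l "insert l U"] by (auto simp: A_def rows_meeting_def)
    have AI: "A \<subseteq> I" "finite A" using fI by (auto simp: A_def rows_meeting_def)
    have "1 \<le> card A" using iA AI by (metis One_nat_def Suc_leI card_gt_0_iff empty_iff)
    then have A1: "card A = 1" using neg by (simp add: A_def)
    have cIA: "card (I - A) = card I - 1" using AI A1 card_Diff_subset by metis
    have "2 * dim (insert l U \<union> vecs P (I - A)) \<le> 2 * dim (insert l U) + rank_bound d (card (I - A))"
      using fU fI sz d vanishing_sum_insert[OF vs fI, of l] proper_rows_insert[OF pr, of l]
      unfolding A_def by (intro dim_vanishing_sum_le) auto
    moreover have "dim (insert l U) \<le> Suc (dim U)" using dim_insert_finite[OF fU, of l] by auto
    moreover have "dim (U \<union> vecs P I) \<le> dim (insert l U \<union> vecs P (I - A)) + (card A - 1) * (d - 1)"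
      using dim_le_via_factor[OF fU fI sz pr vs i A_def] .
    moreover have "odd (card I - 1)" using ev c4 by simp
    then have "rank_bound d (card I - 1) = (card I - 2) * d + 2"
      by (simp add: rank_bound_def numeral_2_eq_2)
    moreover have "card I * d = (card I - 2) * d + 2 * d"
      using le_Suc_ex[OF c4] by (auto simp: add_mult_distrib)
    ultimately show False using ext d unfolding cIA A1 by simp
  qed
  obtain B where B: "B \<subseteq> vecs P I" "card B + dim U = dim (U \<union> vecs P I)" "vecs P I \<subseteq> span (U \<union> B)"
    using relative_basis[OF fU finite_vecs[OF fI]] by blast
  have fB: "finite B" using B(1) fI finite_subset finite_vecs by blast
  have "dim (U \<union> vecs P I) \<le> dim (U \<union> B)"
    using B(3) span_superset[of "U \<union> B"] fB fU by (intro dim_mono_finite) auto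
  moreover have "dim (U \<union> B) \<le> dim U + card B" using dim_Un_le_card fU fB by blast
  ultimately have ind: "dim (U \<union> B) = dim U + card B" using B(2) by simp
  define occ where "occ i = {b \<in> B. i \<in> rows_meeting (insert b U) I P}" for i
  have occ: "card (occ i) \<le> d" if "i \<in> I" for i
    unfolding occ_def by (rule basis_occurrences(1)[OF fU fI _ pr fB ind that]) (rule sz)
  have occ_sum: "(\<Sum>i\<in>I. card (occ i)) = (\<Sum>b\<in>B. card (rows_meeting (insert b U) I P))"
    unfolding occ_def by (rule basis_occurrences(2)[OF fU fI _ pr fB ind]) (rule sz)
  have occ_span: "\<exists>b\<in>occ i. w \<in> span (insert b U)" if "i \<in> I" "card (occ i) = d" "w \<in># P i" for i w
    using that(2) unfolding occ_def
    by (rule basis_occurrences(3)[OF fU fI _ pr fB ind that(1) _ that(3), rotated]) (rule sz)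
  \<comment> \<open>The number of occurrences is at least \<open>2 * card B\<close> and at most
    \<open>card I * d\<close>, and extremality gives the reverse comparison. So every single
    estimate is an equality.\<close>
  have "(\<Sum>b\<in>B. 2) \<le> (\<Sum>b\<in>B. card (rows_meeting (insert b U) I P))"
    using two B(1) by (intro sum_mono) blast
  moreover have "(\<Sum>i\<in>I. card (occ i)) \<le> (\<Sum>i\<in>I. d)" using occ by (intro sum_mono)
  ultimately have eqs: "(\<Sum>i\<in>I. card (occ i)) = (\<Sum>i\<in>I. d)"
      "(\<Sum>b\<in>B. 2) = (\<Sum>b\<in>B. card (rows_meeting (insert b U) I P))"
    using occ_sum ext B(2) by auto
  have occ_d: "card (occ i) = d" if "i \<in> I" for i
    using sum_mono_inv[OF eqs(1) occ that fI] by simp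
  have rows2: "card (rows_meeting (insert b U) I P) = 2" if "b \<in> B" for b
    using sum_mono_inv[OF eqs(2) _ that fB] two B(1) by (simp add: subset_iff)
  have w_occ: "\<exists>w\<in>#P i. w \<in> span (insert b U) \<and> w \<notin> span U" if "i \<in> I" "b \<in> occ i" for i b
    using that pr by (auto simp: occ_def rows_meeting_def proper_rows_def)
  have occ_w: "\<exists>b\<in>occ i. w \<in> span (insert b U) \<and> w \<notin> span U" if "i \<in> I" "w \<in># P i" for i w
    using occ_span[OF that(1) occ_d[OF that(1)] that(2)] that pr by (auto simp: proper_rows_def)
  obtain i where i: "i \<in> I" using ne by blast
  \<comment> \<open>At this point row \<open>i\<close> does not vanish, so some other row
    \<open>k\<close> does not vanish either. All basis elements of row \<open>k\<close> must then
    lie in \<open>occ i\<close>, which makes \<open>k\<close> the partner of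
    \<open>i\<close>.\<close>
  obtain y where y: "point U y" "\<And>b. b \<in> B \<Longrightarrow> y b = (if b \<in> occ i then 1 else 0)"
    using relative_point[OF fU fB ind, of "\<lambda>b. if b \<in> occ i then 1 else 0"] by blast
  have "val y (P i) \<noteq> 0"
  proof
    assume "val y (P i) = 0"
    then obtain w where w: "w \<in># P i" "y w = 0" by (auto simp: val_eq_0_iff)
    obtain b where b: "b \<in> occ i" "w \<in> span (insert b U)" "w \<notin> span U"
      using occ_w[OF i w(1)] by blast
    obtain k where "k \<noteq> 0" "y w = k * y b"
      using proportional_on_points[OF b(2,3)] y(1) by blast
    then show False using w(2) y(2)[of b] b(1) by (simp add: occ_def)
  qed
  moreover have "c i \<noteq> 0" using pr i by (simp add: proper_rows_def)
  moreover have "(\<Sum>j\<in>I. c j * val y (P j)) = 0" using vs y(1) by (simp add: vanishing_sum_def)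
  then have "c i * val y (P i) + (\<Sum>j\<in>I - {i}. c j * val y (P j)) = 0"
    using fI i by (simp add: sum.remove)
  ultimately have "(\<Sum>j\<in>I - {i}. c j * val y (P j)) \<noteq> 0" by auto
  then obtain k where k: "k \<in> I" "k \<noteq> i" "val y (P k) \<noteq> 0"
    by (metis (no_types, lifting) DiffD1 DiffD2 insertCI mult_zero_right sum.neutral)
  have "occ k \<subseteq> occ i"
  proof
    fix b assume b: "b \<in> occ k"
    obtain w where w: "w \<in># P k" "w \<in> span (insert b U)" "w \<notin> span U"
      using w_occ[OF k(1) b] by blast
    obtain a where "y w = a * y b" using proportional_on_points[OF w(2,3)] y(1) by blast
    moreover have "y w \<noteq> 0" using k(3) w(1) by (auto simp: val_eq_0_iff)
    moreover have "b \<in> B" using b by (simp add: occ_def)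
    ultimately show "b \<in> occ i" using y(2)[of b] by (auto split: if_splits)
  qed
  then have occ_eq: "occ k = occ i"
    using occ_d[OF i] occ_d[OF k(1)] fB by (intro card_subset_eq) (auto simp: occ_def)
  have rows_ik: "rows_meeting (insert b U) I P = {i, k}" if "b \<in> occ i" for b
  proof -
    have "b \<in> occ k" using that occ_eq by simp
    then have "{i, k} \<subseteq> rows_meeting (insert b U) I P" "b \<in> B"
      using that by (auto simp: occ_def)
    moreover have "finite (rows_meeting (insert b U) I P)" by (rule finite_rows_meeting[OF fI])
    ultimately have "{i, k} = rows_meeting (insert b U) I P"
      using rows2[of b] k(2) by (intro card_subset_eq) auto
    then show ?thesis by simp
  qed
  have "c i * val z (P i) + c k * val z (P k) = 0" if z: "point U z" for z
  proof -
    \<comment> \<open>Setting the basis elements outside \<open>occ i\<close> to 0 leaves rows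
      \<open>i\<close> and \<open>k\<close> unchanged and kills all others: the elements of
      \<open>occ i\<close> have used up their two occurrences in \<open>i\<close> and
      \<open>k\<close>.\<close>
    obtain z' where z': "point U z'" "\<And>b. b \<in> B \<Longrightarrow> z' b = (if b \<in> occ i then z b else 0)"
      using relative_point[OF fU fB ind, of "\<lambda>b. if b \<in> occ i then z b else 0"] by blast
    have same: "val z' (P j) = val z (P j)" if j: "j \<in> I" "occ j = occ i" for j
    proof (rule val_cong)
      fix w assume "w \<in># P j"
      then obtain b where b: "b \<in> occ i" "w \<in> span (insert b U)" "w \<notin> span U"
        using occ_w[OF j(1)] j(2) by blast
      obtain a where a: "\<And>y. point U y \<Longrightarrow> y w = a * y b"
        using proportional_on_points[OF b(2,3)] by blast
      have "z' b = z b" using z'(2)[of b] b(1) by (simp add: occ_def)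
      then show "z' w = z w" using a[OF z] a[OF z'(1)] by simp
    qed
    have zero: "val z' (P j) = 0" if j: "j \<in> I - {i, k}" for j
    proof -
      have "occ j \<noteq> {}" using occ_d[of j] j d by force
      then obtain b where b: "b \<in> occ j" by blast
      then have "b \<notin> occ i" using rows_ik[of b] j by (auto simp: occ_def)
      then have "z' b = 0" using z'(2)[of b] b by (simp add: occ_def)
      moreover obtain w where w: "w \<in># P j" "w \<in> span (insert b U)" "w \<notin> span U"
        using w_occ[of j b] b j by blast
      moreover obtain a where "z' w = a * z' b"
        using proportional_on_points[OF w(2,3)] z'(1) by blast
      ultimately show ?thesis by (auto simp: val_eq_0_iff)
    qed
    have "0 = (\<Sum>j\<in>I. c j * val z' (P j))" using vs z'(1) by (simp add: vanishing_sum_def)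
    also have "\<dots> = (\<Sum>j\<in>{i, k}. c j * val z' (P j))"
      using zero i k(1) fI by (intro sum.mono_neutral_right) auto
    also have "\<dots> = c i * val z (P i) + c k * val z (P k)"
      using same[OF i] same[OF k(1) occ_eq] k(2) by auto
    finally show ?thesis by simp
  qed
  then have "vanishing_sum U {i, k} c P" using k(2) by (simp add: vanishing_sum_def)
  moreover have "i \<noteq> k" using k(2) by simp
  ultimately show ?thesis using i k(1) by (intro bexI[of _ i] bexI[of _ k] conjI)
qed

section \<open>Restriction to lines\<close>

definition line_poly :: "('b \<Rightarrow> 'a) \<Rightarrow> ('b \<Rightarrow> 'a) \<Rightarrow> 'b multiset \<Rightarrow> 'a poly" where
  "line_poly y z M = (\<Prod>v\<in>#M. [:y v, z v:])"

lemma line_poly_empty [simp]: "line_poly y z {#} = 1"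
  and line_poly_add_mset [simp]: "line_poly y z (add_mset v M) = [:y v, z v:] * line_poly y z M"
  and line_poly_union: "line_poly y z (M + N) = line_poly y z M * line_poly y z N"
  by (simp_all add: line_poly_def)

lemma poly_line_poly: "poly (line_poly y z M) t = val (\<lambda>v. y v + t * z v) M"
  by (induction M) (simp_all add: algebra_simps)

lemma poly_eq_0_of_cofinite:
  assumes "finite A" "\<And>t. t \<notin> A \<Longrightarrow> poly p t = 0"
  shows "p = (0 :: 'a poly)"
proof (rule ccontr)
  assume "p \<noteq> 0"
  then have "finite {t. poly p t = 0}" by (rule poly_roots_finite)
  moreover have "UNIV \<subseteq> A \<union> {t. poly p t = 0}" using assms(2) by auto
  ultimately have "finite (UNIV :: 'a set)" using assms(1) by (meson finite_UnI finite_subset)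
  then show False using infinite_scalars by simp
qed

text \<open>Polynomial functions on the section have no zero divisors. Along a line in a direction
  \<open>z\<close> with \<open>z l = 1\<close>, the form \<open>l\<close> has only one zero, so the
  sum vanishes at all other parameters and hence as a polynomial, also at the given point.\<close>

lemma vanishing_sum_cancel:
  assumes "l \<notin> span U"
    and "\<And>y. point U y \<Longrightarrow> y l * (\<Sum>i\<in>I. c i * val y (P i)) = 0"
  shows "vanishing_sum U I c P"
  unfolding vanishing_sum_def
proof (intro allI impI)
  fix y assume y: "point U y"
  obtain z where z: "point U z" "z l = 1" by (rule separating_point[OF assms(1)])
  define p where "p = (\<Sum>i\<in>I. smult (c i) (line_poly y z (P i)))"
  have poly_p: "poly p t = (\<Sum>i\<in>I. c i * val (\<lambda>v. y v + t * z v) (P i))" for t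
    by (simp add: p_def poly_sum poly_line_poly)
  have "p = 0"
  proof (rule poly_eq_0_of_cofinite[of "{- y l}"])
    fix t assume "t \<notin> {- y l}"
    then have "y l + t * z l \<noteq> 0" using z(2) by (simp add: add_eq_0_iff)
    then show "poly p t = 0"
      using assms(2)[OF point_line[OF y z(1), of t]] by (simp add: poly_p)
  qed simp
  then show "(\<Sum>i\<in>I. c i * val y (P i)) = 0" using poly_p[of 0] by simp
qed

section \<open>Sums of four products\<close>

lemma size_filter_disjoint:
  assumes "\<And>x. \<not> (Q x \<and> R x)"
  shows "size (filter_mset Q M) + size (filter_mset R M) \<le> size M"
  using assms by (induction M) auto

text \<open>
  A factor common to all rows can be divided out.  If there is none, each factor is shared by
  exactly two rows, and on its hyperplane the two remaining rows are proportional.  A row that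
  shares factors with two different rows then gives the bound \<open>3 d / 2\<close>, and otherwise the rows
  split into two pairs depending on disjoint sets of factors.
\<close>

theorem dim_four_rows_le:
  assumes "finite U" "card I = 4" "\<And>i. i \<in> I \<Longrightarrow> size (P i) = d"
    and "proper_rows U I c P" "vanishing_sum U I c P"
    and "\<And>i k. i \<in> I \<Longrightarrow> k \<in> I \<Longrightarrow> i \<noteq> k \<Longrightarrow> \<not> vanishing_sum U {i, k} c P"
  shows "dim (U \<union> vecs P I) \<le> dim U + d + 2 \<or> 2 * dim (U \<union> vecs P I) \<le> 2 * dim U + 3 * d"
  using assms
\<comment> \<open>The induction serves the division by a common factor: it lowers \<open>d\<close>
  by one and the dimension by at most one, which both alternatives of the bound tolerate.\<close>
proof (induction d arbitrary: c P)
  case 0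
  then have "vecs P I = {}" by (auto simp: vecs_def)
  then show ?case by simp
next
  case (Suc d)
  note fU = Suc.prems(1) and c4 = Suc.prems(2) and sz = Suc.prems(3) and pr = Suc.prems(4)
    and vs = Suc.prems(5) and np = Suc.prems(6)
  have fI: "finite I" using c4 by (metis card.infinite zero_neq_numeral)
  define R where "R w = rows_meeting (insert w U) I P" for w
  have RI: "R w \<subseteq> I" "finite (R w)" for w using fI by (auto simp: R_def rows_meeting_def)
  have self: "i \<in> R w" if "i \<in> I" "w \<in># P i" for i w
    using that span_base[of w "insert w U"] by (auto simp: R_def rows_meeting_def)
  have R_mem: "\<exists>w'\<in>#P j. w' \<in> span (insert w U) \<and> w' \<notin> span U \<and> w \<in> span (insert w' U) \<and> R w' = R w"
    if "j \<in> R w" for j w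
  proof -
    obtain w' where w': "w' \<in># P j" "w' \<in> span (insert w U)" "w' \<notin> span U"
      using \<open>j \<in> R w\<close> pr by (auto simp: R_def rows_meeting_def proper_rows_def)
    then show ?thesis
      using in_span_insert[of w' w U] rows_meeting_exchange[OF w'(2,3), of I P] by (auto simp: R_def)
  qed
  show ?case
  proof (rule ccontr)
    assume neg: "\<not> ?case"
    \<comment> \<open>Three rows containing \<open>l\<close> would leave a single nonzero row on
      \<open>l = 0\<close>. One row containing \<open>l\<close> would leave three rows there, and
      their bound yields the first alternative.\<close>
    have card_R: "card (R l) \<in> {2, 4}" if l: "l \<in> vecs P I" for l
    proof -
      obtain i where i: "i \<in> I" "l \<in># P i" using l by (auto simp: vecs_def)
      have le: "card (R l) \<le> 4" using RI[of l] fI c4 by (metis card_mono)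
      have "card (R l) \<noteq> 0" using self[OF i] RI(2) by auto
      moreover have "card (R l) \<noteq> 3"
      proof
        assume "card (R l) = 3"
        then have "card (I - R l) = 1" using RI c4 by (simp add: card_Diff_subset)
        then obtain n where "I - R l = {n}" using card_1_singletonE by blast
        then show False
          using not_vanishing_single[of "insert l U" n c P] vanishing_sum_insert[OF vs fI, of l]
            proper_rows_insert[OF pr, of l] by (simp add: R_def)
      qed
      moreover have "card (R l) \<noteq> 1"
      proof
        assume R1: "card (R l) = 1"
        then have c3: "card (I - R l) = 3" using RI c4 by (simp add: card_Diff_subset)
        have "2 * dim (insert l U \<union> vecs P (I - R l)) \<le>
            2 * dim (insert l U) + rank_bound (Suc d) (card (I - R l))"
          using fU fI sz c3 vanishing_sum_insert[OF vs fI, of l] proper_rows_insert[OF pr, of l]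
          unfolding R_def by (intro dim_vanishing_sum_le) auto
        moreover have "dim (insert l U) \<le> Suc (dim U)" using dim_insert_finite[OF fU, of l] by auto
        moreover have "dim (U \<union> vecs P I) \<le>
            dim (insert l U \<union> vecs P (I - R l)) + (card (R l) - 1) * (Suc d - 1)"
          using dim_le_via_factor[OF fU fI sz pr vs i R_def] .
        ultimately show False using neg unfolding c3 R1 by (simp add: rank_bound_def)
      qed
      ultimately show ?thesis using le by auto
    qed
    show False
    proof (cases "\<exists>l\<in>vecs P I. card (R l) = 4")
      case True
      then obtain l where l: "l \<in> vecs P I" "card (R l) = 4" by blast
      then have RlI: "R l = I" using RI[of l] fI c4 by (simp add: card_subset_eq)
      have l_notin: "l \<notin> span U" using l(1) pr by (auto simp: vecs_def proper_rows_def)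
      have "\<exists>w M k. P j = add_mset w M \<and> w \<in> span (insert l U) \<and> k \<noteq> 0 \<and>
          (\<forall>y. point U y \<longrightarrow> y w = k * y l)" if j: "j \<in> I" for j
      proof -
        obtain w where w: "w \<in># P j" "w \<in> span (insert l U)" "w \<notin> span U"
          using R_mem[of j l] RlI j by blast
        obtain k where "k \<noteq> 0" "\<And>y. point U y \<Longrightarrow> y w = k * y l"
          using proportional_on_points[OF w(2,3)] by blast
        then show ?thesis using w(1,2) multi_member_split[OF w(1)] by blast
      qed
      then obtain w M k where wMk: "\<And>j. j \<in> I \<Longrightarrow> P j = add_mset (w j) (M j)"
          "\<And>j. j \<in> I \<Longrightarrow> w j \<in> span (insert l U)" "\<And>j. j \<in> I \<Longrightarrow> k j \<noteq> 0"
          "\<And>j y. j \<in> I \<Longrightarrow> point U y \<Longrightarrow> y (w j) = k j * y l"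
        by metis
      define c' where "c' j = c j * k j" for j
      have fac: "c j * val y (P j) = y l * (c' j * val y (M j))" if "j \<in> I" "point U y" for j y
        using wMk(1)[OF that(1)] wMk(4)[OF that] by (simp add: c'_def)
      have "vanishing_sum U I c' M"
      proof (rule vanishing_sum_cancel[OF l_notin])
        fix y assume y: "point U y"
        have "(\<Sum>j\<in>I. c j * val y (P j)) = 0" using vs y by (simp add: vanishing_sum_def)
        then show "y l * (\<Sum>j\<in>I. c' j * val y (M j)) = 0"
          using fac[OF _ y] by (simp add: sum_distrib_left)
      qed
      moreover have "\<not> vanishing_sum U {i, j} c' M" if ij: "i \<in> I" "j \<in> I" "i \<noteq> j" for i j
      proof
        assume *: "vanishing_sum U {i, j} c' M"
        have "c i * val y (P i) + c j * val y (P j) = 0" if y: "point U y" for y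
          using * y fac[OF ij(1) y] fac[OF ij(2) y] ij(3)
          by (simp add: vanishing_sum_def distrib_left[symmetric])
        then show False using np[OF ij] ij(3) by (simp add: vanishing_sum_def)
      qed
      moreover have "proper_rows U I c' M"
        using pr wMk(1,3) by (auto simp: proper_rows_def c'_def)
      moreover have "size (M i) = d" if "i \<in> I" for i using sz[OF that] wMk(1)[OF that] by simp
      ultimately have IH: "dim (U \<union> vecs M I) \<le> dim U + d + 2 \<or> 2 * dim (U \<union> vecs M I) \<le> 2 * dim U + 3 * d"
        using fU c4 by (intro Suc.IH)
      have fM: "finite (U \<union> vecs M I)" using fU fI by (simp add: finite_vecs)
      have "vecs P I \<subseteq> span (insert l (U \<union> vecs M I))"
      proof
        fix v assume "v \<in> vecs P I"
        then obtain j where j: "j \<in> I" "v \<in># P j" by (auto simp: vecs_def)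
        show "v \<in> span (insert l (U \<union> vecs M I))"
        proof (cases "v = w j")
          case True
          then show ?thesis
            using wMk(2)[OF j(1)] span_mono[of "insert l U" "insert l (U \<union> vecs M I)"] by blast
        next
          case False
          then have "v \<in> vecs M I" using j wMk(1) by (auto simp: vecs_def)
          then show ?thesis by (intro span_base) blast
        qed
      qed
      then have "dim (U \<union> vecs P I) \<le> dim (insert l (U \<union> vecs M I))"
        using fM span_superset[of "insert l (U \<union> vecs M I)"] by (intro dim_mono_finite) auto
      also have "\<dots> \<le> Suc (dim (U \<union> vecs M I))" using dim_insert_finite[OF fM, of l] by auto
      finally have le: "dim (U \<union> vecs P I) \<le> Suc (dim (U \<union> vecs M I))" .
      from IH show False
      proof
        assume "dim (U \<union> vecs M I) \<le> dim U + d + 2"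
        then show False using le neg by simp
      next
        assume "2 * dim (U \<union> vecs M I) \<le> 2 * dim U + 3 * d"
        then show False using le neg by simp
      qed
    next
      case False
      then have R2: "card (R l) = 2" if "l \<in> vecs P I" for l using card_R that by blast
      have R2': "card (R l) = 2" if "i \<in> I" "l \<in># P i" for i l
        using R2 that by (auto simp: vecs_def)
      have pairs: "\<exists>k. k \<in> I \<and> k \<noteq> i \<and> R w = {i, k}" if iw: "i \<in> I" "w \<in># P i" for i w
      proof -
        obtain a b where "R w = {a, b}" "a \<noteq> b" using R2'[OF iw] by (meson card_2_iff)
        then show ?thesis using self[OF iw] RI(1)[of w] by auto
      qed
      \<comment> \<open>On \<open>l = 0\<close> only the rows \<open>m\<close> and \<open>n\<close>
        survive, so row \<open>m\<close> lies in the span of row \<open>n\<close>, \<open>l\<close>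
        and \<open>U\<close>. Every factor not shared by exactly \<open>i\<close> and
        \<open>k\<close> is proportional to a factor of \<open>m\<close> or \<open>n\<close>; the
        others are represented in \<open>?S\<close>.\<close>
      have bound: "dim (U \<union> vecs P I) \<le> dim U + size (filter_mset (\<lambda>w. R w = {i, k}) (P i)) + Suc d"
        if i: "i \<in> I" "l \<in># P i" "R l = {i, k}" "i \<noteq> k" for i k l
      proof -
        let ?S = "filter_mset (\<lambda>w. R w = {i, k}) (P i)"
        have k: "k \<in> I" using RI(1)[of l] i(3) by blast
        have "card (I - {i, k}) = 2" using c4 i k by (simp add: card_Diff_subset)
        then obtain m n where mn: "I - {i, k} = {m, n}" "m \<noteq> n" by (meson card_2_iff)
        then have mnI: "m \<in> I" "n \<in> I" and I_eq: "I = {i, k, m, n}" using i(1) k by auto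
        let ?T = "U \<union> set_mset ?S \<union> set_mset (P n)"
        have lT: "span (insert l U) \<subseteq> span ?T" using i(2,3) by (intro span_mono) auto
        have "set_mset (P m) \<subseteq> span (insert l U \<union> vecs P ({m, n} - {m}))"
          using vanishing_sum_insert[OF vs fI, of l] proper_rows_insert[OF pr, of l] mn i(3)
          by (intro row_in_span_of_others[of "{m, n}"]) (auto simp: R_def proper_rows_def)
        also have "\<dots> \<subseteq> span ?T"
        proof (intro span_minimal subspace_span)
          show "insert l U \<union> vecs P ({m, n} - {m}) \<subseteq> span ?T"
            using lT span_superset[of "insert l U"] span_superset[of ?T] mn(2)
            by (auto simp: vecs_def)
        qed
        finally have Pm: "set_mset (P m) \<subseteq> span ?T" .
        have Pn: "set_mset (P n) \<subseteq> span ?T" using span_superset[of ?T] by blast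
        have UT: "U \<subseteq> span ?T" using span_superset[of ?T] by blast
        have via: "w \<in> span ?T" if w: "w \<in> span (insert w' U)" "w' \<in> span ?T" for w w'
        proof -
          have "span (insert w' U) \<subseteq> span ?T" using w(2) UT by (intro span_minimal) auto
          then show ?thesis using w(1) by blast
        qed
        have "w \<in> span ?T" if j: "j \<in> I" "w \<in># P j" for w j
        proof -
          obtain x where x: "x \<in> I" "x \<noteq> j" "R w = {j, x}" using pairs[OF j] by blast
          have mem: "w' \<in> span ?T" if "w' \<in># P i" "R w' = {i, k}" for w'
            using that by (intro span_base) auto
          consider "j \<in> {m, n}" | "x \<in> {m, n}" | "j = i" "x = k" | "j = k" "x = i"
            using I_eq j(1) x(1,2) by blast
          then show ?thesis
          proof cases
            case 1
            then show ?thesis using j(2) Pm Pn by auto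
          next
            case 2
            then obtain w' where "w' \<in># P x" "w \<in> span (insert w' U)" using R_mem[of x w] x(3) by auto
            then show ?thesis using 2 Pm Pn via[of w w'] by auto
          next
            case 3
            then show ?thesis using mem j x(3) by blast
          next
            case 4
            then obtain w' where "w' \<in># P i" "w \<in> span (insert w' U)" "R w' = {i, k}"
              using R_mem[of i w] x(3) by (auto simp: insert_commute)
            then show ?thesis using mem via by blast
          qed
        qed
        then have "U \<union> vecs P I \<subseteq> span ?T" using UT by (auto simp: vecs_def)
        then have "dim (U \<union> vecs P I) \<le> dim ?T" using fU by (intro dim_mono_finite) auto
        also have "\<dots> \<le> dim (U \<union> set_mset ?S) + size (P n)" using fU by (intro dim_Un_mset_le) auto
        also have "\<dots> \<le> dim U + size ?S + Suc d"
          using dim_Un_mset_le[OF fU, of ?S] sz[OF mnI(2)] by simp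
        finally show ?thesis .
      qed
      have "\<exists>k. k \<in> I \<and> k \<noteq> i \<and> (\<forall>w\<in>#P i. R w = {i, k})" if i: "i \<in> I" for i
      proof -
        have "P i \<noteq> {#}" using sz[OF i] by auto
        then obtain l where l: "l \<in># P i" by blast
        obtain k where k: "k \<in> I" "k \<noteq> i" "R l = {i, k}" using pairs[OF i l] by blast
        have "R w = {i, k}" if w: "w \<in># P i" for w
        proof (rule ccontr)
          assume ne: "R w \<noteq> {i, k}"
          obtain k' where k': "k' \<in> I" "k' \<noteq> i" "R w = {i, k'}" using pairs[OF i w] by blast
          \<comment> \<open>With two different partners, the smaller of the two disjoint shared
            parts has at most half the size of the row, and \<open>bound\<close> for that part gives
            three halves of the row size.\<close>
          have "size (filter_mset (\<lambda>w. R w = {i, k}) (P i)) +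
              size (filter_mset (\<lambda>w. R w = {i, k'}) (P i)) \<le> size (P i)"
            using ne k'(3) by (intro size_filter_disjoint) auto
          then show False
            using bound[OF i l k(3)] bound[OF i w k'(3)] k(2) k'(2) sz[OF i] neg by fastforce
        qed
        then show ?thesis using k by blast
      qed
      then obtain partner where partner: "\<And>i. i \<in> I \<Longrightarrow> partner i \<in> I"
          "\<And>i. i \<in> I \<Longrightarrow> partner i \<noteq> i" "\<And>i w. i \<in> I \<Longrightarrow> w \<in># P i \<Longrightarrow> R w = {i, partner i}"
        by metis
      have sym: "partner (partner i) = i" if i: "i \<in> I" for i
      proof -
        have "P i \<noteq> {#}" using sz[OF i] by auto
        then obtain l where l: "l \<in># P i" by blast
        then obtain w where "w \<in># P (partner i)" "R w = R l"
          using R_mem[of "partner i" l] partner(3)[OF i l] by blast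
        then have "{partner i, partner (partner i)} = {i, partner i}"
          using partner(3)[OF partner(1)[OF i]] partner(3)[OF i l] by simp
        then show ?thesis using partner(2)[OF i] by (auto simp: doubleton_eq_iff)
      qed
      have "I \<noteq> {}" using c4 by auto
      then obtain i where i: "i \<in> I" by blast
      define k where "k = partner i"
      have k: "k \<in> I" "k \<noteq> i" using partner i by (auto simp: k_def)
      have "card (I - {i, k}) = 2" using c4 i k by (simp add: card_Diff_subset)
      then have "I - {i, k} \<noteq> {}" by (metis card.empty zero_neq_numeral)
      then obtain m where m: "m \<in> I" "m \<noteq> i" "m \<noteq> k" by blast
      define n where "n = partner m"
      have n: "n \<in> I" "n \<noteq> m" using partner m(1) by (auto simp: n_def)
      have n': "n \<noteq> i" "n \<noteq> k" using m sym[OF m(1)] sym[OF i] by (auto simp: n_def k_def)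
      have "card {i, k, m, n} = 4" using k m n n' by simp
      then have I_eq: "I = {i, k, m, n}"
        using c4 i k m n fI by (metis card_subset_eq empty_subsetI insert_subset)
      have spans: "set_mset (P (partner j)) \<subseteq> span (U \<union> set_mset (P j))" if j: "j \<in> I" for j
      proof
        fix w assume w: "w \<in># P (partner j)"
        have "j \<in> R w" using partner(3)[OF partner(1)[OF j] w] sym[OF j] by simp
        then obtain w' where "w' \<in># P j" "w \<in> span (insert w' U)" using R_mem by blast
        then show "w \<in> span (U \<union> set_mset (P j))"
          using span_mono[of "insert w' U" "U \<union> set_mset (P j)"] by auto
      qed
      have "\<not> vanishing_sum U {i, k} c P" using np i k by blast
      then obtain y where y: "point U y" "c i * val y (P i) + c k * val y (P k) \<noteq> 0"
        using k(2) by (auto simp: vanishing_sum_def)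
      \<comment> \<open>Otherwise \<open>y\<close> can be moved, invisibly to rows \<open>m\<close>
        and \<open>n\<close>, until \<open>l\<close> and with it both rows \<open>i\<close> and
        \<open>k\<close> vanish. Then \<open>m\<close> and \<open>n\<close> cancel at
        \<open>y\<close>, hence so do \<open>i\<close> and \<open>k\<close>, against the choice of
        \<open>y\<close>.\<close>
      have Pi: "set_mset (P i) \<subseteq> span (U \<union> set_mset (P m))"
      proof (rule ccontr)
        assume "\<not> ?thesis"
        then obtain l where l: "l \<in># P i" "l \<notin> span (U \<union> set_mset (P m))" by blast
        obtain z where z: "point (U \<union> set_mset (P m)) z" "z l = 1" by (rule separating_point[OF l(2)])
        define x where "x = (\<lambda>v. y v + (- y l) * z v)"
        have zU: "point U z" using z(1) by (auto simp: point_def)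
        have x: "point U x" unfolding x_def by (rule point_line[OF y(1) zU])
        have "x l = 0" using z(2) by (simp add: x_def)
        then have xl: "point (insert l U) x" using x by (simp add: point_def)
        have "i \<in> R l" "k \<in> R l" using partner(3)[OF i l(1)] by (auto simp: k_def)
        then have "val x (P i) = 0" "val x (P k) = 0"
          using val_meeting_eq_0[OF xl] by (auto simp: R_def rows_meeting_def)
        moreover have same: "val x (P j) = val y (P j)" if j: "j = m \<or> j = n" for j
        proof (rule val_cong)
          fix v assume "v \<in># P j"
          then have "v \<in> span (U \<union> set_mset (P m))"
            using j spans[OF m(1)] span_superset[of "U \<union> set_mset (P m)"] by (auto simp: n_def)
          then have "z v = 0" by (rule point_span[OF z(1)])
          then show "x v = y v" by (simp add: x_def)
        qed
        moreover have "(\<Sum>j\<in>I. c j * val x (P j)) = 0" "(\<Sum>j\<in>I. c j * val y (P j)) = 0"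
          using vs x y(1) by (simp_all add: vanishing_sum_def)
        ultimately show False using y(2) k m n n' unfolding I_eq by simp
      qed
      have "span (U \<union> set_mset (P i)) \<subseteq> span (U \<union> set_mset (P m))"
        using Pi span_superset[of "U \<union> set_mset (P m)"] by (intro span_minimal) auto
      then have "U \<union> vecs P I \<subseteq> span (U \<union> set_mset (P m))"
        using Pi spans[OF i] spans[OF m(1)] span_superset[of "U \<union> set_mset (P m)"]
        unfolding I_eq k_def n_def by auto
      then have "dim (U \<union> vecs P I) \<le> dim (U \<union> set_mset (P m))"
        using fU by (intro dim_mono_finite) auto
      also have "\<dots> \<le> dim U + Suc d" using dim_Un_mset_le[OF fU, of "P m"] sz[OF m(1)] by simp
      finally show False using neg by linarith
    qed
  qed
qed

section \<open>Rows with designated factors\<close>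

lemma vanishing_sum_Diff:
  assumes "finite I" "J \<subseteq> I" "vanishing_sum U I c P" "vanishing_sum U J c P"
  shows "vanishing_sum U (I - J) c P"
  using assms by (simp add: vanishing_sum_def sum_diff)

lemma rank_bound_le: "rank_bound d s \<le> s * d" if "2 \<le> d"
proof (cases "even s")
  case False
  then obtain t where "s = Suc t" by (cases s) auto
  then show ?thesis using False that by (simp add: rank_bound_def)
qed (simp add: rank_bound_def)

text \<open>Each row of \<open>Z\<close> has a designated factor in \<open>span S\<close> and so
  loses one dimension. The additive form avoids subtraction in the later accounting.\<close>

lemma dim_Un_designated_le:
  assumes "finite S" "finite Q" "\<And>i. i \<in> Z \<Longrightarrow> set_mset (X i) \<inter> span S \<noteq> {}" "Z \<subseteq> Q"
  shows "dim (S \<union> vecs X Q) + card Z \<le> dim (S \<union> vecs X (Q - Z)) + (\<Sum>i\<in>Z. size (X i))"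
proof -
  let ?S = "S \<union> vecs X (Q - Z)"
  have fZ: "finite Z" using assms finite_subset by blast
  have "S \<union> vecs X Q = ?S \<union> vecs X Z" using assms(4) by (auto simp: vecs_def)
  moreover have "set_mset (X i) \<inter> span ?S \<noteq> {}" if "i \<in> Z" for i
    using assms(3)[OF that] span_mono[of S ?S] by blast
  then have "dim (?S \<union> vecs X Z) \<le> dim ?S + (\<Sum>i\<in>Z. size (X i) - 1)"
    using assms fZ by (intro dim_Un_meeting_vecs_le) (auto simp: finite_vecs)
  ultimately have "dim (S \<union> vecs X Q) \<le> dim ?S + (\<Sum>i\<in>Z. size (X i) - 1)" by simp
  moreover have "(\<Sum>i\<in>Z. size (X i) - 1) + card Z = (\<Sum>i\<in>Z. size (X i))"
  proof -
    have "(\<Sum>i\<in>Z. size (X i) - 1) + (\<Sum>i\<in>Z. 1) = (\<Sum>i\<in>Z. size (X i))"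
      unfolding sum.distrib[symmetric]
    proof (rule sum.cong)
      fix i assume "i \<in> Z"
      then have "X i \<noteq> {#}" using assms(3) by force
      then show "size (X i) - 1 + 1 = size (X i)" by (simp add: nonempty_has_size Suc_leI)
    qed simp
    then show ?thesis by simp
  qed
  ultimately show ?thesis by linarith
qed

text \<open>Intended for \<open>m = 2\<close> on the hyperplane of a factor of one product: the
  other product, row \<open>k\<close>, and the three rows with variables remain. A loss of two
  dimensions is more than one additional linear equation can cause if the variables were
  independent.\<close>

lemma dim_three_designated_rows_le:
  assumes fU: "finite U" and c3: "card Q = 3" and k: "k \<notin> Q" and d: "1 \<le> d"
    and sz: "\<And>i. i \<in> insert k Q \<Longrightarrow> size (P i) = d"
    and P: "\<And>i. i \<in> Q \<Longrightarrow> P i = F i + X i"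
    and F: "\<And>i. i \<in> Q \<Longrightarrow> set_mset (F i) \<inter> span U = {}"
    and cnz: "\<And>i. i \<in> Q \<Longrightarrow> c i \<noteq> 0"
    and deg: "\<And>i j. i \<in> Q \<Longrightarrow> j \<in> Q \<Longrightarrow> i \<noteq> j \<Longrightarrow> d + 2 \<le> size (X i) + size (X j)"
    and vs: "vanishing_sum U (insert k Q) c P"
  shows "dim (U \<union> vecs X Q) + 2 \<le> dim U + (\<Sum>i\<in>Q. size (X i))"
proof -
  have fQ: "finite Q" using c3 by (metis card.infinite zero_neq_numeral)
  define Z where "Z = {i \<in> insert k Q. c i = 0 \<or> set_mset (P i) \<inter> span U \<noteq> {}}"
  define I where "I = insert k Q - Z"
  have fI: "finite I" using fQ by (simp add: I_def)
  have prI: "proper_rows U I c P" by (auto simp: proper_rows_def I_def Z_def)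
  have vsI: "vanishing_sum U I c P"
    using fQ span_superset[of U] by (intro vanishing_sum_section[OF vs]) (auto simp: I_def Z_def)
  have szI: "size (P i) = d" if "i \<in> I" for i using sz that by (simp add: I_def)
  have XZ: "set_mset (X i) \<inter> span U \<noteq> {}" if "i \<in> Q \<inter> Z" for i
    using that cnz[of i] P[of i] F[of i] by (auto simp: Z_def)
  have "dim (U \<union> vecs X Q) + card (Q \<inter> Z) \<le>
      dim (U \<union> vecs X (Q - Q \<inter> Z)) + (\<Sum>i\<in>Q \<inter> Z. size (X i))"
    using XZ by (intro dim_Un_designated_le fU fQ) auto
  moreover have "Q - Q \<inter> Z = Q - Z" by blast
  then have "dim (U \<union> vecs X (Q - Q \<inter> Z)) = dim (U \<union> vecs X (Q - Z))" by simp
  moreover have "(\<Sum>i\<in>Q. size (X i)) = (\<Sum>i\<in>Q - Z. size (X i)) + (\<Sum>i\<in>Q \<inter> Z. size (X i))"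
    using fQ by (simp add: sum.Int_Diff[of Q _ Z] add.commute)
  moreover have "card (Q \<inter> Z) = 3 - card (Q - Z)" "card (Q - Z) \<le> 3"
    using c3 fQ card_mono[of Q "Q - Z"] card_Diff_subset_Int[of Q Z] card_mono[of Q "Q \<inter> Z"] by auto
  \<comment> \<open>A row of \<open>Q\<close> that vanishes on the section does so because of a
    variable, not of \<open>F i\<close>, and thus already saves one dimension. The surviving rows
    only have to save the rest of the two.\<close>
  moreover have "dim (U \<union> vecs X (Q - Z)) + 2 \<le>
      dim U + (\<Sum>i\<in>Q - Z. size (X i)) + (3 - card (Q - Z))"
  proof -
    have subX: "U \<union> vecs X (Q - Z) \<subseteq> span (U \<union> vecs P I)"
    proof -
      have "U \<union> vecs X (Q - Z) \<subseteq> U \<union> vecs P I" using P by (auto simp: vecs_def I_def)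
      then show ?thesis using span_superset[of "U \<union> vecs P I"] by blast
    qed
    have XI: "dim (U \<union> vecs X (Q - Z)) \<le> dim (U \<union> vecs P I)"
      using subX fU fI by (intro dim_mono_finite) (auto simp: finite_vecs)
    have small: "dim (U \<union> vecs X (Q - Z)) \<le> dim U + d + 1" if "card I \<in> {2, 3}"
    proof -
      have "2 * dim (U \<union> vecs P I) \<le> 2 * dim U + rank_bound d (card I)"
        using fU fI szI prI vsI that by (intro dim_vanishing_sum_le) auto
      then show ?thesis using XI that by (auto simp: rank_bound_def)
    qed
    consider "card (Q - Z) = 0" | "card (Q - Z) = 1" | "card (Q - Z) = 2" | "card (Q - Z) = 3"
      using \<open>card (Q - Z) \<le> 3\<close> by linarith
    then show ?thesis
    proof cases
      case 1
      then have "Q - Z = {}" using fQ by (metis card_0_eq finite_Diff)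
      then show ?thesis unfolding \<open>Q - Z = {}\<close> by simp
    next
      case 2
      then obtain i where "Q - Z = {i}" using card_1_singletonE by blast
      then show ?thesis using dim_Un_mset_le[OF fU, of "X i"] by simp
    next
      case 3
      then obtain i j where ij: "Q - Z = {i, j}" "i \<noteq> j" by (meson card_2_iff)
      have "I = {i, j} \<or> I = {k, i, j}" using ij by (auto simp: I_def)
      moreover have "k \<noteq> i" "k \<noteq> j" using k ij by auto
      ultimately have "card I \<in> {2, 3}" using ij(2) by auto
      moreover have "d + 2 \<le> size (X i) + size (X j)" using deg ij by blast
      ultimately show ?thesis using small ij by simp
    next
      case 4
      then have QZ: "Q - Z = Q" using c3 fQ by (metis Diff_subset card_subset_eq)
      obtain i1 i2 i3 where Q: "Q = {i1, i2, i3}" "i1 \<noteq> i2" "i1 \<noteq> i3" "i2 \<noteq> i3"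
        using c3 by (auto simp: card_3_iff)
      have sums: "d + 2 \<le> size (X i1) + size (X i2)" "d + 2 \<le> size (X i1) + size (X i3)"
          "d + 2 \<le> size (X i2) + size (X i3)"
        using deg Q by auto
      have tot: "(\<Sum>i\<in>Q. size (X i)) = size (X i1) + size (X i2) + size (X i3)"
        using Q by simp
      show ?thesis
      proof (cases "k \<in> Z")
        case True
        then have "I = Q" using QZ by (auto simp: I_def)
        then have "dim (U \<union> vecs X Q) \<le> dim U + d + 1" using small c3 QZ by simp
        then show ?thesis using sums tot unfolding QZ c3 by linarith
      next
        case False
        then have I: "I = insert k Q" using QZ by (auto simp: I_def)
        then have I4: "card I = 4" using k c3 fQ by simp
        have pair: ?thesis if ab: "Q = {a, b, e}" "a \<noteq> b" "e \<noteq> a" "e \<noteq> b" "vanishing_sum U {a, b} c P" for a b e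
        proof -
          have "2 * dim (U \<union> vecs P {a, b}) \<le> 2 * dim U + rank_bound d (card {a, b})"
            using fU ab sz proper_rows_mono[OF prI, of "{a, b}"] by (intro dim_vanishing_sum_le) (auto simp: I)
          then have *: "dim (U \<union> vecs P {a, b}) \<le> dim U + d" using ab(2) by (simp add: rank_bound_def)
          have fab: "finite (U \<union> vecs P {a, b})" using fU by (simp add: finite_vecs)
          have "U \<union> vecs X Q \<subseteq> (U \<union> vecs P {a, b}) \<union> set_mset (X e)"
            using P ab(1) by (auto simp: vecs_def)
          then have "dim (U \<union> vecs X Q) \<le> dim ((U \<union> vecs P {a, b}) \<union> set_mset (X e))"
            using fab span_superset[of "(U \<union> vecs P {a, b}) \<union> set_mset (X e)"]
            by (intro dim_mono_finite) auto
          also have "\<dots> \<le> dim (U \<union> vecs P {a, b}) + size (X e)" by (rule dim_Un_mset_le[OF fab])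
          finally have "dim (U \<union> vecs X Q) \<le> dim U + d + size (X e)" using * by linarith
          moreover have "d + 2 \<le> size (X a) + size (X b)" using deg ab by blast
          moreover have "(\<Sum>i\<in>Q. size (X i)) = size (X a) + size (X b) + size (X e)"
            using ab by simp
          ultimately show ?thesis unfolding QZ c3 by linarith
        qed
        show ?thesis
        proof (cases "\<exists>i\<in>I. \<exists>j\<in>I. i \<noteq> j \<and> vanishing_sum U {i, j} c P")
          case True
          then obtain i j where ij: "i \<in> I" "j \<in> I" "i \<noteq> j" "vanishing_sum U {i, j} c P" by blast
          \<comment> \<open>If the cancelling pair contains \<open>k\<close>, the complementary pair
            cancels too, so two rows of \<open>Q\<close> cancel in either case.\<close>
          have "\<exists>a b e. Q = {a, b, e} \<and> a \<noteq> b \<and> e \<noteq> a \<and> e \<noteq> b \<and> vanishing_sum U {a, b} c P"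
          proof (cases "k \<in> {i, j}")
            case True
            have "vanishing_sum U (I - {i, j}) c P"
              using ij by (intro vanishing_sum_Diff fI vsI) auto
            moreover obtain e where e: "{i, j} = {k, e}" "e \<in> Q" using True ij I by auto
            then have "I - {i, j} = Q - {e}" using I k by auto
            moreover have "card (Q - {e}) = 2" using e(2) c3 fQ by simp
            then obtain a b where "Q - {e} = {a, b}" "a \<noteq> b" by (meson card_2_iff)
            moreover from this have "Q = {a, b, e}" "e \<noteq> a" "e \<noteq> b" using e(2) by auto
            ultimately show ?thesis by metis
          next
            case False
            then have ijQ: "i \<in> Q" "j \<in> Q" using ij I by auto
            then have "card (Q - {i, j}) = 1" using ij(3) c3 fQ by (simp add: card_Diff_subset)
            then obtain e where "Q - {i, j} = {e}" using card_1_singletonE by blast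
            then have "Q = {i, j, e}" "e \<noteq> i" "e \<noteq> j" using ijQ by auto
            then show ?thesis using ij(3,4) by metis
          qed
          then show ?thesis using pair by blast
        next
          case False
          then have "dim (U \<union> vecs P I) \<le> dim U + d + 2 \<or> 2 * dim (U \<union> vecs P I) \<le> 2 * dim U + 3 * d"
            by (intro dim_four_rows_le[OF fU I4 szI prI vsI]) auto
          then have "dim (U \<union> vecs X Q) + 2 \<le> dim U + (\<Sum>i\<in>Q. size (X i))"
          proof
            assume "dim (U \<union> vecs P I) \<le> dim U + d + 2"
            then show ?thesis using XI sums tot d unfolding QZ by linarith
          next
            assume "2 * dim (U \<union> vecs P I) \<le> 2 * dim U + 3 * d"
            then show ?thesis using XI sums tot unfolding QZ by linarith
          qed
          then show ?thesis unfolding QZ c3 by simp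
        qed
      qed
    qed
  qed
  ultimately show ?thesis by linarith
qed

section \<open>Degrees of products along a line\<close>

lemma line_poly_cong:
  "(\<And>v. v \<in># M \<Longrightarrow> y v = y' v) \<Longrightarrow> line_poly y z M = line_poly y' z M"
  by (induction M) auto

lemma degree_line_poly_le: "degree (line_poly y z M) \<le> size M"
proof (induction M)
  case (add v M)
  have "degree [:y v, z v:] \<le> 1" by simp
  then show ?case using add degree_mult_le[of "[:y v, z v:]" "line_poly y z M"] by simp
qed simp

lemma degree_line_poly_const: "(\<And>v. v \<in># M \<Longrightarrow> z v = 0) \<Longrightarrow> degree (line_poly y z M) = 0"
proof (induction M)
  case (add v M)
  then have "degree [:y v, z v:] = 0" "degree (line_poly y z M) = 0" by simp_all
  then show ?case using degree_mult_le[of "[:y v, z v:]" "line_poly y z M"] by simp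
qed simp

lemma coeff_line_poly_size: "(\<And>v. v \<in># M \<Longrightarrow> z v = 1) \<Longrightarrow> coeff (line_poly y z M) (size M) = 1"
proof (induction M)
  case (add v M)
  then have "coeff (line_poly y z M) (size M) = 1" "z v = 1" by simp_all
  moreover have "coeff (line_poly y z M) (Suc (size M)) = 0"
    using degree_line_poly_le[of y z M] by (intro coeff_eq_0) simp
  ultimately show ?case by simp
qed simp

text \<open>
  The other rows have small degree along a direction \<open>\<alpha>\<close> that is invisible to their designated
  factors and to \<open>x\<close>, but on which the remaining designated factors of row \<open>i\<close> are \<open>1\<close>.  If \<open>x\<close>
  were not in the span of \<open>G\<close>, then translating by a point of \<open>G\<close> would change the row \<open>i\<close> by a
  polynomial of larger degree.
\<close>

lemma free_row_in_span:
  assumes fU: "finite U" and fQ: "finite Q" and fK: "finite K" and KQ: "K \<inter> Q = {}"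
    and vs: "vanishing_sum U (K \<union> Q) c P" and i: "i \<in> Q"
    and P: "\<And>j. j \<in> Q \<Longrightarrow> P j = F j + X j"
    and free: "dim (U \<union> vecs X (Q - {i})) + size (X i) \<le> dim (U \<union> vecs X Q)"
    and two: "2 \<le> size (X i)"
    and Fsz: "\<And>j. j \<in> Q \<Longrightarrow> j \<noteq> i \<Longrightarrow> size (F j) + 2 \<le> size (X i)"
    and G: "U \<subseteq> span G" "vecs P K \<subseteq> span G" "set_mset (F i) \<subseteq> span G"
    and Fi: "set_mset (F i) \<inter> span U = {}" and ci: "c i \<noteq> 0"
  shows "set_mset (X i) \<subseteq> span G"
proof (rule ccontr)
  assume "\<not> ?thesis"
  then obtain x where x: "x \<in># X i" "x \<notin> span G" by blast
  then obtain M where M: "X i = add_mset x M" using multi_member_split by metis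
  obtain \<psi> where \<psi>: "point G \<psi>" "\<psi> x = 1" by (rule separating_point[OF x(2)])
  have \<psi>U: "point U \<psi>" using point_mono[OF \<psi>(1) G(1)] .
  let ?S = "U \<union> vecs X (Q - {i})"
  have fS: "finite ?S" using fU fQ by (simp add: finite_vecs)
  have SX: "?S \<union> set_mset (X i) = U \<union> vecs X Q" using i by (auto simp: vecs_def)
  have le: "dim (?S \<union> set_mset (X i)) \<le> dim ?S + card (set_mset (X i))"
    using dim_Un_le_card[OF fS] by simp
  then have card_eq: "card (set_mset (X i)) = size (X i)"
    using free card_set_mset_le_size[of "X i"] unfolding SX by linarith
  then have ind: "dim (?S \<union> set_mset (X i)) = dim ?S + card (set_mset (X i))"
    using free le unfolding SX by linarith
  have xM: "x \<notin># M"
  proof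
    assume "x \<in># M"
    then have "card (set_mset (X i)) = card (set_mset M)" using M by (simp add: insert_absorb)
    then show False using card_eq card_set_mset_le_size[of M] M by simp
  qed
  obtain \<alpha> where \<alpha>: "point ?S \<alpha>" "\<And>b. b \<in> set_mset (X i) \<Longrightarrow> \<alpha> b = (if b = x then 0 else 1)"
    using relative_point[OF fS _ ind, of "\<lambda>b. if b = x then 0 else 1"] by auto
  have \<alpha>U: "point U \<alpha>" using \<alpha>(1) by (auto simp: point_def)
  obtain y where y: "point U y" "\<And>v. v \<in> set_mset (F i) \<Longrightarrow> y v \<noteq> 0"
    using avoiding_point[OF _ Fi] by auto
  define y' where "y' = (\<lambda>v. y v + 1 * \<psi> v)"
  have y': "point U y'" unfolding y'_def by (rule point_line[OF y(1) \<psi>U])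
  define D where "D j = line_poly y' \<alpha> (P j) - line_poly y \<alpha> (P j)" for j
  \<comment> \<open>The identity is subtracted along two parallel lines, through \<open>y\<close>
    and through its translate \<open>y'\<close>. The rows in \<open>K\<close> cancel, since their
    factors lie in \<open>span G\<close>, where \<open>\<psi>\<close> vanishes.\<close>
  have sumD: "(\<Sum>j\<in>Q. smult (c j) (D j)) = 0"
  proof (rule poly_eq_0_of_cofinite[of "{}"])
    fix t
    have pts: "point U (\<lambda>v. y v + t * \<alpha> v)" "point U (\<lambda>v. y' v + t * \<alpha> v)"
      using point_line y(1) y' \<alpha>U by blast+
    have cancel: "b' = b" if "a + b = 0" "a' + b' = 0" "a' = a" for a a' b b' :: 'a
      using that by (metis add_left_imp_eq)
    have sums: "(\<Sum>j\<in>K. c j * val z (P j)) + (\<Sum>j\<in>Q. c j * val z (P j)) = 0" if "point U z" for z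
      using vs that KQ fK fQ by (simp add: vanishing_sum_def sum.union_disjoint)
    have "(\<Sum>j\<in>K. c j * val (\<lambda>v. y' v + t * \<alpha> v) (P j)) = (\<Sum>j\<in>K. c j * val (\<lambda>v. y v + t * \<alpha> v) (P j))"
    proof (intro sum.cong refl arg_cong2[where f="(*)"] val_cong)
      fix j v assume "j \<in> K" "v \<in># P j"
      then have "v \<in> span G" using G(2) by (auto simp: vecs_def)
      then have "\<psi> v = 0" by (rule point_span[OF \<psi>(1)])
      then show "y' v + t * \<alpha> v = y v + t * \<alpha> v" by (simp add: y'_def)
    qed
    then have "(\<Sum>j\<in>Q. c j * val (\<lambda>v. y' v + t * \<alpha> v) (P j)) = (\<Sum>j\<in>Q. c j * val (\<lambda>v. y v + t * \<alpha> v) (P j))"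
      by (rule cancel[OF sums[OF pts(1)] sums[OF pts(2)]])
    then show "poly (\<Sum>j\<in>Q. smult (c j) (D j)) t = 0"
      by (simp add: D_def poly_sum poly_line_poly right_diff_distrib sum_subtractf)
  qed simp
  have degD: "degree (smult (c j) (D j)) \<le> size (X i) - 2" if j: "j \<in> Q - {i}" for j
  proof -
    have "degree (line_poly z \<alpha> (P j)) \<le> size (F j)" for z
    proof -
      have "\<alpha> v = 0" if "v \<in># X j" for v
        using \<alpha>(1) that j by (auto simp: point_def vecs_def)
      then have "degree (line_poly z \<alpha> (X j)) = 0" by (rule degree_line_poly_const)
      then show ?thesis
        using degree_line_poly_le[of z \<alpha> "F j"] P[of j] j
          degree_mult_le[of "line_poly z \<alpha> (F j)" "line_poly z \<alpha> (X j)"]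
        by (simp add: line_poly_union)
    qed
    then have "degree (D j) \<le> size (F j)" unfolding D_def by (intro degree_diff_le)
    then show ?thesis using degree_smult_le[of "c j" "D j"] Fsz[of j] j by simp
  qed
  define f where "f = line_poly y \<alpha> (F i)"
  define L where "L = line_poly y' \<alpha> (X i) - line_poly y \<alpha> (X i)"
  have "line_poly y' \<alpha> (F i) = f"
    unfolding f_def
  proof (rule line_poly_cong)
    fix v assume "v \<in># F i"
    then have "\<psi> v = 0" using G(3) point_span[OF \<psi>(1), of v] by blast
    then show "y' v = y v" by (simp add: y'_def)
  qed
  then have Di: "D i = f * L"
    using P[OF i] by (simp add: D_def L_def line_poly_union f_def right_diff_distrib)
  have "poly f 0 \<noteq> 0" using y(2) by (auto simp: f_def poly_line_poly val_eq_0_iff)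
  then have f0: "f \<noteq> 0" by auto
  have ones: "\<alpha> v = 1" if "v \<in># M" for v using \<alpha>(2)[of v] M xM that by auto
  have "\<alpha> x = 0" using \<alpha>(2)[of x] M by simp
  \<comment> \<open>Along \<open>\<alpha>\<close> the form \<open>x\<close> is constant and the
    other factors of \<open>X i\<close> are monic linear in \<open>t\<close>, so the top
    coefficients are \<open>y' x\<close> and \<open>y x\<close>, which differ by
    \<open>\<psi> x = 1\<close>. Thus \<open>D i\<close> has degree at least
    \<open>size (X i) - 1\<close>, one more than all other rows allow.\<close>
  then have "coeff L (size M) = y' x - y x"
    using coeff_line_poly_size[of M \<alpha> y', OF ones] coeff_line_poly_size[of M \<alpha> y, OF ones]
    by (simp add: L_def M)
  then have cL: "coeff L (size M) \<noteq> 0" using \<psi>(2) by (simp add: y'_def)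
  then have "L \<noteq> 0" "size M \<le> degree L" by (auto intro: le_degree)
  then have "size M \<le> degree (smult (c i) (D i))"
    using f0 ci by (simp add: Di degree_mult_eq)
  moreover have "smult (c i) (D i) = - (\<Sum>j\<in>Q - {i}. smult (c j) (D j))"
    using sumD fQ i by (simp add: sum.remove eq_neg_iff_add_eq_0)
  moreover have "degree (\<Sum>j\<in>Q - {i}. smult (c j) (D j)) \<le> size (X i) - 2"
    using degD fQ by (intro degree_sum_le) auto
  ultimately have "size M \<le> size (X i) - 2" by simp
  then show False using two M by simp
qed

lemma val_proportional:
  "(\<And>v. v \<in># M \<Longrightarrow> y v = z v * a) \<Longrightarrow> val y M = val z M * a ^ size M"
  by (induction M) (auto simp: algebra_simps)

text \<open>By submodularity, a row that adds \<open>n\<close> dimensions to all other rows also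
  adds at least \<open>n\<close> to any subfamily of them.\<close>

lemma dim_designated_sets_ge:
  assumes fU: "finite U" and fQ: "finite Q" and A: "A \<subseteq> Q"
    and free: "\<And>i. i \<in> A \<Longrightarrow> dim (U \<union> vecs X (Q - {i})) + n \<le> dim (U \<union> vecs X Q)"
  shows "dim U + n * card A \<le> dim (U \<union> vecs X A)"
proof -
  have "finite A" using A fQ finite_subset by blast
  then show ?thesis using A free
  proof (induction A rule: finite_induct)
    case (insert i A)
    have "dim ((U \<union> vecs X A) \<union> vecs X (Q - {i}) \<union> set_mset (X i)) + dim (U \<union> vecs X A) \<le>
        dim ((U \<union> vecs X A) \<union> vecs X (Q - {i})) + dim ((U \<union> vecs X A) \<union> set_mset (X i))"
      using insert fU fQ by (intro dim_Un_submodular) (auto simp: finite_vecs)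
    moreover have "(U \<union> vecs X A) \<union> vecs X (Q - {i}) \<union> set_mset (X i) = U \<union> vecs X Q"
      using insert by (auto simp: vecs_def)
    moreover have "(U \<union> vecs X A) \<union> vecs X (Q - {i}) = U \<union> vecs X (Q - {i})"
      using insert by (auto simp: vecs_def)
    moreover have "(U \<union> vecs X A) \<union> set_mset (X i) = U \<union> vecs X (insert i A)" by auto
    moreover have "dim U + n * card A \<le> dim (U \<union> vecs X A)"
      using insert by blast
    moreover have "dim (U \<union> vecs X (Q - {i})) + n \<le> dim (U \<union> vecs X Q)" using insert by blast
    ultimately show ?case using insert(1,2) by simp
  qed simp
qed

text \<open>The forms \<open>v - \<eta> v *s h\<close> cut out the points at which every form of
  \<open>H\<close> is the multiple \<open>\<eta> v\<close> of \<open>h\<close>. This lowers the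
  dimension of \<open>H\<close> by at least one, and since \<open>\<eta>\<close> itself is such a
  point, forms that are nonzero at \<open>\<eta>\<close> do not vanish on the new section.\<close>

lemma collapse:
  assumes fH: "finite H" and UH: "U \<subseteq> H" and h: "h \<in> H" and \<eta>: "point U \<eta>" "\<eta> h = 1"
  obtains V where "finite V" "Suc (dim V) \<le> dim H" "H \<subseteq> span (insert h V)" "point V \<eta>"
    "\<And>y. point V y \<Longrightarrow> point U y"
    "\<And>y v. point V y \<Longrightarrow> v \<in> span H \<Longrightarrow> y v = \<eta> v * y h"
proof -
  define V where "V = (\<lambda>v. v - \<eta> v *s h) ` H"
  have fV: "finite V" using fH by (simp add: V_def)
  have pV: "point V \<eta>"
    using \<eta> by (auto simp: V_def point_def point_diff[OF \<eta>(1)] point_scale[OF \<eta>(1)])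
  have hV: "h \<notin> span V" using point_span[OF pV, of h] \<eta>(2) by auto
  have VH: "insert h V \<subseteq> span H"
    using h by (auto simp: V_def intro: span_base span_diff span_scale)
  have "Suc (dim V) = dim (insert h V)" using dim_insert_finite[OF fV, of h] hV by simp
  also have "\<dots> \<le> dim H" using fH VH by (rule dim_mono_finite)
  finally have dV: "Suc (dim V) \<le> dim H" .
  have HV: "H \<subseteq> span (insert h V)"
  proof
    fix v assume "v \<in> H"
    then have "v - \<eta> v *s h \<in> span (insert h V)" by (intro span_base) (auto simp: V_def)
    moreover have "\<eta> v *s h \<in> span (insert h V)" by (intro span_scale span_base) simp
    ultimately have "(v - \<eta> v *s h) + \<eta> v *s h \<in> span (insert h V)" by (rule span_add)
    then show "v \<in> span (insert h V)" by simp
  qed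
  have collapsed: "y v = \<eta> v * y h" if y: "point V y" and v: "v \<in> span H" for y v
  proof -
    have "point V (\<lambda>v. y v + (- y h) * \<eta> v)" by (rule point_line[OF y pV])
    moreover have "y u + (- y h) * \<eta> u = 0" if "u \<in> H" for u
    proof -
      have "y (u - \<eta> u *s h) = 0" using y that by (auto simp: V_def point_def)
      then show ?thesis by (simp add: point_diff[OF y] point_scale[OF y] mult.commute)
    qed
    ultimately have "point H (\<lambda>v. y v + (- y h) * \<eta> v)" by (simp add: point_def)
    from point_span[OF this v] show ?thesis by (simp add: mult.commute)
  qed
  have "point U y" if y: "point V y" for y
  proof -
    have "y u = 0" if "u \<in> U" for u
      using collapsed[OF y span_base, of u] that UH \<eta>(1) by (auto simp: point_def)
    then show ?thesis using y by (simp add: point_def)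
  qed
  then show ?thesis using that fV dV HV pV collapsed by blast
qed

text \<open>
  If the bound fails, then by induction each factor \<open>l\<close> of a row in \<open>K\<close> is proportional to the
  factors \<open>g i\<close> of at least as many rows in \<open>Q\<close> as there are rows in \<open>K\<close> containing \<open>l\<close>; when
  there is only one such row \<open>i\<close>, its designated factors are independent of the others, and
  hence lie in the span \<open>G\<close> of the rows in \<open>K\<close>.  So there are few such \<open>l\<close>, which makes \<open>G\<close> small
  compared to the number of rows of \<open>Q\<close> meeting \<open>G\<close>.  Collapsing \<open>G\<close> to a single form turns these
  rows into a vanishing sum of products of three forms, whose dimension is too large.
\<close>

theorem dim_designated_quartic_rows_le:
  assumes "finite U" "finite K" "finite Q" "K \<inter> Q = {}" "\<And>i. i \<in> K \<union> Q \<Longrightarrow> size (P i) = 4"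
    and "\<And>i. i \<in> Q \<Longrightarrow> P i = add_mset (g i) (X i)" "\<And>i. i \<in> Q \<Longrightarrow> g i \<notin> span U"
    and "\<And>i. i \<in> Q \<Longrightarrow> c i \<noteq> 0" "vanishing_sum U (K \<union> Q) c P"
  shows "dim (U \<union> vecs X Q) \<le> dim U + 2 * card Q + card K"
  using assms
proof (induction "card K + card Q" arbitrary: U K Q rule: less_induct)
  case less
  note IH = less.hyps
  note fU = less.prems(1) and fK = less.prems(2) and fQ = less.prems(3) and KQ = less.prems(4)
    and sz = less.prems(5) and P = less.prems(6) and g = less.prems(7) and cnz = less.prems(8)
    and vs = less.prems(9)
  have szX: "size (X i) = 3" if "i \<in> Q" for i using sz[of i] P[OF that] that by simp
  show ?case
  proof (rule ccontr)
    assume neg: "\<not> ?case"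
    \<comment> \<open>The induction hypothesis on a smaller section, where all rows outside
      \<open>K' \<union> Q'\<close> vanish. Rows of \<open>Q'\<close> may vanish too, as long as
      this is not due to \<open>g i\<close>.\<close>
    have drop: "dim (V \<union> vecs X Q') \<le> dim V + 2 * card Q' + card K'"
      if V: "finite V" "U \<subseteq> span V" and sub: "K' \<subseteq> K" "Q' \<subseteq> Q" "card K' + card Q' < card K + card Q"
        and gV: "\<And>i. i \<in> Q' \<Longrightarrow> g i \<notin> span V"
        and dead: "\<And>i. i \<in> K \<union> Q - (K' \<union> Q') \<Longrightarrow> c i = 0 \<or> set_mset (P i) \<inter> span V \<noteq> {}"
      for V K' Q'
    proof -
      have "vanishing_sum V (K' \<union> Q') c P"
        using V(2) fK fQ sub dead by (intro vanishing_sum_section[OF vs]) auto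
      moreover have "finite K'" "finite Q'" using fK fQ sub finite_subset by blast+
      ultimately show ?thesis
        using IH[OF sub(3), of V] V sub KQ sz P gV cnz by blast
    qed
    have pr: "proper_rows U (K \<union> Q) c P"
    proof -
      have "c k \<noteq> 0 \<and> set_mset (P k) \<inter> span U = {}" if k: "k \<in> K" for k
      proof (rule ccontr)
        assume *: "\<not> ?thesis"
        have "card (K - {k}) < card K" using fK k by (rule card_Diff1_less)
        moreover have "dim (U \<union> vecs X Q) \<le> dim U + 2 * card Q + card (K - {k})"
          using fU span_superset[of U] g * calculation by (intro drop) auto
        ultimately show False using neg by linarith
      qed
      moreover have "set_mset (P i) \<inter> span U = {}" if i: "i \<in> Q" for i
      proof (rule ccontr)
        assume *: "set_mset (P i) \<inter> span U \<noteq> {}"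
        then have "set_mset (X i) \<inter> span U \<noteq> {}" using P[OF i] g[OF i] by auto
        then have "dim (U \<union> vecs X Q) + card {i} \<le> dim (U \<union> vecs X (Q - {i})) + (\<Sum>i\<in>{i}. size (X i))"
          using i by (intro dim_Un_designated_le fU fQ) auto
        moreover have cQ: "card Q = Suc (card (Q - {i}))" using fQ i by (rule card.remove)
        moreover have "dim (U \<union> vecs X (Q - {i})) \<le> dim U + 2 * card (Q - {i}) + card K"
          using fU span_superset[of U] g * cQ by (intro drop) auto
        ultimately show False using neg szX[OF i] by simp
      qed
      ultimately show ?thesis using cnz by (auto simp: proper_rows_def)
    qed
    have XP: "vecs X Q \<subseteq> vecs P Q"
    proof -
      have "set_mset (X i) \<subseteq> set_mset (P i)" if "i \<in> Q" for i using P[OF that] by auto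
      then show ?thesis by (auto simp: vecs_def)
    qed
    have Kne: "K \<noteq> {}"
    proof
      assume K: "K = {}"
      then have "2 * dim (U \<union> vecs P Q) \<le> 2 * dim U + rank_bound 4 (card Q)"
        using fU fQ sz pr vs by (intro dim_vanishing_sum_le) auto
      moreover have "rank_bound 4 (card Q) \<le> card Q * 4" by (rule rank_bound_le) simp
      moreover have "dim (U \<union> vecs X Q) \<le> dim (U \<union> vecs P Q)"
        using XP fU fQ span_superset[of "U \<union> vecs P Q"]
        by (intro dim_mono_finite) (auto simp: finite_vecs)
      ultimately show False using neg by linarith
    qed
    define J where "J l = {i \<in> Q. g i \<in> span (insert l U)}" for l
    have J: "J l \<subseteq> Q" "finite (J l)" for l using fQ by (auto simp: J_def)
    \<comment> \<open>On \<open>l = 0\<close> the rows \<open>T\<close> and \<open>J l\<close> are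
      dropped; restoring them costs 1 for \<open>l\<close> and 3 for each row of \<open>J l\<close>.
      The bound contains 2 for each of these and 1 for each row of \<open>T\<close>, so its failure
      forces \<open>card T \<le> card (J l)\<close>. When \<open>card (J l) = 1\<close> there is no
      slack, and the three designated factors must be independent of the rest.\<close>
    have factor: "1 \<le> card (J l) \<and> (card (J l) = 1 \<longrightarrow>
        (\<forall>i\<in>J l. dim (U \<union> vecs X (Q - {i})) + 3 \<le> dim (U \<union> vecs X Q)))"
      if l: "l \<in> vecs P K" for l
    proof -
      define T where "T = {k \<in> K. set_mset (P k) \<inter> span (insert l U) \<noteq> {}}"
      have T: "T \<subseteq> K" "finite T" using fK by (auto simp: T_def)
      have "T \<noteq> {}" using l span_base[of l "insert l U"] by (auto simp: T_def vecs_def)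
      then have T1: "1 \<le> card T" using T(2) by (simp add: Suc_leI card_gt_0_iff)
      have cK: "card (K - T) + card T = card K"
        using T fK by (simp add: card_Diff_subset card_mono)
      have cQ: "card (Q - J l) + card (J l) = card Q"
        using J fQ by (simp add: card_Diff_subset card_mono)
      have "U \<subseteq> span (insert l U)" using span_superset[of "insert l U"] by blast
      then have "dim (insert l U \<union> vecs X (Q - J l)) \<le>
          dim (insert l U) + 2 * card (Q - J l) + card (K - T)"
        using fU cK cQ T1 P by (intro drop) (auto simp: J_def T_def)
      moreover have "dim (insert l U) \<le> Suc (dim U)" using dim_insert_finite[OF fU, of l] by auto
      moreover have "dim (U \<union> vecs X (Q - J l)) \<le> dim (insert l U \<union> vecs X (Q - J l))"
        using fU fQ span_superset[of "insert l U \<union> vecs X (Q - J l)"]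
        by (intro dim_mono_finite) (auto simp: finite_vecs)
      moreover have "dim (U \<union> vecs X Q) \<le> dim (U \<union> vecs X (Q - J l)) + card (J l) * 3"
      proof -
        have "U \<union> vecs X Q = (U \<union> vecs X (Q - J l)) \<union> vecs X (J l)"
          using J by (auto simp: vecs_def)
        moreover have "dim ((U \<union> vecs X (Q - J l)) \<union> vecs X (J l)) \<le>
            dim (U \<union> vecs X (Q - J l)) + card (J l) * 3"
          using fU fQ J szX by (intro dim_Un_vecs_le) (auto simp: finite_vecs)
        ultimately show ?thesis by simp
      qed
      ultimately have *: "card T \<le> card (J l)"
          "dim (U \<union> vecs X (Q - J l)) \<le> 1 + dim U + 2 * card (Q - J l) + card (K - T)"
        using neg cK cQ by linarith+
      have "dim (U \<union> vecs X (Q - {i})) + 3 \<le> dim (U \<union> vecs X Q)" if "card (J l) = 1" "i \<in> J l" for i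
      proof -
        have "J l = {i}" using that by (metis card_1_singletonE singletonD)
        then have "dim (U \<union> vecs X (Q - {i})) \<le> 1 + dim U + 2 * card (Q - J l) + card (K - T)"
          using *(2) by simp
        then show ?thesis using neg T1 cQ cK that(1) by linarith
      qed
      then show ?thesis using * T1 by auto
    qed
    define G where "G = U \<union> vecs P K"
    have fG: "finite G" using fU fK by (simp add: G_def finite_vecs)
    have lG: "span (insert l U) \<subseteq> span G" if "l \<in> vecs P K" for l
      using that by (intro span_mono) (auto simp: G_def)
    have inG: "set_mset (X i) \<subseteq> span G" if l: "l \<in> vecs P K" "card (J l) = 1" "i \<in> J l" for l i
    proof -
      have iQ: "i \<in> Q" using l(3) J by blast
      have Gsub: "U \<subseteq> span G" "vecs P K \<subseteq> span G" using span_superset[of G] by (auto simp: G_def)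
      have free: "dim (U \<union> vecs X (Q - {i})) + size (X i) \<le> dim (U \<union> vecs X Q)"
        using factor[OF l(1)] l szX[OF iQ] by auto
      have gG: "set_mset {#g i#} \<subseteq> span G" using l lG by (auto simp: J_def)
      show ?thesis
        by (rule free_row_in_span[where F = "\<lambda>j. {#g j#}" and X = X,
              OF fU fQ fK KQ vs iQ _ free _ _ Gsub gG _ cnz[OF iQ]])
          (use szX iQ g[OF iQ] P in simp_all)
    qed
    obtain B where B: "B \<subseteq> vecs P K" "card B + dim U = dim G" "vecs P K \<subseteq> span (U \<union> B)"
      using relative_basis[OF fU finite_vecs[OF fK, of P]] unfolding G_def by blast
    have fB: "finite B" using B(1) fK finite_subset finite_vecs by blast
    have "G \<subseteq> span (U \<union> B)" using B(3) span_superset[of "U \<union> B"] by (auto simp: G_def)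
    then have "dim G \<le> dim (U \<union> B)" using fU fB by (intro dim_mono_finite) auto
    moreover have "dim (U \<union> B) \<le> dim U + card B" using dim_Un_le_card fU fB by blast
    ultimately have ind: "dim (U \<union> B) = dim U + card B" using B(2) by simp
    have disj: "J b \<inter> J b' = {}" if b: "b \<in> B" "b' \<in> B" "b \<noteq> b'" for b b'
    proof (rule ccontr)
      assume "J b \<inter> J b' \<noteq> {}"
      then obtain i where i: "i \<in> Q" "g i \<in> span (insert b U)" "g i \<in> span (insert b' U)"
        by (auto simp: J_def)
      have "b' \<in> span (insert (g i) U)" using i g[OF i(1)] in_span_insert by blast
      also have "span (insert (g i) U) = span (insert b U)"
        using i g[OF i(1)] by (intro span_insert_exchange)
      also have "\<dots> \<subseteq> span (U \<union> (B - {b'}))" using b by (intro span_mono) auto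
      finally show False using relative_independent_not_in_span[OF fU fB ind b(2)] by simp
    qed
    define B1 where "B1 = {b \<in> B. card (J b) = 1}"
    define Q12 where "Q12 = {i \<in> Q. set_mset (P i) \<inter> span G \<noteq> {}}"
    have Q12: "Q12 \<subseteq> Q" "finite Q12" using fQ by (auto simp: Q12_def)
    have UJ: "card (\<Union>b\<in>A. J b) = (\<Sum>b\<in>A. card (J b))" if "A \<subseteq> B" for A
      using that disj J fB finite_subset by (intro card_UN_disjoint) blast+
    have "2 * card B \<le> card B1 + card Q12"
    proof -
      have "(\<Union>b\<in>B. J b) \<subseteq> Q12"
      proof
        fix i assume "i \<in> (\<Union>b\<in>B. J b)"
        then obtain b where b: "b \<in> B" "i \<in> Q" "g i \<in> span (insert b U)" by (auto simp: J_def)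
        then have "g i \<in> span G" using lG B(1) by blast
        moreover have "g i \<in># P i" using P[OF b(2)] by simp
        ultimately show "i \<in> Q12" using b(2) by (auto simp: Q12_def)
      qed
      then have "card (\<Union>b\<in>B. J b) \<le> card Q12" by (rule card_mono[OF Q12(2)])
      then have "(\<Sum>b\<in>B. card (J b)) \<le> card Q12" using UJ[of B] by simp
      moreover have "(\<Sum>b\<in>B. 2) \<le> (\<Sum>b\<in>B. card (J b) + (if b \<in> B1 then 1 else 0))"
      proof (rule sum_mono)
        fix b assume b: "b \<in> B"
        then have "1 \<le> card (J b)" using factor B(1) by blast
        then show "2 \<le> card (J b) + (if b \<in> B1 then 1 else 0)" using b by (auto simp: B1_def)
      qed
      moreover have "(\<Sum>b\<in>B. if b \<in> B1 then 1 else 0) = card B1"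
        using fB by (simp add: B1_def flip: sum.inter_filter)
      ultimately show ?thesis by (simp add: sum.distrib)
    qed
    \<comment> \<open>Each element of \<open>B1\<close> belongs to one row of \<open>Q\<close>,
      whose three designated factors are independent of the others and lie in \<open>span G\<close>;
      modulo \<open>U\<close> this span has dimension \<open>card B\<close>.\<close>
    moreover have "3 * card B1 \<le> card B"
    proof -
      define Q1 where "Q1 = (\<Union>b\<in>B1. J b)"
      have "card Q1 = (\<Sum>b\<in>B1. card (J b))" unfolding Q1_def by (rule UJ) (simp add: B1_def)
      then have cQ1: "card Q1 = card B1" by (simp add: B1_def)
      have Q1: "Q1 \<subseteq> Q" using J by (auto simp: Q1_def)
      have b1: "b \<in> vecs P K" "card (J b) = 1" if "b \<in> B1" for b
        using that B(1) by (auto simp: B1_def)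
      have "dim U + 3 * card Q1 \<le> dim (U \<union> vecs X Q1)"
      proof (rule dim_designated_sets_ge[OF fU fQ Q1])
        fix i assume "i \<in> Q1"
        then obtain b where "b \<in> B1" "i \<in> J b" by (auto simp: Q1_def)
        then show "dim (U \<union> vecs X (Q - {i})) + 3 \<le> dim (U \<union> vecs X Q)"
          using factor[of b] b1[of b] by blast
      qed
      also have "\<dots> \<le> dim G"
      proof (rule dim_mono_finite[OF fG])
        have "set_mset (X i) \<subseteq> span G" if "b \<in> B1" "i \<in> J b" for b i
          using inG[OF b1(1)[OF that(1)] b1(2)[OF that(1)] that(2)] .
        then have "vecs X Q1 \<subseteq> span G" by (auto simp: Q1_def vecs_def)
        moreover have "U \<subseteq> span G" using span_superset[of G] by (auto simp: G_def)
        ultimately show "U \<union> vecs X Q1 \<subseteq> span G" by simp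
      qed
      finally show ?thesis using cQ1 B(2) by simp
    qed
    moreover have "card B \<le> card K * 4"
      using dim_Un_vecs_le[OF fU fK, of P 4] sz B(2) unfolding G_def by auto
    moreover have "card Q12 + 2 * card K + 1 \<le> 2 * card B"
    proof -
      define Q3 where "Q3 = Q - Q12"
      have fQ3: "finite Q3" and Q3: "Q3 \<subseteq> Q" using fQ by (auto simp: Q3_def)
      have cQ: "card Q = card Q12 + card Q3"
        using Q12 by (simp add: Q3_def card_Diff_subset card_mono fQ)
      define H where "H = G \<union> vecs P Q3"
      have fH: "finite H" using fG fQ3 by (simp add: H_def finite_vecs)
      have dH: "dim H \<le> dim G + 2 * card Q3"
      proof -
        have "vanishing_sum G Q3 c P"
        proof (rule vanishing_sum_section[OF vs])
          show "U \<subseteq> span G" using span_superset[of G] by (auto simp: G_def)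
          fix j assume j: "j \<in> K \<union> Q - Q3"
          show "c j = 0 \<or> set_mset (P j) \<inter> span G \<noteq> {}"
          proof (cases "j \<in> K")
            case True
            then have "P j \<noteq> {#}" using sz[of j] by auto
            then obtain v where v: "v \<in># P j" by blast
            then have "v \<in> span G" using True by (intro span_base) (auto simp: G_def vecs_def)
            then show ?thesis using v by blast
          next
            case False
            then show ?thesis using j by (auto simp: Q3_def Q12_def)
          qed
        qed (use fK fQ Q3 in auto)
        moreover have "proper_rows G Q3 c P"
          using cnz by (auto simp: proper_rows_def Q3_def Q12_def)
        ultimately have "2 * dim (G \<union> vecs P Q3) \<le> 2 * dim G + rank_bound 4 (card Q3)"
          using fG fQ3 sz Q3 by (intro dim_vanishing_sum_le) auto
        moreover have "rank_bound 4 (card Q3) \<le> card Q3 * 4" by (rule rank_bound_le) simp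
        ultimately show ?thesis unfolding H_def by linarith
      qed
      obtain k0 where k0: "k0 \<in> K" using Kne by blast
      then have "P k0 \<noteq> {#}" using sz[of k0] by auto
      then obtain h where h: "h \<in># P k0" by blast
      have "vecs P (K \<union> Q) \<inter> span U = {}" using pr by (auto simp: proper_rows_def vecs_def)
      then obtain \<theta> where \<theta>: "point U \<theta>" "\<And>v. v \<in> vecs P (K \<union> Q) \<Longrightarrow> \<theta> v \<noteq> 0"
        using avoiding_point[of "vecs P (K \<union> Q)" U] fK fQ by (auto simp: finite_vecs)
      \<comment> \<open>A point where no factor of any row vanishes, normalised at \<open>h\<close>,
        keeps all rows nonzero after the collapse.\<close>
      define \<eta> where "\<eta> = (\<lambda>v. inverse (\<theta> h) * \<theta> v)"
      have hv: "h \<in> vecs P K" using h k0 by (auto simp: vecs_def)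
      then have \<theta>h: "\<theta> h \<noteq> 0" using \<theta>(2)[of h] by (simp add: vecs_Un)
      have \<eta>: "point U \<eta>" "\<eta> h = 1" "\<And>v. v \<in> vecs P (K \<union> Q) \<Longrightarrow> \<eta> v \<noteq> 0"
        using \<theta>(2) \<theta>h point_scaled[OF \<theta>(1)] by (auto simp: \<eta>_def)
      have UH: "U \<subseteq> H" and hH: "h \<in> H" using hv by (auto simp: H_def G_def)
      obtain V where V: "finite V" "Suc (dim V) \<le> dim H" "H \<subseteq> span (insert h V)" "point V \<eta>"
          "\<And>y. point V y \<Longrightarrow> point U y"
          "\<And>y v. point V y \<Longrightarrow> v \<in> span H \<Longrightarrow> y v = \<eta> v * y h"
        using collapse[OF fH UH hH \<eta>(1,2)] by blast
      have hV: "h \<notin> span V" using point_span[OF V(4), of h] \<eta>(2) by auto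
      have "\<exists>w M. P i = add_mset w M \<and> w \<in> span G" if i: "i \<in> Q12" for i
      proof -
        obtain v where "v \<in># P i" "v \<in> span G" using i by (auto simp: Q12_def)
        then show ?thesis using multi_member_split[of v "P i"] by blast
      qed
      then obtain w M where wM: "\<And>i. i \<in> Q12 \<Longrightarrow> P i = add_mset (w i) (M i)"
          "\<And>i. i \<in> Q12 \<Longrightarrow> w i \<in> span G"
        by metis
      \<comment> \<open>On \<open>V\<close> the rows in \<open>K\<close> and \<open>Q3\<close> merge
        into \<open>C\<close> times the fourth power of \<open>h\<close>, and each row of
        \<open>Q12\<close> contains a multiple of \<open>h\<close>. Dividing by \<open>h\<close>
        leaves cubic rows; the freed index \<open>k0\<close> carries the merged one.\<close>
      define C where "C = (\<Sum>j\<in>K \<union> Q3. c j * val \<eta> (P j))"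
      define c' where "c' i = (if i = k0 then C else c i * \<eta> (w i))" for i
      define M' where "M' i = (if i = k0 then {#h, h, h#} else M i)" for i
      have k0Q: "k0 \<notin> Q12" using k0 KQ Q12 by auto
      have GH: "span G \<subseteq> span H" by (intro span_mono) (auto simp: H_def)
      have "vanishing_sum V (insert k0 Q12) c' M'"
      proof (rule vanishing_sum_cancel[OF hV])
        fix y assume y: "point V y"
        have "(\<Sum>j\<in>K \<union> Q. c j * val y (P j)) = 0"
          using vs V(5)[OF y] by (simp add: vanishing_sum_def)
        moreover have "K \<union> Q = (K \<union> Q3) \<union> Q12" "(K \<union> Q3) \<inter> Q12 = {}"
          using Q12(1) KQ by (auto simp: Q3_def)
        ultimately have "(\<Sum>j\<in>K \<union> Q3. c j * val y (P j)) + (\<Sum>j\<in>Q12. c j * val y (P j)) = 0"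
          using fK fQ3 Q12(2) by (simp add: sum.union_disjoint)
        moreover have "(\<Sum>j\<in>K \<union> Q3. c j * val y (P j)) = C * y h ^ 4"
        proof -
          have "val y (P j) = val \<eta> (P j) * y h ^ 4" if j: "j \<in> K \<union> Q3" for j
          proof -
            have "val y (P j) = val \<eta> (P j) * y h ^ size (P j)"
            proof (rule val_proportional)
              fix v assume "v \<in># P j"
              then have "v \<in> span H" using j by (intro span_base) (auto simp: H_def G_def vecs_def)
              then show "y v = \<eta> v * y h" by (rule V(6)[OF y])
            qed
            then show ?thesis using sz[of j] j Q3 by auto
          qed
          then show ?thesis by (simp add: C_def sum_distrib_right mult.assoc)
        qed
        moreover have "(\<Sum>j\<in>Q12. c j * val y (P j)) = y h * (\<Sum>j\<in>Q12. c' j * val y (M' j))"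
          unfolding sum_distrib_left
        proof (rule sum.cong)
          fix j assume j: "j \<in> Q12"
          then have "y (w j) = \<eta> (w j) * y h" using wM(2) GH V(6)[OF y] by blast
          moreover have "j \<noteq> k0" using j k0Q by blast
          ultimately show "c j * val y (P j) = y h * (c' j * val y (M' j))"
            using wM(1)[OF j] by (simp add: c'_def M'_def)
        qed simp
        moreover have "c' k0 * val y (M' k0) = C * y h ^ 3"
          by (simp add: c'_def M'_def power3_eq_cube mult.assoc)
        ultimately show "y h * (\<Sum>i\<in>insert k0 Q12. c' i * val y (M' i)) = 0"
          using k0Q Q12(2) by (simp add: distrib_left eval_nat_numeral mult.left_commute)
      qed
      have szM: "size (M' i) = 3" if "i \<in> insert k0 Q12" for i
        using that wM(1)[of i] sz[of i] Q12(1) by (auto simp: M'_def)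
      have MV: "set_mset (M' i) \<inter> span V = {}" if "i \<in> insert k0 Q12" for i
      proof -
        have "\<eta> v \<noteq> 0" if "v \<in># M' i" for v
        proof (cases "i = k0")
          case True
          then show ?thesis using that \<eta>(2) by (auto simp: M'_def split: if_splits)
        next
          case False
          then have i: "i \<in> Q12" using \<open>i \<in> insert k0 Q12\<close> by simp
          then have "v \<in># P i" using that False wM(1)[OF i] by (simp add: M'_def)
          then have "v \<in> vecs P (K \<union> Q)" using i Q12(1) by (auto simp: vecs_def)
          then show ?thesis by (rule \<eta>(3))
        qed
        then show ?thesis using point_span[OF V(4)] by blast
      qed
      have cM: "c' i \<noteq> 0" if i: "i \<in> Q12" for i
      proof -
        have "w i \<in># P i" using wM(1)[OF i] by simp
        then have "w i \<in> vecs P (K \<union> Q)" using i Q12(1) by (auto simp: vecs_def)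
        moreover have "i \<noteq> k0" "i \<in> Q" using i k0Q Q12(1) by blast+
        ultimately show ?thesis using cnz[of i] \<eta>(3)[of "w i"] by (simp add: c'_def)
      qed
      have MQ: "vecs M' Q12 = vecs M Q12" unfolding vecs_def
        by (rule SUP_cong) (use k0Q in \<open>auto simp: M'_def\<close>)
      have fVM: "finite (V \<union> vecs M Q12)" using V(1) Q12(2) by (simp add: finite_vecs)
      \<comment> \<open>If \<open>C = 0\<close>, the merged row is dropped and \<open>h\<close> is
        added by hand, at a cost of 2 within the allowed 3.\<close>
      have "2 * dim (insert h (V \<union> vecs M Q12)) \<le> 2 * dim V + 3 * card Q12 + 3"
      proof (cases "C = 0")
        case True
        have "vanishing_sum V Q12 c' M'"
          using Q12(2) span_superset[of V] True
          by (intro vanishing_sum_section[OF \<open>vanishing_sum V (insert k0 Q12) c' M'\<close>]) (auto simp: c'_def)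
        moreover have "proper_rows V Q12 c' M'" using MV cM by (simp add: proper_rows_def)
        ultimately have "2 * dim (V \<union> vecs M' Q12) \<le> 2 * dim V + rank_bound 3 (card Q12)"
          using V(1) Q12(2) szM by (intro dim_vanishing_sum_le) auto
        moreover have "rank_bound 3 (card Q12) \<le> card Q12 * 3" by (rule rank_bound_le) simp
        moreover have "dim (insert h (V \<union> vecs M Q12)) \<le> Suc (dim (V \<union> vecs M Q12))"
          using dim_insert_finite[OF fVM, of h] by auto
        ultimately show ?thesis unfolding MQ by linarith
      next
        case False
        then have "proper_rows V (insert k0 Q12) c' M'"
          using MV cM by (auto simp: proper_rows_def c'_def)
        then have "2 * dim (V \<union> vecs M' (insert k0 Q12)) \<le> 2 * dim V + rank_bound 3 (card (insert k0 Q12))"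
          using V(1) Q12(2) szM \<open>vanishing_sum V (insert k0 Q12) c' M'\<close>
          by (intro dim_vanishing_sum_le) auto
        moreover have "rank_bound 3 (card (insert k0 Q12)) \<le> card (insert k0 Q12) * 3"
          by (rule rank_bound_le) simp
        moreover have "V \<union> vecs M' (insert k0 Q12) = insert h (V \<union> vecs M Q12)"
          using MQ by (auto simp: M'_def)
        ultimately show ?thesis using k0Q Q12(2) by simp
      qed
      moreover have "dim (U \<union> vecs X Q) \<le> dim (insert h (V \<union> vecs M Q12))"
      proof (rule dim_mono_finite)
        let ?E = "span (insert h (V \<union> vecs M Q12))"
        have "span (insert h V) \<subseteq> ?E" by (intro span_mono) auto
        then have HE: "H \<subseteq> ?E" using V(3) by blast
        then have sHE: "span H \<subseteq> ?E" by (intro span_minimal) auto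
        have "set_mset (P i) \<subseteq> ?E" if i: "i \<in> Q" for i
        proof (cases "i \<in> Q12")
          case True
          have "set_mset (M i) \<subseteq> ?E" using True span_superset[of "insert h (V \<union> vecs M Q12)"]
            by (auto simp: vecs_def)
          moreover have "w i \<in> ?E" using wM(2)[OF True] GH sHE by blast
          ultimately show ?thesis using wM(1)[OF True] by simp
        next
          case False
          then have "set_mset (P i) \<subseteq> H" using i by (auto simp: H_def Q3_def vecs_def)
          then show ?thesis using HE by blast
        qed
        then have "vecs P Q \<subseteq> ?E" by (auto simp: vecs_def)
        then show "U \<union> vecs X Q \<subseteq> ?E" using XP HE UH by blast
      qed (use fVM in auto)
      ultimately show ?thesis using neg V(2) dH cQ B(2) by linarith
    qed
    \<comment> \<open>The four inequalities give \<open>5 * card B \<le> 3 * card Q12 \<le> 6 * card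
      B - 6 * card K - 3\<close>, hence \<open>6 * card K + 3 \<le> card B\<close>, against
      \<open>card B \<le> 4 * card K\<close>.\<close>
    ultimately show False by linarith
  qed
qed

section \<open>From the dimension bounds to the abstract property C\<close>

lemma dim_empty_set [simp]: "dim {} = 0"
  using dim_eq_card_independent[OF independent_empty] by simp

lemma rank_bound_le_odd: "rank_bound d s \<le> 2 * (m * d + 1)" if "s \<le> 2 * m + 1"
proof -
  have "rank_bound d s \<le> 2 * m * d + 2"
  proof (cases "even s")
    case True
    then have "s \<le> 2 * m" using that by presburger
    then have "s * d \<le> 2 * m * d" by (rule mult_le_mono1)
    moreover have "rank_bound d s = s * d" using True by (simp add: rank_bound_def)
    ultimately show ?thesis by linarith
  next
    case False
    then have "s - 1 \<le> 2 * m" using that by simp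
    then have "(s - 1) * d \<le> 2 * m * d" by (rule mult_le_mono1)
    moreover have "rank_bound d s = (s - 1) * d + 2" using False by (simp add: rank_bound_def)
    ultimately show ?thesis by linarith
  qed
  then show ?thesis by simp
qed

text \<open>
  The abstract form of property \<open>C\<close>: the rows in \<open>K\<close> are the products \<open>\<ell>\<^sub>i\<close>, and the row \<open>i \<in> Q\<close>
  consists of the factors \<open>F i\<close> of \<open>f\<^sub>i\<close> and the variables \<open>X i\<close> of the monomial.
\<close>

theorem no_independent_designated_rows:
  assumes fK: "finite K" and fQ: "finite Q" and KQ: "K \<inter> Q = {}"
    and sz: "\<And>i. i \<in> K \<union> Q \<Longrightarrow> size (P i) = d"
    and P: "\<And>i. i \<in> Q \<Longrightarrow> P i = F i + X i"
    and F: "\<And>i. i \<in> Q \<Longrightarrow> 0 \<notin># F i" and cnz: "\<And>i. i \<in> Q \<Longrightarrow> c i \<noteq> 0"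
    and vs: "vanishing_sum {} (K \<union> Q) c P"
    and ind: "dim (vecs X Q) = (\<Sum>i\<in>Q. size (X i))"
    and cK: "card K = m" and cQ: "card Q = Suc m" and m: "1 \<le> m" and d: "2 \<le> d"
    and deg: "\<And>i j. i \<in> Q \<Longrightarrow> j \<in> Q \<Longrightarrow> i \<noteq> j \<Longrightarrow> d + 2 \<le> size (X i) + size (X j)"
    and md: "m \<le> 2 \<or> d \<le> 4"
  shows False
proof -
  define n where "n i = size (X i)" for i
  have szF: "size (F i) + n i = d" if "i \<in> Q" for i
    using sz[of i] P[OF that] that by (simp add: n_def)
  have deg': "d + 2 \<le> n i + n j" if "i \<in> Q" "j \<in> Q" "i \<noteq> j" for i j
    using deg[OF that] by (simp add: n_def)
  have indn: "dim (vecs X Q) = (\<Sum>i\<in>Q. n i)" using ind by (simp add: n_def)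
  have fX: "finite (vecs X Q)" by (rule finite_vecs[OF fQ])
  have F0: "set_mset (F i) \<inter> span {} = {}" if "i \<in> Q" for i using F[OF that] by auto
  have X0: "set_mset (X i) \<inter> span {} = {}" if i: "i \<in> Q" for i
  proof -
    have "dim ({} \<union> vecs X (Q - {i})) \<le> dim {} + (\<Sum>j\<in>Q - {i}. size (X j))"
      using fQ by (intro dim_Un_vecs_le_sum) auto
    moreover have "dim (vecs X (Q - {i}) \<union> set_mset (X i)) + card {i} \<le>
        dim (vecs X (Q - {i})) + (\<Sum>j\<in>{i}. size (X j))" if "set_mset (X i) \<inter> span {} \<noteq> {}"
    proof -
      have "set_mset (X i) \<inter> span (vecs X (Q - {i})) \<noteq> {}"
        using that span_mono[of "{}" "vecs X (Q - {i})"] by blast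
      then show ?thesis
        using dim_Un_designated_le[of "vecs X (Q - {i})" "{i}" "{i}" X] fQ by (simp add: finite_vecs)
    qed
    moreover have "vecs X (Q - {i}) \<union> set_mset (X i) = vecs X Q" using i by (auto simp: vecs_def)
    moreover have "(\<Sum>j\<in>Q. size (X j)) = size (X i) + (\<Sum>j\<in>Q - {i}. size (X j))"
      using fQ i by (rule sum.remove)
    ultimately show ?thesis using ind by fastforce
  qed
  have upper: "(\<Sum>i\<in>Q. n i) \<le> m * d + 1"
  proof -
    define K' where "K' = {k \<in> K. c k \<noteq> 0 \<and> set_mset (P k) \<inter> span {} = {}}"
    have K': "K' \<subseteq> K" "finite K'" using fK by (auto simp: K'_def)
    have "proper_rows {} (K' \<union> Q) c P"
      using cnz P F0 X0 unfolding proper_rows_def K'_def by auto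
    moreover have "vanishing_sum {} (K' \<union> Q) c P"
      using fK fQ K' by (intro vanishing_sum_section[OF vs]) (auto simp: K'_def)
    ultimately have "2 * dim ({} \<union> vecs P (K' \<union> Q)) \<le> 2 * dim {} + rank_bound d (card (K' \<union> Q))"
      using K' fQ sz d by (intro dim_vanishing_sum_le) auto
    moreover have "card (K' \<union> Q) \<le> 2 * m + 1"
      using card_Un_le[of K' Q] card_mono[OF fK K'(1)] cK cQ by simp
    then have "rank_bound d (card (K' \<union> Q)) \<le> 2 * (m * d + 1)" by (rule rank_bound_le_odd)
    moreover have "dim (vecs X Q) \<le> dim (vecs P (K' \<union> Q))"
    proof (rule dim_mono_finite)
      have "set_mset (X i) \<subseteq> set_mset (P i)" if "i \<in> Q" for i using P[OF that] by auto
      then have "vecs X Q \<subseteq> vecs P (K' \<union> Q)" by (auto simp: vecs_def)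
      then show "vecs X Q \<subseteq> span (vecs P (K' \<union> Q))" using span_superset by blast
    qed (use K' fQ in \<open>simp add: finite_vecs\<close>)
    ultimately show ?thesis using indn by simp
  qed
  \<comment> \<open>Since \<open>n j \<le> d\<close>, the pairwise condition gives
    \<open>2 \<le> n i\<close>, and \<open>n i = 2\<close> makes all other \<open>n j\<close> at
    least \<open>d\<close>: the total \<open>m d + 2\<close> exceeds \<open>upper\<close> by
    one.\<close>
  have three: "3 \<le> n i" if i: "i \<in> Q" for i
  proof (rule ccontr)
    assume "\<not> 3 \<le> n i"
    have cQi: "card (Q - {i}) = m" using fQ i cQ by simp
    then have "Q - {i} \<noteq> {}" using m by (metis card.empty not_one_le_zero)
    then obtain j where j: "j \<in> Q" "j \<noteq> i" by blast
    have "n i = 2" using deg'[OF i j(1)] j(2) szF[OF j(1)] \<open>\<not> 3 \<le> n i\<close> by simp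
    have "(\<Sum>j\<in>Q - {i}. d) \<le> (\<Sum>j\<in>Q - {i}. n j)"
      using deg'[OF i] \<open>n i = 2\<close> by (intro sum_mono) fastforce
    then have "m * d + 2 \<le> (\<Sum>i\<in>Q. n i)"
      using sum.remove[OF fQ i, of n] \<open>n i = 2\<close> cQi by simp
    then show False using upper by simp
  qed
  have lower: "(\<Sum>i\<in>Q. 3) \<le> (\<Sum>i\<in>Q. n i)" by (rule sum_mono) (rule three)
  obtain q where q: "q \<in> Q" using cQ by (metis card.empty ex_in_conv nat.distinct(1))
  have "3 \<le> d" using three[OF q] szF[OF q] by simp
  consider "m = 1" | "m = 2" | "d = 3" | "d = 4" using m md \<open>3 \<le> d\<close> by linarith
  then show False
  proof cases
    case 1
    then obtain i j where "Q = {i, j}" "i \<noteq> j" using cQ card_2_iff by (metis One_nat_def Suc_1)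
    then show False using deg'[of i j] upper 1 by simp
  next
    case 3
    then show False using lower upper cQ by simp
  next
    case 4
    \<comment> \<open>Three variables of each row are designated; the fourth factor may come from
      \<open>F i\<close> or be a variable itself. The quartic bound is then
      \<open>2 (m + 1) + m = 3 m + 2\<close>, one less than the number of designated
      variables.\<close>
    have "\<exists>x Y. Y \<subseteq># X i \<and> size Y = 3 \<and> P i = add_mset x Y \<and> x \<notin> span {}" if i: "i \<in> Q" for i
    proof -
      have "\<exists>Y. Y \<subseteq># X i \<and> size Y = 3"
      proof -
        obtain xs where xs: "mset xs = X i" using ex_mset by blast
        have "mset (take 3 xs) \<subseteq># mset xs" by (metis append_take_drop_id mset_append mset_subset_eq_add_left)
        moreover have "length xs = n i" unfolding n_def xs[symmetric] by simp
        ultimately show ?thesis using xs three[OF i] by (intro exI[of _ "mset (take 3 xs)"]) simp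
      qed
      then obtain Y where Y: "Y \<subseteq># X i" "size Y = 3" by blast
      have YP: "Y \<subseteq># P i" using Y(1) P[OF i] by (simp add: subset_mset.le_iff_add) (metis union_assoc union_commute)
      have "size (P i - Y) = 1" using YP Y(2) sz[of i] i 4 by (simp add: size_Diff_submset)
      then obtain x where x: "P i - Y = {#x#}" using size_1_singleton_mset by blast
      then have Px: "P i = add_mset x Y" using YP by (metis add_mset_add_single subset_mset.diff_add union_commute)
      then have "x \<in># F i \<or> x \<in># X i" using P[OF i] by (metis union_iff union_single_eq_member add_mset_add_single)
      then have "x \<notin> span {}" using F0[OF i] X0[OF i] by blast
      then show ?thesis using Y Px by blast
    qed
    then obtain g Y where gY: "\<And>i. i \<in> Q \<Longrightarrow> Y i \<subseteq># X i" "\<And>i. i \<in> Q \<Longrightarrow> size (Y i) = 3"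
        "\<And>i. i \<in> Q \<Longrightarrow> P i = add_mset (g i) (Y i)" "\<And>i. i \<in> Q \<Longrightarrow> g i \<notin> span {}"
      by metis
    have "dim ({} \<union> vecs Y Q) \<le> dim {} + 2 * card Q + card K"
      using fK fQ KQ sz gY cnz vs 4 by (intro dim_designated_quartic_rows_le) auto
    moreover have "dim (vecs X Q) \<le> dim (vecs Y Q) + (\<Sum>i\<in>Q. size (X i - Y i))"
    proof -
      have "set_mset (X i) \<subseteq> set_mset (Y i) \<union> set_mset (X i - Y i)" if "i \<in> Q" for i
      proof -
        have "X i = Y i + (X i - Y i)" using gY(1)[OF that] by simp
        then show ?thesis by (metis set_mset_union subset_refl)
      qed
      then have sub: "vecs X Q \<subseteq> vecs Y Q \<union> vecs (\<lambda>i. X i - Y i) Q" by (auto simp: vecs_def)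
      have "dim (vecs X Q) \<le> dim (vecs Y Q \<union> vecs (\<lambda>i. X i - Y i) Q)"
        using fQ sub span_superset by (intro dim_mono_finite) (auto simp: finite_vecs)
      also have "\<dots> \<le> dim (vecs Y Q) + (\<Sum>i\<in>Q. size (X i - Y i))"
        using fQ by (intro dim_Un_vecs_le_sum) (auto simp: finite_vecs)
      finally show ?thesis .
    qed
    moreover have "(\<Sum>i\<in>Q. size (X i - Y i)) + (\<Sum>i\<in>Q. 3) = (\<Sum>i\<in>Q. n i)"
      unfolding sum.distrib[symmetric]
      using gY(1,2) three by (intro sum.cong) (auto simp: n_def size_Diff_submset)
    ultimately show False using indn cQ cK by simp
  next
    case 2
    have c3: "card Q = 3" using cQ 2 by simp
    have main: False if k: "K = {k, k'}" "k \<noteq> k'" and V: "finite V" "dim V \<le> 1"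
        and FV: "\<And>i. i \<in> Q \<Longrightarrow> set_mset (F i) \<inter> span V = {}"
        and dead: "c k = 0 \<or> set_mset (P k) \<inter> span V \<noteq> {}" for k k' V
    proof -
      have k'Q: "k' \<notin> Q" using KQ k by blast
      have "vanishing_sum V (insert k' Q) c P"
        using fK fQ k dead by (intro vanishing_sum_section[OF vs]) auto
      then have "dim (V \<union> vecs X Q) + 2 \<le> dim V + (\<Sum>i\<in>Q. size (X i))"
        using V FV c3 k'Q d sz P cnz deg k(1)
        by (intro dim_three_designated_rows_le[where k = k' and d = d]) auto
      moreover have "dim (vecs X Q) \<le> dim (V \<union> vecs X Q)"
        using V fX span_superset[of "V \<union> vecs X Q"] by (intro dim_mono_finite) auto
      ultimately show False using ind V by simp
    qed
    \<comment> \<open>On the hyperplane of a factor \<open>l\<close> of row \<open>k\<close>, the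
      bound with its loss of two is impossible for independent variables. Its hypothesis on
      \<open>F\<close> must fail, so \<open>l\<close> is proportional to a factor of some
      \<open>F i\<close>.\<close>
    have "vecs P K \<subseteq> span (vecs F Q)"
    proof
      fix l assume "l \<in> vecs P K"
      then obtain k where k: "k \<in> K" "l \<in># P k" by (auto simp: vecs_def)
      have "card (K - {k}) = 1" using k(1) cK 2 fK by simp
      then obtain k' where "K - {k} = {k'}" using card_1_singletonE by blast
      then have kk: "K = {k, k'}" "k \<noteq> k'" using k(1) by auto
      have "dim {l} \<le> 1" using dim_insert_finite[of "{}" l] by simp
      moreover have "set_mset (P k) \<inter> span {l} \<noteq> {}" using k(2) span_base[of l "{l}"] by blast
      ultimately obtain i where i: "i \<in> Q" "set_mset (F i) \<inter> span {l} \<noteq> {}"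
        using main[OF kk, of "{l}"] by auto
      then obtain w where w: "w \<in># F i" "w \<in> span {l}" by blast
      then have "l \<in> span {w}" using in_span_insert[of w l "{}"] F0[OF i(1)] by blast
      moreover have "span {w} \<subseteq> span (vecs F Q)" using w(1) i(1) by (intro span_mono) (auto simp: vecs_def)
      ultimately show "l \<in> span (vecs F Q)" by blast
    qed
    note KF = this
    have "set_mset (X i) \<subseteq> span (vecs F Q)" if i: "i \<in> Q" for i
    proof -
      have free: "dim ({} \<union> vecs X (Q - {i})) + size (X i) \<le> dim ({} \<union> vecs X Q)"
        using dim_Un_vecs_le_sum[of "{}" "Q - {i}" X] fQ ind sum.remove[OF fQ i, of "\<lambda>i. size (X i)"]
        by simp
      have two: "2 \<le> size (X i)" using three[OF i] by (simp add: n_def)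
      have FG: "set_mset (F i) \<subseteq> span (vecs F Q)"
        using i span_superset[of "vecs F Q"] by (auto simp: vecs_def)
      have Fsz: "size (F j) + 2 \<le> size (X i)" if "j \<in> Q" "j \<noteq> i" for j
        using szF[OF that(1)] deg'[OF i that(1)] that(2) by (simp add: n_def)
      show ?thesis
        by (rule free_row_in_span[OF finite.emptyI fQ fK KQ vs i P free two Fsz _ KF FG F0[OF i] cnz[OF i]]) simp_all
    qed
    then have "vecs X Q \<subseteq> span (vecs F Q)" by (auto simp: vecs_def)
    then have "dim (vecs X Q) \<le> dim (vecs F Q)" using fQ by (intro dim_mono_finite finite_vecs)
    also have "\<dots> \<le> (\<Sum>i\<in>Q. size (F i))" using dim_Un_vecs_le_sum[of "{}" Q F] fQ by simp
    \<comment> \<open>The pairwise condition makes the left side at least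
      \<open>3 (d + 2) / 2\<close>, whereas both sides add up to \<open>3 d\<close>.\<close>
    finally have le: "(\<Sum>i\<in>Q. n i) \<le> (\<Sum>i\<in>Q. size (F i))" using indn by simp
    obtain i1 i2 i3 where Q: "Q = {i1, i2, i3}" "i1 \<noteq> i2" "i1 \<noteq> i3" "i2 \<noteq> i3"
      using c3 by (auto simp: card_3_iff)
    have "n i1 + n i2 + n i3 \<le> size (F i1) + size (F i2) + size (F i3)" using le Q by simp
    moreover have "d + 2 \<le> n i1 + n i2" "d + 2 \<le> n i1 + n i3" "d + 2 \<le> n i2 + n i3"
      using deg' Q by auto
    moreover have "size (F i1) + n i1 = d" "size (F i2) + n i2 = d" "size (F i3) + n i3 = d"
      using szF Q by auto
    ultimately show False by linarith
  qed
qed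

end

section \<open>Instantiation over an algebraically closed field\<close>

lemma infinite_UNIV_alg_closed_field: "infinite (UNIV :: 'a::alg_closed_field set)"
proof
  assume fin: "finite (UNIV :: 'a set)"
  \<comment> \<open>A nonconstant polynomial with value 1 everywhere, in the manner of Euclid's
    argument for primes.\<close>
  define p where "p = (\<Prod>a\<in>(UNIV :: 'a set). [:- a, 1:]) + 1"
  have deg: "degree (\<Prod>a\<in>(UNIV :: 'a set). [:- a, 1:]) = card (UNIV :: 'a set)"
    by (subst degree_prod_eq_sum_degree) auto
  have "card (UNIV :: 'a set) > 0" using fin by (simp add: card_gt_0_iff)
  then have "degree p > 0" using deg by (simp add: p_def degree_add_eq_left)
  then obtain x where "poly p x = 0" using alg_closed_imp_poly_has_root by blast
  moreover have "poly p x = 1" using fin by (auto simp: p_def poly_prod)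
  ultimately show False by simp
qed

text \<open>Two instances occur: for property C a linear form is its vector of coefficients, and for
  a plane it is a function on the vectors of the plane.\<close>

interpretation forms: infinite_vector_space "\<lambda>(c::'a::alg_closed_field) (v::'i \<Rightarrow> 'a) p. c * v p"
  by unfold_locales (rule infinite_UNIV_alg_closed_field)

section \<open>Evaluation of polynomials\<close>

definition monom_eval :: "(nat \<Rightarrow> 'a::comm_ring_1) \<Rightarrow> (nat \<Rightarrow>\<^sub>0 nat) \<Rightarrow> 'a" where
  "monom_eval p m = (\<Prod>v\<in>Poly_Mapping.keys m. p v ^ Poly_Mapping.lookup m v)"

definition mpoly_eval :: "(nat \<Rightarrow> 'a::comm_ring_1) \<Rightarrow> 'a mpoly \<Rightarrow> 'a" where
  "mpoly_eval p f = (\<Sum>m\<in>Poly_Mapping.keys f. Poly_Mapping.lookup f m * monom_eval p m)"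

lemma monom_eval_superset:
  assumes "finite S" "Poly_Mapping.keys m \<subseteq> S"
  shows "monom_eval p m = (\<Prod>v\<in>S. p v ^ Poly_Mapping.lookup m v)"
  unfolding monom_eval_def using assms
  by (intro prod.mono_neutral_left) (auto simp: in_keys_iff)

lemma monom_eval_add: "monom_eval p (m + m') = monom_eval p m * monom_eval p m'"
proof -
  let ?S = "Poly_Mapping.keys m \<union> Poly_Mapping.keys m'"
  have "Poly_Mapping.keys (m + m') \<subseteq> ?S" by (rule keys_add)
  then have "monom_eval p (m + m') = (\<Prod>v\<in>?S. p v ^ Poly_Mapping.lookup (m + m') v)"
    by (intro monom_eval_superset) auto
  also have "\<dots> = (\<Prod>v\<in>?S. p v ^ Poly_Mapping.lookup m v) * (\<Prod>v\<in>?S. p v ^ Poly_Mapping.lookup m' v)"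
    by (simp add: lookup_add power_add prod.distrib)
  also have "\<dots> = monom_eval p m * monom_eval p m'"
    by (simp add: monom_eval_superset[of ?S])
  finally show ?thesis .
qed

lemma mpoly_eval_superset:
  assumes "finite S" "Poly_Mapping.keys f \<subseteq> S"
  shows "mpoly_eval p f = (\<Sum>m\<in>S. Poly_Mapping.lookup f m * monom_eval p m)"
  unfolding mpoly_eval_def using assms
  by (intro sum.mono_neutral_left) (auto simp: in_keys_iff)

lemma mpoly_eval_0 [simp]: "mpoly_eval p 0 = 0"
  by (simp add: mpoly_eval_def)

lemma mpoly_eval_add: "mpoly_eval p (f + g) = mpoly_eval p f + mpoly_eval p g"
proof -
  let ?S = "Poly_Mapping.keys f \<union> Poly_Mapping.keys g"
  have "Poly_Mapping.keys (f + g) \<subseteq> ?S" by (rule keys_add)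
  then have "mpoly_eval p (f + g) = (\<Sum>m\<in>?S. Poly_Mapping.lookup (f + g) m * monom_eval p m)"
    by (intro mpoly_eval_superset) auto
  also have "\<dots> = mpoly_eval p f + mpoly_eval p g"
    by (simp add: lookup_add distrib_right sum.distrib mpoly_eval_superset[of ?S])
  finally show ?thesis .
qed

lemma mpoly_eval_sum: "mpoly_eval p (sum f I) = (\<Sum>i\<in>I. mpoly_eval p (f i))"
  by (induction I rule: infinite_finite_induct) (auto simp: mpoly_eval_add)

lemma mpoly_eval_single: "mpoly_eval p (Poly_Mapping.single m a) = a * monom_eval p m"
  by (simp add: mpoly_eval_def)

lemma mpoly_eval_1 [simp]: "mpoly_eval p 1 = 1"
proof -
  have "mpoly_eval p (Poly_Mapping.single 0 1) = 1"
    unfolding mpoly_eval_single by (simp add: monom_eval_def)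
  then show ?thesis by simp
qed

lemma poly_mapping_sum_singles: "f = (\<Sum>m\<in>Poly_Mapping.keys f. Poly_Mapping.single m (Poly_Mapping.lookup f m))"
  by (rule poly_mapping_eqI) (auto simp: lookup_sum lookup_single when_def in_keys_iff)

lemma mpoly_eval_mult: "mpoly_eval p (f * g) = mpoly_eval p f * mpoly_eval p g"
proof -
  have "f * g = (\<Sum>m\<in>Poly_Mapping.keys f. \<Sum>m'\<in>Poly_Mapping.keys g.
      Poly_Mapping.single (m + m') (Poly_Mapping.lookup f m * Poly_Mapping.lookup g m'))"
    by (subst poly_mapping_sum_singles[of f], subst poly_mapping_sum_singles[of g])
      (simp add: sum_product mult_single)
  then have "mpoly_eval p (f * g) = (\<Sum>m\<in>Poly_Mapping.keys f. \<Sum>m'\<in>Poly_Mapping.keys g.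
      Poly_Mapping.lookup f m * Poly_Mapping.lookup g m' * monom_eval p (m + m'))"
    by (simp only: mpoly_eval_sum mpoly_eval_single)
  also have "\<dots> = mpoly_eval p f * mpoly_eval p g"
    by (simp add: mpoly_eval_def monom_eval_add sum_product mult_ac)
  finally show ?thesis .
qed

lemma mpoly_eval_prod: "mpoly_eval p (prod f I) = (\<Prod>i\<in>I. mpoly_eval p (f i))"
  by (induction I rule: infinite_finite_induct) (auto simp: mpoly_eval_mult)

section \<open>The property \<open>C\<close>\<close>

lemma variable_not_unit: "\<not> (Poly_Mapping.single (Poly_Mapping.single v 1) 1 :: 'a::comm_ring_1 mpoly) dvd 1"
proof
  assume "(Poly_Mapping.single (Poly_Mapping.single v 1) 1 :: 'a mpoly) dvd 1"
  then obtain g :: "'a mpoly" where "1 = Poly_Mapping.single (Poly_Mapping.single v 1) 1 * g" by (rule dvdE)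
  then have "mpoly_eval (\<lambda>_. 0) (1 :: 'a mpoly) =
      mpoly_eval (\<lambda>_. 0) (Poly_Mapping.single (Poly_Mapping.single v 1) 1 * g)"
    by (rule arg_cong)
  then show False by (simp add: mpoly_eval_mult mpoly_eval_single monom_eval_def)
qed

lemma lookup_squarefree_monomial:
  assumes "squarefree (monomial m :: 'a::comm_ring_1 mpoly)"
  shows "Poly_Mapping.lookup m v \<le> 1"
proof (rule ccontr)
  assume *: "\<not> ?thesis"
  let ?x = "Poly_Mapping.single (Poly_Mapping.single v 1) 1 :: 'a mpoly"
  have "Poly_Mapping.single v 1 + Poly_Mapping.single v 1 + (m - Poly_Mapping.single v 2) = m"
    using * by (intro poly_mapping_eqI) (auto simp: lookup_add lookup_minus lookup_single when_def)
  then have "(monomial m :: 'a mpoly) = ?x ^ 2 * monomial (m - Poly_Mapping.single v 2)"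
    by (simp add: power2_eq_square mult_single)
  then have "?x ^ 2 dvd (monomial m :: 'a mpoly)" by (rule dvdI)
  then show False using assms variable_not_unit unfolding squarefree_def by blast
qed

lemma keys_coprime_monomials:
  assumes "coprime_mpoly (monomial m :: 'a::comm_ring_1 mpoly) (monomial m')"
  shows "Poly_Mapping.keys m \<inter> Poly_Mapping.keys m' = {}"
proof (rule ccontr)
  assume "\<not> ?thesis"
  then obtain v where v: "v \<in> Poly_Mapping.keys m" "v \<in> Poly_Mapping.keys m'" by blast
  let ?x = "Poly_Mapping.single (Poly_Mapping.single v 1) 1 :: 'a mpoly"
  have "?x dvd monomial k" if "v \<in> Poly_Mapping.keys k" for k
  proof -
    have "Poly_Mapping.single v 1 + (k - Poly_Mapping.single v 1) = k"
      using that by (intro poly_mapping_eqI)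
        (auto simp: lookup_add lookup_minus lookup_single when_def in_keys_iff)
    then have "(monomial k :: 'a mpoly) = ?x * monomial (k - Poly_Mapping.single v 1)"
      by (simp add: mult_single)
    then show ?thesis by (rule dvdI)
  qed
  then show False using assms v variable_not_unit unfolding coprime_mpoly_def by blast
qed

text \<open>The point \<open>y\<close> has the coordinates \<open>y (unit_vec v)\<close>.\<close>

definition unit_vec :: "'i \<Rightarrow> 'i \<Rightarrow> 'a::field" where
  "unit_vec v = (\<lambda>u. if u = v then 1 else 0)"

lemma point_eq_sum:
  assumes y: "forms.point {} (y :: ('i \<Rightarrow> 'a::alg_closed_field) \<Rightarrow> 'a)" and "finite S"
  shows "y (\<lambda>u. if u \<in> S then a u else 0) = (\<Sum>v\<in>S. a v * y (unit_vec v))"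
  using assms(2)
proof (induction S rule: finite_induct)
  case empty
  then show ?case using forms.point_zero[OF y] by (simp add: zero_fun_def)
next
  case (insert v S)
  have "(\<lambda>u. if u \<in> insert v S then a u else 0) =
      (\<lambda>u. a v * unit_vec v u) + (\<lambda>u. if u \<in> S then a u else 0)"
    using insert(2) by (auto simp: unit_vec_def fun_eq_iff)
  then show ?case
    using insert by (simp add: forms.point_add[OF y] forms.point_scale[OF y])
qed

lemma linear_form_coeffs:
  assumes "linear_form n (f :: 'a::alg_closed_field mpoly)"
  obtains l where "f \<noteq> 0 \<Longrightarrow> l \<noteq> 0"
    "\<And>y. forms.point {} y \<Longrightarrow> mpoly_eval (\<lambda>v. y (unit_vec v)) f = y l"
proof -
  obtain a where a: "f = (\<Sum>v<n. Poly_Mapping.single (Poly_Mapping.single v 1) (a v))"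
    using assms by (auto simp: linear_form_def)
  let ?l = "\<lambda>u. if u \<in> {..<n} then a u else 0"
  have "?l \<noteq> 0" if "f \<noteq> 0"
  proof
    assume "?l = 0"
    then have "a v = 0" if "v < n" for v using that by (auto dest: fun_cong[where x = v])
    then show False using a that by simp
  qed
  moreover have "mpoly_eval (\<lambda>v. y (unit_vec v)) f = y ?l" if "forms.point {} y" for y
    unfolding point_eq_sum[OF that finite_lessThan] a
    by (simp add: mpoly_eval_sum mpoly_eval_single monom_eval_def)
  ultimately show ?thesis by (rule that)
qed

text \<open>The scalar stays separate so that \<open>M\<close> has exactly \<open>e\<close>
  elements, also for \<open>e = 0\<close>. Only a nonzero product guarantees nonzero
  factors.\<close>

lemma prod_of_linear_forms_coeffs:
  assumes "prod_of_linear_forms n e (f :: 'a::alg_closed_field mpoly)"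
  obtains c M where "size M = e" "f \<noteq> 0 \<Longrightarrow> c \<noteq> 0 \<and> 0 \<notin># M"
    "\<And>y. forms.point {} y \<Longrightarrow> mpoly_eval (\<lambda>v. y (unit_vec v)) f = c * forms.val y M"
proof -
  obtain c l where cl: "\<forall>j<e. linear_form n (l j)" "f = Poly_Mapping.single 0 c * (\<Prod>j<e. l j)"
    using assms by (auto simp: prod_of_linear_forms_def)
  have "\<exists>k. (l j \<noteq> 0 \<longrightarrow> k \<noteq> 0) \<and>
      (\<forall>y. forms.point {} y \<longrightarrow> mpoly_eval (\<lambda>v. y (unit_vec v)) (l j) = y k)" if "j < e" for j
    using linear_form_coeffs[of n "l j"] cl(1) that by metis
  then obtain k where k: "\<And>j. j < e \<Longrightarrow> l j \<noteq> 0 \<Longrightarrow> k j \<noteq> 0"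
      "\<And>j y. j < e \<Longrightarrow> forms.point {} y \<Longrightarrow> mpoly_eval (\<lambda>v. y (unit_vec v)) (l j) = y (k j)"
    by metis
  let ?M = "image_mset k (mset_set {..<e})"
  have "size ?M = e" by simp
  moreover have "c \<noteq> 0 \<and> 0 \<notin># ?M" if "f \<noteq> 0"
  proof -
    have "l j \<noteq> 0" if "j < e" for j
    proof
      assume "l j = 0"
      then have "(\<Prod>j<e. l j) = 0" using that by (intro prod_zero) auto
      then show False using \<open>f \<noteq> 0\<close> cl(2) by simp
    qed
    moreover have "c \<noteq> 0" using that cl(2) by auto
    ultimately show ?thesis using k(1) by force
  qed
  moreover have "mpoly_eval (\<lambda>v. y (unit_vec v)) f = c * forms.val y ?M" if y: "forms.point {} y" for y
  proof -
    have "mpoly_eval (\<lambda>v. y (unit_vec v)) f = c * (\<Prod>j<e. y (k j))"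
      using k(2)[OF _ y] by (simp add: cl(2) mpoly_eval_mult mpoly_eval_single mpoly_eval_prod monom_eval_def)
    also have "(\<Prod>j<e. y (k j)) = forms.val y ?M"
      by (simp add: forms.val_def prod_unfold_prod_mset image_mset.compositionality comp_def)
    finally show ?thesis .
  qed
  ultimately show ?thesis by (rule that)
qed

text \<open>The coordinate \<open>t\<close> is nonzero on \<open>b t\<close> but vanishes on the
  span of the other vectors.\<close>

lemma independent_of_dual_coordinates:
  fixes b :: "'i \<Rightarrow> 'i \<Rightarrow> 'a::field"
  assumes "\<And>t. t \<in> T \<Longrightarrow> b t t \<noteq> 0" "\<And>s t. s \<in> T \<Longrightarrow> t \<in> T \<Longrightarrow> s \<noteq> t \<Longrightarrow> b t s = 0"
  shows "fun_vs.independent (b ` T)" "inj_on b T"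
proof -
  show "fun_vs.independent (b ` T)"
    unfolding fun_vs.dependent_def
  proof
    assume "\<exists>a\<in>b ` T. a \<in> fun_vs.span (b ` T - {a})"
    then obtain t where t: "t \<in> T" "b t \<in> fun_vs.span (b ` T - {b t})" by blast
    have "fun_vs.subspace {v :: 'i \<Rightarrow> 'a. v t = 0}" by (auto simp: fun_vs.subspace_def)
    moreover have "b ` T - {b t} \<subseteq> {v. v t = 0}" using assms(2)[OF t(1)] by fastforce
    ultimately have "fun_vs.span (b ` T - {b t}) \<subseteq> {v. v t = 0}" by (rule fun_vs.span_minimal[rotated])
    then show False using t assms(1) by auto
  qed
  show "inj_on b T"
    by (rule inj_onI) (metis assms)
qed

theorem property_C_holds:
  assumes d: "d > 1" and m: "m \<ge> 1" and md: "m \<le> 2 \<or> d \<le> 4"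
  shows "property_C TYPE('a::alg_closed_field) d m"
  unfolding property_C_def
proof (intro allI impI)
  fix n and l f :: "nat \<Rightarrow> 'a mpoly" and x
  assume eq: "C_equation n d m l f x"
    and deg: "\<forall>i\<in>{0..m}. \<forall>j\<in>{0..m}. i \<noteq> j \<longrightarrow> monomial_degree (x i) + monomial_degree (x j) \<ge> d + 2"
  show "\<exists>i\<in>{0..m}. f i = 0"
  proof (rule ccontr)
    assume "\<not> ?thesis"
    then have f0: "f i \<noteq> 0" if "i \<in> {0..m}" for i using that by blast
    have sqf: "squarefree (monomial (x i) :: 'a mpoly)" if "i \<in> {0..m}" for i
      using eq that by (simp add: C_equation_def)
    have cop: "Poly_Mapping.keys (x i) \<inter> Poly_Mapping.keys (x j) = {}"
      if "i \<in> {0..m}" "j \<in> {0..m}" "i \<noteq> j" for i j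
      using eq that unfolding C_equation_def by (intro keys_coprime_monomials[where 'a='a]) blast
    have lin_l: "prod_of_linear_forms n d (l i)" if "i \<in> {1..m}" for i
      using eq that unfolding C_equation_def by blast
    have "if monomial_degree (x i) \<le> d then prod_of_linear_forms n (d - monomial_degree (x i)) (f i)
        else f i = 0" if "i \<in> {0..m}" for i
      using eq that unfolding C_equation_def by blast
    then have lin_f: "monomial_degree (x i) \<le> d" "prod_of_linear_forms n (d - monomial_degree (x i)) (f i)"
      if "i \<in> {0..m}" for i
      using f0[OF that] that by (metis (full_types))+
    have sum_eq: "(\<Sum>i=1..m. l i) = (\<Sum>i=0..m. f i * monomial (x i))"
      using eq by (simp add: C_equation_def)
    have lookup1: "Poly_Mapping.lookup (x i) v = 1" if "i \<in> {0..m}" "v \<in> Poly_Mapping.keys (x i)" for i v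
      using lookup_squarefree_monomial[OF sqf[OF that(1)], of v] that(2) by (simp add: in_keys_iff)
    have mdeg: "monomial_degree (x i) = card (Poly_Mapping.keys (x i))" if "i \<in> {0..m}" for i
      using lookup1[OF that] by (simp add: monomial_degree_def)
    have "\<exists>c M. size M = d \<and>
        (\<forall>y. forms.point {} y \<longrightarrow> mpoly_eval (\<lambda>v. y (unit_vec v)) (l i) = c * forms.val y M)"
      if "i \<in> {1..m}" for i
      using prod_of_linear_forms_coeffs[OF lin_l[OF that]] by metis
    then obtain cl Ml where l: "\<And>i. i \<in> {1..m} \<Longrightarrow> size (Ml i) = d"
        "\<And>i y. i \<in> {1..m} \<Longrightarrow> forms.point {} y \<Longrightarrow>
          mpoly_eval (\<lambda>v. y (unit_vec v)) (l i) = cl i * forms.val y (Ml i)"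
      by metis
    have "\<exists>c M. size M = d - monomial_degree (x i) \<and> c \<noteq> 0 \<and> 0 \<notin># M \<and>
        (\<forall>y. forms.point {} y \<longrightarrow> mpoly_eval (\<lambda>v. y (unit_vec v)) (f i) = c * forms.val y M)"
      if "i \<in> {0..m}" for i
      using prod_of_linear_forms_coeffs[OF lin_f(2)[OF that]] f0[OF that] by metis
    then obtain cf Mf where f: "\<And>i. i \<in> {0..m} \<Longrightarrow> size (Mf i) = d - monomial_degree (x i)"
        "\<And>i. i \<in> {0..m} \<Longrightarrow> cf i \<noteq> 0" "\<And>i. i \<in> {0..m} \<Longrightarrow> 0 \<notin># Mf i"
        "\<And>i y. i \<in> {0..m} \<Longrightarrow> forms.point {} y \<Longrightarrow>
          mpoly_eval (\<lambda>v. y (unit_vec v)) (f i) = cf i * forms.val y (Mf i)"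
      by metis
    define Xv :: "nat \<Rightarrow> (nat \<Rightarrow> 'a) multiset"
      where "Xv i = image_mset unit_vec (mset_set (Poly_Mapping.keys (x i)))" for i
    \<comment> \<open>The sum type keeps the two families, both indexed by numbers, disjoint; the
      sign in \<open>c\<close> moves the right side of the equation to the left.\<close>
    define K :: "(nat + nat) set" where "K = Inl ` {1..m}"
    define Q :: "(nat + nat) set" where "Q = Inr ` {0..m}"
    define F :: "nat + nat \<Rightarrow> (nat \<Rightarrow> 'a) multiset" where "F = case_sum (\<lambda>_. {#}) Mf"
    define X :: "nat + nat \<Rightarrow> (nat \<Rightarrow> 'a) multiset" where "X = case_sum (\<lambda>_. {#}) Xv"
    define P :: "nat + nat \<Rightarrow> (nat \<Rightarrow> 'a) multiset" where "P = case_sum Ml (\<lambda>i. Mf i + Xv i)"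
    define c :: "nat + nat \<Rightarrow> 'a" where "c = case_sum cl (\<lambda>i. - cf i)"
    have szX: "size (Xv i) = monomial_degree (x i)" if "i \<in> {0..m}" for i
      using mdeg[OF that] by (simp add: Xv_def)
    have valX: "forms.val y (Xv i) = mpoly_eval (\<lambda>v. y (unit_vec v)) (monomial (x i))"
      if "i \<in> {0..m}" for i y
      using lookup1[OF that]
      by (simp add: mpoly_eval_single monom_eval_def forms.val_def Xv_def prod_unfold_prod_mset
          image_mset.compositionality comp_def cong: image_mset_cong)
    have vs: "forms.vanishing_sum {} (K \<union> Q) c P"
      unfolding forms.vanishing_sum_def
    proof (intro allI impI)
      fix y :: "(nat \<Rightarrow> 'a) \<Rightarrow> 'a" assume y: "forms.point {} y"
      have "(\<Sum>i\<in>K \<union> Q. c i * forms.val y (P i)) =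
          (\<Sum>i\<in>K. c i * forms.val y (P i)) + (\<Sum>i\<in>Q. c i * forms.val y (P i))"
        by (rule sum.union_disjoint) (auto simp: K_def Q_def)
      also have "(\<Sum>i\<in>K. c i * forms.val y (P i)) = (\<Sum>i=1..m. cl i * forms.val y (Ml i))"
        unfolding K_def by (subst sum.reindex) (auto simp: c_def P_def)
      also have "\<dots> = mpoly_eval (\<lambda>v. y (unit_vec v)) (\<Sum>i=1..m. l i)"
        using l(2)[OF _ y] by (simp add: mpoly_eval_sum)
      also have "(\<Sum>i\<in>Q. c i * forms.val y (P i)) =
          (\<Sum>i=0..m. - (cf i * forms.val y (Mf i) * forms.val y (Xv i)))"
        unfolding Q_def by (subst sum.reindex) (auto simp: c_def P_def mult.assoc)
      also have "\<dots> = - mpoly_eval (\<lambda>v. y (unit_vec v)) (\<Sum>i=0..m. f i * monomial (x i))"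
        using f(4)[OF _ y] valX by (simp add: mpoly_eval_sum mpoly_eval_mult sum_negf)
      finally show "(\<Sum>i\<in>K \<union> Q. c i * forms.val y (P i)) = 0"
        unfolding sum_eq by simp
    qed
    have "fun_vs.dim (forms.vecs X Q) = (\<Sum>i\<in>Q. size (X i))"
    proof -
      let ?V = "\<Union>i\<in>{0..m}. Poly_Mapping.keys (x i)"
      have "forms.vecs X Q = unit_vec ` ?V"
        by (auto simp: forms.vecs_def Q_def X_def Xv_def)
      moreover have "fun_vs.independent ((unit_vec :: nat \<Rightarrow> nat \<Rightarrow> 'a) ` ?V)"
        and inj: "inj_on (unit_vec :: nat \<Rightarrow> nat \<Rightarrow> 'a) ?V"
        by (rule independent_of_dual_coordinates; simp add: unit_vec_def)+
      ultimately have "fun_vs.dim (forms.vecs X Q) = card ((unit_vec :: nat \<Rightarrow> nat \<Rightarrow> 'a) ` ?V)"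
        by (simp add: fun_vs.dim_eq_card_independent)
      also have "\<dots> = card ?V" by (rule card_image[OF inj])
      also have "\<dots> = (\<Sum>i\<in>{0..m}. card (Poly_Mapping.keys (x i)))"
        using cop by (intro card_UN_disjoint) auto
      also have "\<dots> = (\<Sum>i\<in>Q. size (X i))"
        unfolding Q_def by (subst sum.reindex) (auto simp: X_def Xv_def)
      finally show ?thesis .
    qed
    moreover have "size (P i) = d" if "i \<in> K \<union> Q" for i
      using that l(1) f(1) szX lin_f(1) by (auto simp: K_def Q_def P_def)
    moreover have "d + 2 \<le> size (X i) + size (X j)" if ij: "i \<in> Q" "j \<in> Q" "i \<noteq> j" for i j
    proof -
      obtain a b where ab: "i = Inr a" "j = Inr b" "a \<in> {0..m}" "b \<in> {0..m}"
        using ij(1,2) by (auto simp: Q_def)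
      then have "d + 2 \<le> monomial_degree (x a) + monomial_degree (x b)" using deg ij(3) by blast
      then show ?thesis using szX[OF ab(3)] szX[OF ab(4)] by (simp add: X_def ab(1,2))
    qed
    moreover have "P i = F i + X i" "0 \<notin># F i" "c i \<noteq> 0" if "i \<in> Q" for i
      using that f(2,3) by (auto simp: P_def F_def X_def Q_def c_def)
    moreover have "finite K" "finite Q" "K \<inter> Q = {}" "card K = m" "card Q = Suc m"
      by (auto simp: K_def Q_def card_image)
    ultimately show False
      using vs m d md by (intro forms.no_independent_designated_rows[of K Q P d F X c m]) auto
  qed
qed

section \<open>Subspaces of the hypersurface\<close>

lemma (in infinite_vector_space) point_sum:
  assumes "point U y"
  shows "y (sum f I) = (\<Sum>i\<in>I. y (f i))"
  by (induction I rule: infinite_finite_induct) (auto simp: point_zero[OF assms] point_add[OF assms])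

lemma sum_fun_apply: "sum f S x = (\<Sum>i\<in>S. f i x)" for f :: "'s \<Rightarrow> 't \<Rightarrow> 'a::comm_monoid_add"
  by (induction S rule: infinite_finite_induct) auto

lemma zero_locus_subset: "zero_locus r d A \<subseteq> coord_space r d"
  by (auto simp: zero_locus_def)

text \<open>Extension by 0 outside \<open>L\<close> makes linear relations between these functions
  the same as relations between the coordinates on \<open>L\<close>.\<close>

definition coord_form :: "('i \<Rightarrow> 'a::field) set \<Rightarrow> 'i \<Rightarrow> ('i \<Rightarrow> 'a) \<Rightarrow> 'a" where
  "coord_form L p = (\<lambda>v. if v \<in> L then v p else 0)"

text \<open>
  Otherwise, a functional that vanishes on \<open>L\<close> but not at this vector would be a linear relation
  between the coordinate forms that \<open>y\<close> does not respect.
\<close>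

lemma coords_of_point_in_subspace:
  fixes L :: "('i \<Rightarrow> 'a::alg_closed_field) set"
  assumes L: "fun_vs.subspace L" and R: "finite R" and supp: "\<And>v p. v \<in> L \<Longrightarrow> p \<notin> R \<Longrightarrow> v p = 0"
    and y: "forms.point {} y"
  shows "(\<lambda>p. if p \<in> R then y (coord_form L p) else 0) \<in> L"
proof (rule ccontr)
  let ?v = "\<lambda>p. if p \<in> R then y (coord_form L p) else 0"
  assume "?v \<notin> L"
  then have "?v \<notin> fun_vs.span L" using L by (simp add: fun_vs.span_eq_iff[THEN iffD2])
  then obtain z where z: "forms.point L z" "z ?v = 1" by (rule forms.separating_point)
  have z0: "forms.point {} z" using z(1) by (simp add: forms.point_def)
  define \<phi> where "\<phi> = (\<Sum>p\<in>R. (\<lambda>w. z (unit_vec p) * coord_form L p w))"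
  have "\<phi> w = 0" for w
  proof (cases "w \<in> L")
    case True
    then have w: "w = (\<lambda>u. if u \<in> R then w u else 0)" using supp by auto
    have "\<phi> w = (\<Sum>p\<in>R. w p * z (unit_vec p))"
      using True by (simp add: \<phi>_def coord_form_def sum_fun_apply mult.commute)
    also have "\<dots> = z (\<lambda>u. if u \<in> R then w u else 0)"
      by (rule point_eq_sum[OF z0 R, symmetric])
    also have "\<dots> = 0" using z(1) True w by (simp add: forms.point_def)
    finally show ?thesis .
  qed (simp add: \<phi>_def coord_form_def sum_fun_apply)
  then have "\<phi> = 0" by (simp add: fun_eq_iff)
  then have "y \<phi> = 0" using forms.point_zero[OF y] by simp
  moreover have "y \<phi> = (\<Sum>p\<in>R. y (coord_form L p) * z (unit_vec p))"
    by (simp add: \<phi>_def forms.point_sum[OF y] forms.point_scale[OF y] mult.commute)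
  moreover have "\<dots> = z ?v" by (rule point_eq_sum[OF z0 R, symmetric])
  ultimately show False using z(2) by simp
qed

text \<open>Let the coordinates \<open>C\<close> give a basis of the span of all coordinate forms. A
  vector of \<open>L\<close> whose coordinates in \<open>C\<close> vanish has all coordinates zero,
  so the projection \<open>\<rho>\<close> to \<open>C\<close> is injective on
  \<open>L\<close>.\<close>

lemma dim_le_dim_coord_forms:
  fixes L :: "('i \<Rightarrow> 'a::alg_closed_field) set"
  assumes L: "fun_vs.subspace L" and R: "finite R" and supp: "\<And>v p. v \<in> L \<Longrightarrow> p \<notin> R \<Longrightarrow> v p = 0"
  shows "fun_vs.dim L \<le> fun_vs.dim (coord_form L ` R)"
proof -
  obtain B where B: "B \<subseteq> coord_form L ` R" "fun_vs.independent B" "coord_form L ` R \<subseteq> fun_vs.span B"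
      "card B = fun_vs.dim (coord_form L ` R)"
    by (rule fun_vs.basis_exists)
  obtain C where C: "C \<subseteq> R" "inj_on (coord_form L) C" "B = coord_form L ` C"
    using subset_image_inj[THEN iffD1, OF B(1)] by blast
  have fC: "finite C" using C(1) R finite_subset by blast
  define \<rho> :: "('i \<Rightarrow> 'a) \<Rightarrow> 'i \<Rightarrow> 'a" where "\<rho> v = (\<lambda>p. if p \<in> C then v p else 0)" for v
  interpret \<rho>: Vector_Spaces.linear "\<lambda>(c::'a) (v::'i \<Rightarrow> 'a) p. c * v p" "\<lambda>(c::'a) (v::'i \<Rightarrow> 'a) p. c * v p" \<rho>
    unfolding Vector_Spaces.linear_iff
    by (auto simp: \<rho>_def fun_eq_iff intro: fun_vs.vector_space_axioms)
  have inj: "inj_on \<rho> L"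
    unfolding \<rho>.inj_on_iff_eq_0[OF L]
  proof (intro ballI impI)
    fix v assume v: "v \<in> L" "\<rho> v = 0"
    have "v p = 0" for p
    proof (cases "p \<in> R")
      case True
      have "fun_vs.subspace {\<phi> :: ('i \<Rightarrow> 'a) \<Rightarrow> 'a. \<phi> v = 0}" by (auto simp: fun_vs.subspace_def)
      moreover have "B \<subseteq> {\<phi>. \<phi> v = 0}"
      proof -
        have "v q = 0" if "q \<in> C" for q using v(2) that by (auto simp: \<rho>_def dest: fun_cong[where x = q])
        then show ?thesis using C(3) by (auto simp: coord_form_def)
      qed
      ultimately have "fun_vs.span B \<subseteq> {\<phi>. \<phi> v = 0}" by (rule fun_vs.span_minimal[rotated])
      then have "coord_form L p v = 0" using B(3) True by blast
      then show ?thesis using v(1) by (simp add: coord_form_def)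
    qed (use supp v(1) in auto)
    then show "v = 0" by (simp add: fun_eq_iff)
  qed
  obtain D where D: "D \<subseteq> L" "fun_vs.independent D" "L \<subseteq> fun_vs.span D" "card D = fun_vs.dim L"
    by (rule fun_vs.basis_exists)
  have "fun_vs.span D \<subseteq> L" using D(1) L by (rule fun_vs.span_minimal)
  then have injD: "inj_on \<rho> (fun_vs.span D)" using inj inj_on_subset by blast
  have "fun_vs.independent (\<rho> ` D)" by (rule \<rho>.independent_injective_image[OF D(2) injD])
  moreover have "\<rho> ` D \<subseteq> fun_vs.span (unit_vec ` C)"
  proof -
    have "\<rho> v \<in> fun_vs.span (unit_vec ` C)" for v
    proof -
      have "\<rho> v = (\<Sum>p\<in>C. (\<lambda>q. v p * unit_vec p q))"
        using fC by (auto simp: \<rho>_def fun_eq_iff sum_fun_apply unit_vec_def if_distrib[of "(*) _"] cong: if_cong)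
      moreover have "(\<Sum>p\<in>C. (\<lambda>q. v p * unit_vec p q)) \<in> fun_vs.span (unit_vec ` C)"
        by (intro fun_vs.span_sum fun_vs.span_scale fun_vs.span_base) auto
      ultimately show ?thesis by simp
    qed
    then show ?thesis by blast
  qed
  ultimately have "card (\<rho> ` D) \<le> card (unit_vec ` C :: ('i \<Rightarrow> 'a) set)"
    using fun_vs.independent_span_bound[of "unit_vec ` C" "\<rho> ` D"] fC by blast
  also have "\<dots> \<le> card C" by (rule card_image_le[OF fC])
  also have "card C = card B" using C(2,3) by (simp add: card_image)
  finally have "card (\<rho> ` D) \<le> card B" .
  moreover have "card (\<rho> ` D) = card D"
    using injD fun_vs.span_superset[of D] inj_on_subset by (intro card_image) blast
  ultimately show ?thesis using B(4) D(4) by simp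
qed

context
  fixes r d k :: nat and L :: "(nat \<times> nat \<Rightarrow> 'a::alg_closed_field) set"
  assumes L: "L \<in> fano_planes k r d" and d: "1 \<le> d"
begin

definition coord_row :: "nat \<Rightarrow> ((nat \<times> nat \<Rightarrow> 'a) \<Rightarrow> 'a) multiset" where
  "coord_row i = image_mset (\<lambda>j. coord_form L (i, j)) (mset_set {1..d})"

lemma subspace_L: "fun_vs.subspace L" and dim_L: "fun_vs.dim L = k + 1"
  and L_X: "L \<subseteq> X_hypersurface r d"
  using L by (auto simp: fano_planes_def)

lemma L_coord_space: "v \<in> L \<Longrightarrow> v \<in> coord_space r d"
  using L_X zero_locus_subset by blast

lemma L_support: "v \<in> L \<Longrightarrow> p \<notin> {1..r} \<times> {1..d} \<Longrightarrow> v p = 0"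
  using L_coord_space[of v] unfolding coord_space_def by blast

text \<open>Evaluation at a vector of \<open>L\<close> is a point; conversely, the values of any
  point on the coordinate forms are the coordinates of a vector of \<open>L\<close>.\<close>

lemma vanishing_sum_iff_zero_locus:
  assumes "A \<subseteq> {1..r}"
  shows "forms.vanishing_sum {} A (\<lambda>_. 1) coord_row \<longleftrightarrow> L \<subseteq> zero_locus r d A"
proof -
  have val: "forms.val y (coord_row i) = (\<Prod>j=1..d. y (coord_form L (i, j)))" for y i
    by (simp add: forms.val_def coord_row_def prod_unfold_prod_mset image_mset.compositionality comp_def)
  show ?thesis
  proof
    assume vs: "forms.vanishing_sum {} A (\<lambda>_. 1) coord_row"
    show "L \<subseteq> zero_locus r d A"
    proof
      fix v assume v: "v \<in> L"
      have "forms.point {} (\<lambda>\<phi> :: (nat \<times> nat \<Rightarrow> 'a) \<Rightarrow> 'a. \<phi> v)" by (rule forms.pointI) auto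
      then have "(\<Sum>i\<in>A. forms.val (\<lambda>\<phi>. \<phi> v) (coord_row i)) = 0"
        using vs by (simp add: forms.vanishing_sum_def)
      moreover have "v \<in> coord_space r d" using v L_X zero_locus_subset by blast
      ultimately show "v \<in> zero_locus r d A"
        using v by (simp add: zero_locus_def val coord_form_def)
    qed
  next
    assume sub: "L \<subseteq> zero_locus r d A"
    show "forms.vanishing_sum {} A (\<lambda>_. 1) coord_row"
      unfolding forms.vanishing_sum_def
    proof (intro allI impI)
      fix y :: "((nat \<times> nat \<Rightarrow> 'a) \<Rightarrow> 'a) \<Rightarrow> 'a" assume y: "forms.point {} y"
      let ?v = "\<lambda>p. if p \<in> {1..r} \<times> {1..d} then y (coord_form L p) else 0"
      have "?v \<in> L"
        using subspace_L L_support y by (intro coords_of_point_in_subspace) auto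
      then have "(\<Sum>i\<in>A. \<Prod>j=1..d. ?v (i, j)) = 0" using sub by (auto simp: zero_locus_def)
      also have "(\<Sum>i\<in>A. \<Prod>j=1..d. ?v (i, j)) = (\<Sum>i\<in>A. 1 * forms.val y (coord_row i))"
        unfolding val using assms by (intro sum.cong) (auto intro!: prod.cong)
      finally show "(\<Sum>i\<in>A. 1 * forms.val y (coord_row i)) = 0" .
    qed
  qed
qed

text \<open>A coordinate that vanishes on \<open>L\<close> kills the product of its row, and that
  row alone is a splitting.\<close>

lemma coord_rows_proper:
  assumes "\<not> admits_splitting 1 r d L"
  shows "forms.proper_rows {} {1..r} (\<lambda>_. 1) coord_row"
  unfolding forms.proper_rows_def
proof (intro ballI conjI)
  fix i assume i: "i \<in> {1..r}"
  have "coord_form L (i, j) \<noteq> 0" if j: "j \<in> {1..d}" for j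
  proof
    assume z: "coord_form L (i, j) = 0"
    have "v (i, j) = 0" if "v \<in> L" for v
      using fun_cong[OF z, of v] that by (simp add: coord_form_def)
    then have "(\<Prod>j=1..d. v (i, j)) = 0" if "v \<in> L" for v
      using j that by (intro prod_zero bexI[of _ j]) auto
    then have "L \<subseteq> zero_locus r d {i}"
      using L_coord_space by (auto simp: zero_locus_def)
    then have "admits_splitting 1 r d L"
      using i unfolding admits_splitting_def by (intro exI[of _ "{i}"]) simp
    then show False using assms by simp
  qed
  then show "set_mset (coord_row i) \<inter> fun_vs.span {} = {}" by (auto simp: coord_row_def)
qed simp

lemma dim_coord_rows: "k + 1 \<le> fun_vs.dim ({} \<union> forms.vecs coord_row {1..r})"
proof -
  have "forms.vecs coord_row {1..r} = coord_form L ` ({1..r} \<times> {1..d})"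
    by (auto simp: forms.vecs_def coord_row_def)
  then show ?thesis
    using dim_le_dim_coord_forms[OF subspace_L, where R = "{1..r} \<times> {1..d}"] L_support dim_L by simp
qed

lemma dim_le_if_not_one_split:
  assumes "\<not> admits_splitting 1 r d L" "2 \<le> d"
  shows "2 * (k + 1) \<le> forms.rank_bound d r"
proof -
  have "2 * fun_vs.dim ({} \<union> forms.vecs coord_row {1..r}) \<le>
      2 * fun_vs.dim ({} :: ((nat \<times> nat \<Rightarrow> 'a) \<Rightarrow> 'a) set) + forms.rank_bound d (card {1..r})"
    using coord_rows_proper[OF assms(1)] vanishing_sum_iff_zero_locus[of "{1..r}"] L_X assms(2)
    by (intro forms.dim_vanishing_sum_le) (auto simp: coord_row_def)
  then show ?thesis using dim_coord_rows by simp
qed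

lemma two_split_if_not_one_split:
  assumes "\<not> admits_splitting 1 r d L" "3 \<le> d" "even r" "1 \<le> r" "r * d \<le> 2 * (k + 1)"
  shows "admits_splitting 2 r d L"
proof -
  have "\<exists>i\<in>{1..r}. \<exists>j\<in>{1..r}. i \<noteq> j \<and> forms.vanishing_sum {} {i, j} (\<lambda>_. 1) coord_row"
    using coord_rows_proper[OF assms(1)] vanishing_sum_iff_zero_locus[of "{1..r}"] L_X assms dim_coord_rows
    by (intro forms.vanishing_pair_of_extremal[where d = d]) (auto simp: coord_row_def)
  then obtain i j where ij: "i \<in> {1..r}" "j \<in> {1..r}" "i \<noteq> j"
      "forms.vanishing_sum {} {i, j} (\<lambda>_. 1) coord_row"
    by blast
  then have "L \<subseteq> zero_locus r d {i, j}" using vanishing_sum_iff_zero_locus[of "{i, j}"] by simp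
  then show ?thesis using ij unfolding admits_splitting_def by (intro exI[of _ "{i, j}"]) simp
qed

end

section \<open>Planes that are not one-split\<close>

text \<open>
  The rows are paired so that their products cancel; if \<open>r\<close> is odd, the last three rows have a
  common factor of degree \<open>d - 1\<close> and the remaining factors add up to zero.
\<close>

definition free_coords :: "nat \<Rightarrow> nat \<Rightarrow> (nat \<times> nat) set" where
  "free_coords r d = {i \<in> {1..<r}. odd i} \<times> {1..d} \<union> (if odd r then {(r - 1, 1)} else {})"

text \<open>An even row copies the preceding odd one, with the sign placed in column 1. For odd
  \<open>r\<close>, row \<open>r - 1\<close> has a free first entry instead, and the last branch,
  reached only for \<open>i = r\<close>, makes the first entries of the last three rows add up to
  zero.\<close>

definition paired_vec :: "nat \<Rightarrow> nat \<Rightarrow> (nat \<times> nat \<Rightarrow> 'a::field) \<Rightarrow> nat \<times> nat \<Rightarrow> 'a" where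
  "paired_vec r d u = (\<lambda>(i, j).
     if i \<notin> {1..r} \<or> j \<notin> {1..d} then 0
     else if odd i \<and> i < r then u (i, j)
     else if even i then
       (if j = 1 then (if Suc i = r then u (i, 1) else - u (i - 1, 1)) else u (i - 1, j))
     else (if j = 1 then - u (i - 2, 1) - u (i - 1, 1) else u (i - 2, j)))"

lemma finite_free_coords: "finite (free_coords r d)"
  by (simp add: free_coords_def)

lemma card_free_coords:
  assumes "2 \<le> r" "1 \<le> d"
  shows "card (free_coords r d) = (r div 2) * d + (if odd r then 1 else 0)"
proof -
  have "{i \<in> {1..<r}. odd i} = (\<lambda>b. 2 * b + 1) ` {..<r div 2}"
  proof
    show "{i \<in> {1..<r}. odd i} \<subseteq> (\<lambda>b. 2 * b + 1) ` {..<r div 2}"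
    proof
      fix i assume "i \<in> {i \<in> {1..<r}. odd i}"
      then obtain b where b: "i = 2 * b + 1" "i < r" by (auto elim: oddE)
      then have "b < r div 2" by linarith
      then show "i \<in> (\<lambda>b. 2 * b + 1) ` {..<r div 2}" using b(1) by blast
    qed
  qed auto
  then have odds: "card {i \<in> {1..<r}. odd i} = r div 2"
    by (simp add: card_image inj_on_def)
  have "card ({i \<in> {1..<r}. odd i} \<times> {1..d}) = (r div 2) * d"
    by (simp only: card_cartesian_product odds card_atLeastAtMost) simp
  then show ?thesis
    unfolding free_coords_def by (subst card_Un_disjoint) auto
qed

lemma paired_vec_free:
  assumes "p \<in> free_coords r d" "2 \<le> r" "1 \<le> d"
  shows "paired_vec r d u p = u p"
  using assms by (cases p) (auto simp: free_coords_def paired_vec_def split: if_splits)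

lemma paired_vec_add: "paired_vec r d (u + w) = paired_vec r d u + paired_vec r d w"
  and paired_vec_scale: "paired_vec r d (\<lambda>p. c * u p) = (\<lambda>p. c * paired_vec r d u p)"
  and paired_vec_0: "paired_vec r d (\<lambda>_. 0) = 0"
  by (auto simp: paired_vec_def fun_eq_iff algebra_simps)

lemma sum_pairs: "(\<Sum>i=1..2 * a. t i) = (\<Sum>b=1..a. t (2 * b - 1) + t (2 * b))"
  for t :: "nat \<Rightarrow> 'a::comm_monoid_add"
  by (induction a) (auto simp: add_ac)

lemma paired_vec_in_X:
  assumes "2 \<le> r" "1 \<le> d"
  shows "paired_vec r d u \<in> X_hypersurface r d"
proof -
  define t where "t i = (\<Prod>j=1..d. paired_vec r d u (i, j))" for i
  have split: "t i = paired_vec r d u (i, 1) * (\<Prod>j=2..d. paired_vec r d u (i, j))" for i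
    unfolding t_def using assms(2) by (simp add: prod.atLeast_Suc_atMost numeral_2_eq_2)
  have pair: "t (2 * b - 1) + t (2 * b) = 0" if "1 \<le> b" "2 * b \<le> r" "Suc (2 * b) \<noteq> r" for b
  proof -
    have "(\<Prod>j=2..d. paired_vec r d u (2 * b, j)) = (\<Prod>j=2..d. paired_vec r d u (2 * b - 1, j))"
      using that by (intro prod.cong) (auto simp: paired_vec_def)
    moreover have "paired_vec r d u (2 * b, 1) = - paired_vec r d u (2 * b - 1, 1)"
      using that assms by (auto simp: paired_vec_def)
    ultimately show ?thesis by (simp add: split)
  qed
  have "(\<Sum>i=1..r. t i) = 0"
  proof (cases "even r")
    case True
    then obtain a where a: "r = 2 * a" by blast
    have "t (2 * x - 1) + t (2 * x) = 0" if "x \<in> {1..a}" for x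
    proof (rule pair)
      show "Suc (2 * x) \<noteq> r" using a by presburger
    qed (use that a in auto)
    then show ?thesis unfolding a sum_pairs by (intro sum.neutral) blast
  next
    case False
    then obtain a where a: "r = 2 * a + 1" using oddE by blast
    then obtain b where b: "a = Suc b" using assms(1) by (cases a) auto
    have r: "r = Suc (Suc (Suc (2 * b)))" using a b by simp
    have "(\<Sum>i=1..2 * b. t i) = 0"
    proof -
      have "t (2 * x - 1) + t (2 * x) = 0" if "x \<in> {1..b}" for x
        using that r by (intro pair) auto
      then show ?thesis unfolding sum_pairs by (intro sum.neutral) blast
    qed
    moreover have "t (Suc (2 * b)) + t (Suc (Suc (2 * b))) + t (Suc (Suc (Suc (2 * b)))) = 0"
    proof -
      let ?i1 = "Suc (2 * b)" and ?i2 = "Suc (Suc (2 * b))" and ?i3 = "Suc (Suc (Suc (2 * b)))"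
      let ?W = "\<Prod>j=2..d. paired_vec r d u (?i1, j)"
      have W: "(\<Prod>j=2..d. paired_vec r d u (?i2, j)) = ?W" "(\<Prod>j=2..d. paired_vec r d u (?i3, j)) = ?W"
        using r by (intro prod.cong; auto simp: paired_vec_def)+
      have "paired_vec r d u (?i1, 1) + paired_vec r d u (?i2, 1) + paired_vec r d u (?i3, 1) = 0"
        using r assms by (auto simp: paired_vec_def)
      moreover have "t ?i1 + t ?i2 + t ?i3 =
          (paired_vec r d u (?i1, 1) + paired_vec r d u (?i2, 1) + paired_vec r d u (?i3, 1)) * ?W"
        by (simp only: split W distrib_right)
      ultimately show ?thesis by simp
    qed
    ultimately show ?thesis by (simp add: r add.assoc)
  qed
  moreover have "paired_vec r d u \<in> coord_space r d"
    by (auto simp: coord_space_def paired_vec_def)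
  ultimately show ?thesis by (simp add: zero_locus_def t_def)
qed

lemma paired_vec_in_span:
  assumes "finite S"
  shows "paired_vec r d (\<lambda>p. if p \<in> S then u p else 0) \<in> fun_vs.span ((\<lambda>t. paired_vec r d (unit_vec t)) ` S)"
  using assms
proof (induction S rule: finite_induct)
  case empty
  then show ?case by (simp add: paired_vec_0 fun_eq_iff)
next
  case (insert t S)
  let ?b = "\<lambda>t. paired_vec r d (unit_vec t)"
  have "(\<lambda>p. if p \<in> insert t S then u p else 0) =
      (\<lambda>p. u t * unit_vec t p) + (\<lambda>p. if p \<in> S then u p else 0)"
    using insert(2) by (auto simp: unit_vec_def fun_eq_iff)
  then have "paired_vec r d (\<lambda>p. if p \<in> insert t S then u p else 0) =
      (\<lambda>p. u t * ?b t p) + paired_vec r d (\<lambda>p. if p \<in> S then u p else 0)"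
    by (simp add: paired_vec_add paired_vec_scale)
  moreover have "(\<lambda>p. u t * ?b t p) \<in> fun_vs.span (?b ` insert t S)"
    by (intro fun_vs.span_scale fun_vs.span_base) auto
  moreover have "paired_vec r d (\<lambda>p. if p \<in> S then u p else 0) \<in> fun_vs.span (?b ` insert t S)"
    using insert(3) fun_vs.span_mono[of "?b ` S" "?b ` insert t S"] by blast
  ultimately show ?case by (simp only: fun_vs.span_add)
qed

lemma exists_plane_not_one_split:
  assumes r: "2 \<le> r" and d: "1 \<le> d" and k: "k + 1 \<le> (r div 2) * d + (if odd r then 1 else 0)"
  shows "\<not> fano_split TYPE('a::alg_closed_field) 1 k r d"
proof -
  \<comment> \<open>For odd \<open>r\<close> the first entries of the last three rows become
    \<open>1\<close>, \<open>\<tau>\<close> and \<open>- 1 - \<tau>\<close>, all nonzero, so that no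
    product vanishes at the vector of \<open>u0\<close>.\<close>
  obtain \<tau> :: 'a where \<tau>: "\<tau> \<notin> {0, -1}"
    using ex_new_if_finite[OF infinite_UNIV_alg_closed_field, of "{0, -1}"] by auto
  define u0 :: "nat \<times> nat \<Rightarrow> 'a" where "u0 p = (if odd r \<and> p = (r - 1, 1) then \<tau> else 1)" for p
  have nz: "paired_vec r d u0 (i, j) \<noteq> 0" if ij: "i \<in> {1..r}" "j \<in> {1..d}" for i j
  proof -
    have "- 1 - \<tau> \<noteq> 0" "\<tau> \<noteq> 0" using \<tau> by (auto simp: eq_neg_iff_add_eq_0 algebra_simps)
    moreover have "i - 2 \<noteq> i - 1" if "odd i" "i \<noteq> 1" using that by (cases i) auto
    ultimately show ?thesis using ij r by (auto simp: paired_vec_def u0_def)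
  qed
  let ?t0 = "(1, 1) :: nat \<times> nat"
  have t0: "?t0 \<in> free_coords r d" using r d by (auto simp: free_coords_def)
  have "k \<le> card (free_coords r d - {?t0})"
    using k t0 card_free_coords[OF r d] finite_free_coords[of r d] by simp
  then obtain T where T: "T \<subseteq> free_coords r d - {?t0}" "card T = k" "finite T"
    using obtain_subset_with_card_n by metis
  \<comment> \<open>Only \<open>k\<close> free coordinates besides \<open>(1, 1)\<close> are used,
    to get dimension exactly \<open>k + 1\<close>. The vector for \<open>(1, 1)\<close> carries all
    of \<open>u0\<close> outside \<open>T\<close>: it vanishes at the coordinates in
    \<open>T\<close>, which gives independence, and adding multiples of the others recovers
    \<open>paired_vec r d u0\<close>.\<close>
  define b where "b t = (if t = ?t0 then paired_vec r d (\<lambda>p. if p \<in> T then 0 else u0 p)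
      else paired_vec r d (unit_vec t))" for t
  let ?T = "insert ?t0 T"
  have Tfree: "?T \<subseteq> free_coords r d" using T(1) t0 by blast
  have t0T: "?t0 \<notin> T" using T(1) by blast
  have b_coord: "b t s = (if t = ?t0 then (if s \<in> T then 0 else u0 s) else unit_vec t s)"
    if "s \<in> ?T" for s t
    using paired_vec_free[OF _ r d, of s] that Tfree by (auto simp: b_def)
  have "b t t \<noteq> 0" if "t \<in> ?T" for t
  proof -
    have "u0 ?t0 \<noteq> 0" using \<tau> by (auto simp: u0_def)
    then show ?thesis using b_coord[OF that, of t] t0T by (auto simp: unit_vec_def)
  qed
  moreover have "b t s = 0" if "s \<in> ?T" "t \<in> ?T" "s \<noteq> t" for s t
    using b_coord[OF that(1), of t] that by (auto simp: unit_vec_def)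
  ultimately have ind: "fun_vs.independent (b ` ?T)" and inj: "inj_on b ?T"
    using independent_of_dual_coordinates[of ?T b] by blast+
  define L where "L = fun_vs.span (b ` ?T)"
  have "card (b ` ?T) = k + 1" using card_image[OF inj] T t0T by simp
  then have dimL: "fun_vs.dim L = k + 1"
    unfolding L_def using ind by (simp add: fun_vs.dim_eq_card_independent)
  have "L \<subseteq> range (paired_vec r d)"
    unfolding L_def
  proof (rule fun_vs.span_minimal)
    show "b ` ?T \<subseteq> range (paired_vec r d)" by (auto simp: b_def)
    show "fun_vs.subspace (range (paired_vec r d :: (nat \<times> nat \<Rightarrow> 'a) \<Rightarrow> _))"
      unfolding fun_vs.subspace_def
    proof (intro conjI ballI allI)
      show "0 \<in> range (paired_vec r d :: (nat \<times> nat \<Rightarrow> 'a) \<Rightarrow> _)"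
        using paired_vec_0[of r d] by (metis rangeI)
      show "x + y \<in> range (paired_vec r d)" if "x \<in> range (paired_vec r d)" "y \<in> range (paired_vec r d)"
        for x y :: "nat \<times> nat \<Rightarrow> 'a"
        using that by (auto simp: paired_vec_add[symmetric])
      show "(\<lambda>p. c * x p) \<in> range (paired_vec r d)" if "x \<in> range (paired_vec r d)"
        for c :: 'a and x
        using that by (auto simp: paired_vec_scale[symmetric])
    qed
  qed
  then have "L \<subseteq> X_hypersurface r d" using paired_vec_in_X[OF r d] by blast
  then have plane: "L \<in> fano_planes k r d"
    using dimL by (simp add: fano_planes_def L_def)
  have v0: "paired_vec r d u0 \<in> L"
  proof -
    have "u0 = (\<lambda>p. if p \<in> T then 0 else u0 p) + (\<lambda>p. if p \<in> T then u0 p else 0)"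
      by (auto simp: fun_eq_iff)
    then have "paired_vec r d u0 = b ?t0 + paired_vec r d (\<lambda>p. if p \<in> T then u0 p else 0)"
      by (metis b_def paired_vec_add)
    moreover have "b ?t0 \<in> L" unfolding L_def by (intro fun_vs.span_base) simp
    moreover have "(\<lambda>t. paired_vec r d (unit_vec t)) ` T \<subseteq> b ` ?T"
      using t0T by (auto simp: b_def image_iff)
    then have "paired_vec r d (\<lambda>p. if p \<in> T then u0 p else 0) \<in> L"
      unfolding L_def using paired_vec_in_span[OF T(3), of r d u0] fun_vs.span_mono by blast
    ultimately show ?thesis unfolding L_def by (simp only: fun_vs.span_add)
  qed
  have "\<not> admits_splitting 1 r d L"
  proof
    assume "admits_splitting 1 r d L"
    then obtain A where A: "A \<subseteq> {1..r}" "card A = 1" "L \<subseteq> zero_locus r d A"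
      by (auto simp: admits_splitting_def)
    then obtain i where i: "A = {i}" using card_1_singletonE by blast
    have "(\<Prod>j=1..d. paired_vec r d u0 (i, j)) = 0"
      using A(3) v0 by (auto simp: zero_locus_def i)
    then obtain j where "j \<in> {1..d}" "paired_vec r d u0 (i, j) = 0" by (auto simp: prod_zero_iff)
    then show False using nz[of i j] A(1) i by simp
  qed
  then show ?thesis
    using plane unfolding fano_split_def by (metis le_antisym)
qed

section \<open>The splitting statements\<close>

lemma one_split_if_dim_large:
  assumes "2 \<le> d" "forms.rank_bound d r < 2 * (k + 1)"
  shows "fano_split TYPE('a::alg_closed_field) 1 k r d"
  unfolding fano_split_def
proof
  fix L :: "(nat \<times> nat \<Rightarrow> 'a) set" assume L: "L \<in> fano_planes k r d"
  have "admits_splitting 1 r d L"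
    using dim_le_if_not_one_split[OF L] assms by (meson le_trans not_le one_le_numeral)
  then show "\<exists>lam\<ge>1. lam \<le> 1 \<and> admits_splitting lam r d L" by auto
qed

theorem theorem1p8:
  shows "(\<forall>d m. d > 1 \<and> m \<ge> 1 \<and> (m \<le> 2 \<or> d \<le> 4) \<longrightarrow>
            property_C TYPE('a::alg_closed_field) d m) \<and>
         (\<forall>r d k. r \<ge> 2 \<and> d \<ge> 3 \<and> (r \<le> 6 \<or> d = 4) \<longrightarrow>
            (even r \<longrightarrow>
               (fano_split TYPE('a) 1 k r d \<longleftrightarrow> k \<ge> (r div 2) * d)) \<and>
            (odd r \<longrightarrow>
               (fano_split TYPE('a) 1 k r d \<longleftrightarrow> k \<ge> ((r - 1) div 2) * d + 1)) \<and>
            (even r \<and> k \<ge> (r div 2) * d - 1 \<longrightarrow>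
               fano_split TYPE('a) 2 k r d))"
proof (intro conjI allI impI)
  fix d m :: nat
  assume "d > 1 \<and> m \<ge> 1 \<and> (m \<le> 2 \<or> d \<le> 4)"
  then show "property_C TYPE('a) d m" by (intro property_C_holds) auto
next
  fix r d k :: nat
  assume "r \<ge> 2 \<and> d \<ge> 3 \<and> (r \<le> 6 \<or> d = 4)" and ev: "even r"
  then have rd: "2 \<le> r" "3 \<le> d" by auto
  show "fano_split TYPE('a) 1 k r d \<longleftrightarrow> k \<ge> (r div 2) * d"
  proof
    assume "fano_split TYPE('a) 1 k r d"
    then have "\<not> k + 1 \<le> (r div 2) * d + (if odd r then 1 else 0)"
      using exists_plane_not_one_split[where 'a='a, of r d k] rd by auto
    then show "k \<ge> (r div 2) * d" by simp
  next
    assume k: "k \<ge> (r div 2) * d"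
    have "forms.rank_bound d r = 2 * ((r div 2) * d)" using ev by (simp add: forms.rank_bound_def)
    then show "fano_split TYPE('a) 1 k r d" using k rd by (intro one_split_if_dim_large) auto
  qed
next
  fix r d k :: nat
  assume "r \<ge> 2 \<and> d \<ge> 3 \<and> (r \<le> 6 \<or> d = 4)" and od: "odd r"
  then have rd: "2 \<le> r" "3 \<le> d" by auto
  have half: "(r - 1) div 2 = r div 2" using od by (auto elim: oddE)
  show "fano_split TYPE('a) 1 k r d \<longleftrightarrow> k \<ge> ((r - 1) div 2) * d + 1"
  proof
    assume "fano_split TYPE('a) 1 k r d"
    then have "\<not> k + 1 \<le> (r div 2) * d + (if odd r then 1 else 0)"
      using exists_plane_not_one_split[where 'a='a, of r d k] rd by auto
    then show "k \<ge> ((r - 1) div 2) * d + 1" using od unfolding half by simp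
  next
    assume k: "k \<ge> ((r - 1) div 2) * d + 1"
    have "r - 1 = 2 * (r div 2)" using od by (auto elim: oddE)
    then have "forms.rank_bound d r = 2 * ((r div 2) * d) + 2" using od by (simp add: forms.rank_bound_def)
    then show "fano_split TYPE('a) 1 k r d" using k rd unfolding half by (intro one_split_if_dim_large) auto
  qed
next
  fix r d k :: nat
  assume "r \<ge> 2 \<and> d \<ge> 3 \<and> (r \<le> 6 \<or> d = 4)" and k: "even r \<and> k \<ge> (r div 2) * d - 1"
  then have rd: "2 \<le> r" "3 \<le> d" and ev: "even r" by auto
  have "r * d = 2 * ((r div 2) * d)" using ev by simp
  moreover have "(r div 2) * d \<le> k + 1" using k by (simp add: le_diff_conv)
  ultimately have rk: "r * d \<le> 2 * (k + 1)" by (metis mult_le_mono2)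
  show "fano_split TYPE('a) 2 k r d"
    unfolding fano_split_def
  proof
    fix L :: "(nat \<times> nat \<Rightarrow> 'a) set" assume L: "L \<in> fano_planes k r d"
    show "\<exists>lam\<ge>1. lam \<le> 2 \<and> admits_splitting lam r d L"
    proof (cases "admits_splitting 1 r d L")
      case False
      then have "admits_splitting 2 r d L"
        using rd ev rk by (intro two_split_if_not_one_split[OF L]) auto
      then show ?thesis by (intro exI[of _ 2]) simp
    qed (auto intro: exI[of _ 1])
  qed
qed

end
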